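(* Let $d\ge1$ and let $\Omega\subset\mathbb{R}^d$ be a domain that is bounded at least in one direction (i.e. it lies between two parallel hyperplanes), with Friedrichs constant $c_{\mathsf f}>0$. Let $T>0$, $I=(0,T)$, $\Xi=I\times\Omega$, $f\in L^2(\Xi)$ and $u_0\in\mathring{H}^1(\Omega)$. Let $(u,p)\in \mathring{H}^{1;1}(\Xi)\times D(\Xi)$ be the exact solution of the heat equation $$-\nabla u+p=0\ \text{ in }\Xi,\qquad \partial_\circ u-\operatorname{div}p=f\ \text{ in }\Xi,\qquad u(0,\cdot)=u_0\ \text{ in }\Omega,$$ and let $(\tilde u,\tilde p)\in \mathring{H}^{1;1}(\Xi)\times D(\Xi)$ be an arbitrary approximation. Set $$E:=\|\nabla(u-\tilde u)\|_{L^2(\Xi)}^2+\|p-\tilde p\|_{L^2(\Xi)}^2+\|\partial_\circ(u-\tilde u)+\operatorname{div}(\tilde p-p)\|_{L^2(\Xi)}^2+\|(u-\tilde u)(T,\cdot)\|_{L^2(\Omega)}^2 .$$ Then $$\max\Big\{\|f+\operatorname{div}\tilde p-\partial_\circ\tilde u\|_{L^2(\Xi)}^2+\tfrac12\|\tilde p-\nabla\tilde u\|_{L^2(\Xi)}^2\ ;\ \tfrac{1}{1+c_{\mathsf f}^2}\big(\|\tilde p-\nabla\tilde u\|_{L^2(\Xi)}^2+\|u_0-\tilde u(0,\cdot)\|_{L^2(\Omega)}^2\big)\Big\}\le E$$ and $$E\le(1+4c_{\mathsf f}^2)\|f+\operatorname{div}\tilde p-\partial_\circ\tilde u\|_{L^2(\Xi)}^2+2\|\tilde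 p-\nabla\tilde u\|_{L^2(\Xi)}^2+2\|u_0-\tilde u(0,\cdot)\|_{L^2(\Omega)}^2 .$$
   Context: All functions and vector fields are real valued; $L^2$ is used for both scalar functions and $\mathbb{R}^d$-valued vector fields; derivatives are weak. $\nabla$ and $\operatorname{div}$ are the spatial gradient and divergence (with respect to the variable in $\Omega$), $\partial_\circ$ is the derivative with respect to time. $\mathring{H}^1(\Omega)$ is the closure in $H^1(\Omega)$ of the smooth functions with compact support in $\Omega$. The Friedrichs constant $c_{\mathsf f}>0$ is the constant in the Friedrichs inequality $\|\varphi\|_{L^2(\Omega)}\le c_{\mathsf f}\|\nabla\varphi\|_{L^2(\Omega)}$ for all $\varphi\in\mathring{H}^1(\Omega)$, which holds because $\Omega$ is bounded in one direction. $H^{0;1}(\Xi)=\{\varphi\in L^2(\Xi):\nabla\varphi\in L^2(\Xi)\}$. $\mathring{H}^{0;1}(\Xi)=\{\varphi\in H^{0;1}(\Xi):\varphi(t,\cdot)\in\mathring{H}^1(\Omega)\text{ for a.e. }t\in I\}$. $H^{1;0}(\Xi)=\{\varphi\in L^2(\Xi):\partial_\circ\varphi\in L^2(\Xi)\}$. $\mathring{H}^{1;1}(\Xi)=\mathring{H}^{0;1}(\Xi)\cap H^{1;0}(\Xi)$. $D(\Xi)=\{\phi\in L^2(\Xi):\operatorname{div}\phi\in L^2(\Xi)\}$ (vector fields with values in $\mathbb{R}^d$). For $\varphi\in H^{1;0}(\Xi)$, $\varphi(0,\cdot),\varphi(T,\cdot)\in L^2(\Omega)$ are the values at times $0$ and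 $T$ of the representative that is continuous in time with values in $L^2(\Omega)$. The stated problem is uniquely solvable. *)

theory Defs
  imports "HOL-Analysis.Analysis"
begin

text \<open>
  Elements of the Lebesgue and Sobolev spaces below are functions, not equivalence classes;
  values outside the underlying set are irrelevant, and equations between such functions are meant
  almost everywhere. The operators for weak derivatives and time traces pick a representative,
  which is unique up to null sets only.
\<close>

section \<open>Square-integrable functions\<close>

definition L2 :: "'a::euclidean_space set \<Rightarrow> ('a \<Rightarrow> 'b::euclidean_space) set" where
  "L2 S = {f. f \<in> borel_measurable (lebesgue_on S) \<and>
              integrable (lebesgue_on S) (\<lambda>x. (norm (f x))\<^sup>2)}"

definition L2_norm :: "'a::euclidean_space set \<Rightarrow> ('a \<Rightarrow> 'b::euclidean_space) \<Rightarrow> real" where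
  "L2_norm S f = sqrt (LINT x|lebesgue_on S. (norm (f x))\<^sup>2)"


section \<open>Smooth functions with compact support\<close>

primrec times_cont_diff :: "nat \<Rightarrow> ('a::euclidean_space \<Rightarrow> real) \<Rightarrow> bool" where
  "times_cont_diff 0 f \<longleftrightarrow> continuous_on UNIV f"
| "times_cont_diff (Suc k) f \<longleftrightarrow>
     (\<forall>x. f differentiable (at x)) \<and>
     (\<forall>v. times_cont_diff k (\<lambda>x. frechet_derivative f (at x) v))"

definition smooth :: "('a::euclidean_space \<Rightarrow> real) \<Rightarrow> bool" where
  "smooth f \<longleftrightarrow> (\<forall>k. times_cont_diff k f)"

definition test_functions :: "'a::euclidean_space set \<Rightarrow> ('a \<Rightarrow> real) set" where
  "test_functions S = {\<phi>. smooth \<phi> \<and> compact (closure {x. \<phi> x \<noteq> 0}) \<and>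
                          closure {x. \<phi> x \<noteq> 0} \<subseteq> S}"


section \<open>Weak derivatives\<close>

text \<open>The weak derivative in direction \<^term>\<open>v\<close>, required to be in \<open>L\<^sup>2\<close>.\<close>

definition has_weak_deriv ::
    "'a::euclidean_space set \<Rightarrow> 'a \<Rightarrow> ('a \<Rightarrow> real) \<Rightarrow> ('a \<Rightarrow> real) \<Rightarrow> bool" where
  "has_weak_deriv S v f g \<longleftrightarrow> g \<in> L2 S \<and>
     (\<forall>\<phi>\<in>test_functions S.
        (LINT x|lebesgue_on S. f x * frechet_derivative \<phi> (at x) v) =
        - (LINT x|lebesgue_on S. g x * \<phi> x))"

definition weak_deriv ::
    "'a::euclidean_space set \<Rightarrow> 'a \<Rightarrow> ('a \<Rightarrow> real) \<Rightarrow> 'a \<Rightarrow> real" where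
  "weak_deriv S v f = (SOME g. has_weak_deriv S v f g)"


section \<open>Sobolev spaces on \<open>\<Omega>\<close>\<close>

definition wgrad :: "(real^'d) set \<Rightarrow> (real^'d \<Rightarrow> real) \<Rightarrow> real^'d \<Rightarrow> real^'d" where
  "wgrad \<Omega> f = (\<lambda>x. \<chi> i. weak_deriv \<Omega> (axis i 1) f x)"

definition H1 :: "(real^'d) set \<Rightarrow> (real^'d \<Rightarrow> real) set" where
  "H1 \<Omega> = {f \<in> L2 \<Omega>. \<forall>i. \<exists>g. has_weak_deriv \<Omega> (axis i 1) f g}"

definition H1_norm :: "(real^'d) set \<Rightarrow> (real^'d \<Rightarrow> real) \<Rightarrow> real" where
  "H1_norm \<Omega> f = sqrt ((L2_norm \<Omega> f)\<^sup>2 + (L2_norm \<Omega> (wgrad \<Omega> f))\<^sup>2)"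

definition H1_ring :: "(real^'d) set \<Rightarrow> (real^'d \<Rightarrow> real) set" where
  "H1_ring \<Omega> = {f \<in> H1 \<Omega>. \<forall>\<epsilon>>0. \<exists>\<phi>\<in>test_functions \<Omega>. H1_norm \<Omega> (\<lambda>x. f x - \<phi> x) < \<epsilon>}"

definition bounded_in_one_direction :: "(real^'d) set \<Rightarrow> bool" where
  "bounded_in_one_direction \<Omega> \<longleftrightarrow>
     (\<exists>a \<alpha> \<beta>. a \<noteq> 0 \<and> (\<forall>x\<in>\<Omega>. \<alpha> \<le> a \<bullet> x \<and> a \<bullet> x \<le> \<beta>))"

definition friedrichs_constant :: "(real^'d) set \<Rightarrow> real \<Rightarrow> bool" where
  "friedrichs_constant \<Omega> c \<longleftrightarrow>
     c > 0 \<and> (\<forall>\<phi>\<in>H1_ring \<Omega>. L2_norm \<Omega> \<phi> \<le> c * L2_norm \<Omega> (wgrad \<Omega> \<phi>))"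


section \<open>Spaces on the space-time cylinder \<open>\<Xi> = (0,T) \<times> \<Omega>\<close>\<close>

definition time_deriv ::
    "(real \<times> (real^'d)) set \<Rightarrow> (real \<times> (real^'d) \<Rightarrow> real) \<Rightarrow> real \<times> (real^'d) \<Rightarrow> real" where
  "time_deriv \<Xi> f = weak_deriv \<Xi> (1, 0) f"

definition space_grad ::
    "(real \<times> (real^'d)) set \<Rightarrow> (real \<times> (real^'d) \<Rightarrow> real) \<Rightarrow> real \<times> (real^'d) \<Rightarrow> real^'d" where
  "space_grad \<Xi> f = (\<lambda>z. \<chi> i. weak_deriv \<Xi> (0, axis i 1) f z)"

definition has_space_div ::
    "(real \<times> (real^'d)) set \<Rightarrow> (real \<times> (real^'d) \<Rightarrow> real^'d) \<Rightarrow> (real \<times> (real^'d) \<Rightarrow> real) \<Rightarrow> bool" where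
  "has_space_div \<Xi> q g \<longleftrightarrow> g \<in> L2 \<Xi> \<and>
     (\<forall>\<phi>\<in>test_functions \<Xi>.
        (LINT z|lebesgue_on \<Xi>. (\<Sum>i\<in>UNIV. q z $ i * frechet_derivative \<phi> (at z) (0, axis i 1))) =
        - (LINT z|lebesgue_on \<Xi>. g z * \<phi> z))"

definition space_div ::
    "(real \<times> (real^'d)) set \<Rightarrow> (real \<times> (real^'d) \<Rightarrow> real^'d) \<Rightarrow> real \<times> (real^'d) \<Rightarrow> real" where
  "space_div \<Xi> q = (SOME g. has_space_div \<Xi> q g)"

definition H01 :: "(real \<times> (real^'d)) set \<Rightarrow> (real \<times> (real^'d) \<Rightarrow> real) set" where
  "H01 \<Xi> = {f \<in> L2 \<Xi>. \<forall>i. \<exists>g. has_weak_deriv \<Xi> (0, axis i 1) f g}"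

definition H01_ring :: "real \<Rightarrow> (real^'d) set \<Rightarrow> (real \<times> (real^'d) \<Rightarrow> real) set" where
  "H01_ring T \<Omega> = {f \<in> H01 ({0<..<T} \<times> \<Omega>).
     AE t in lebesgue_on {0<..<T}. (\<lambda>x. f (t, x)) \<in> H1_ring \<Omega>}"

definition H10 :: "(real \<times> (real^'d)) set \<Rightarrow> (real \<times> (real^'d) \<Rightarrow> real) set" where
  "H10 \<Xi> = {f \<in> L2 \<Xi>. \<exists>g. has_weak_deriv \<Xi> (1, 0) f g}"

definition H11_ring :: "real \<Rightarrow> (real^'d) set \<Rightarrow> (real \<times> (real^'d) \<Rightarrow> real) set" where
  "H11_ring T \<Omega> = H01_ring T \<Omega> \<inter> H10 ({0<..<T} \<times> \<Omega>)"

definition D_space :: "(real \<times> (real^'d)) set \<Rightarrow> (real \<times> (real^'d) \<Rightarrow> real^'d) set" where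
  "D_space \<Xi> = {q \<in> L2 \<Xi>. \<exists>g. has_space_div \<Xi> q g}"


section \<open>Values at a fixed time\<close>

text \<open>\<^term>\<open>w\<close> is the representative in \<open>C([0,T], L\<^sup>2(\<Omega>))\<close> of \<^term>\<open>f\<close>.\<close>

definition continuous_rep ::
    "real \<Rightarrow> (real^'d) set \<Rightarrow> (real \<times> (real^'d) \<Rightarrow> real) \<Rightarrow> (real \<Rightarrow> real^'d \<Rightarrow> real) \<Rightarrow> bool" where
  "continuous_rep T \<Omega> f w \<longleftrightarrow>
     (\<forall>t\<in>{0..T}. w t \<in> L2 \<Omega> \<and>
        ((\<lambda>s. L2_norm \<Omega> (\<lambda>x. w s x - w t x)) \<longlongrightarrow> 0) (at t within {0..T})) \<and>
     (AE t in lebesgue_on {0<..<T}. AE x in lebesgue_on \<Omega>. f (t, x) = w t x)"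

definition at_time ::
    "real \<Rightarrow> (real^'d) set \<Rightarrow> (real \<times> (real^'d) \<Rightarrow> real) \<Rightarrow> real \<Rightarrow> real^'d \<Rightarrow> real" where
  "at_time T \<Omega> f = (SOME w. continuous_rep T \<Omega> f w)"


section \<open>The heat equation\<close>

definition heat_solution ::
    "real \<Rightarrow> (real^'d) set \<Rightarrow> (real \<times> (real^'d) \<Rightarrow> real) \<Rightarrow> (real^'d \<Rightarrow> real) \<Rightarrow>
     (real \<times> (real^'d) \<Rightarrow> real) \<Rightarrow> (real \<times> (real^'d) \<Rightarrow> real^'d) \<Rightarrow> bool" where
  "heat_solution T \<Omega> f u0 u p \<longleftrightarrow>
     u \<in> H11_ring T \<Omega> \<and> p \<in> D_space ({0<..<T} \<times> \<Omega>) \<and>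
     (AE z in lebesgue_on ({0<..<T} \<times> \<Omega>). - space_grad ({0<..<T} \<times> \<Omega>) u z + p z = 0) \<and>
     (AE z in lebesgue_on ({0<..<T} \<times> \<Omega>).
        time_deriv ({0<..<T} \<times> \<Omega>) u z - space_div ({0<..<T} \<times> \<Omega>) p z = f z) \<and>
     (AE x in lebesgue_on \<Omega>. at_time T \<Omega> u 0 x = u0 x)"

end

theory Submission
  imports Defs
begin

text \<open>
  Write \<open>e = u - u'\<close> and \<open>q = p - p'\<close> for the errors, and \<open>R\<close> for the time derivative of \<open>e\<close> minus
  the divergence of \<open>q\<close>. The exact solution satisfies the equations almost everywhere, so the two
  computable residuals are \<open>R\<close> and the difference \<open>g\<close> of the spatial gradient of \<open>e\<close> and \<open>q\<close>.
  Expanding the square of \<open>g\<close> produces the inner product of the gradient of \<open>e\<close> with \<open>q\<close>.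
  Integration by parts in space (\<open>space_integration_by_parts\<close>) turns it into minus the inner
  product of \<open>e\<close> with the divergence of \<open>q\<close>, that is, with the time derivative of \<open>e\<close> minus \<open>R\<close>; and
  integration by parts in time (\<open>continuous_rep_exists\<close>) evaluates the inner product of \<open>e\<close> with its
  time derivative. The result is the error identity, in \<open>L\<^sup>2\<close> norms and inner products,
  \<open>\<parallel>g\<parallel>\<^sup>2 + \<parallel>e(0)\<parallel>\<^sup>2 = \<parallel>grad e\<parallel>\<^sup>2 + \<parallel>q\<parallel>\<^sup>2 + \<parallel>e(T)\<parallel>\<^sup>2 - 2 \<langle>e, R\<rangle>\<close>.
  The last term is controlled by the Young inequality and by the Friedrichs inequality for \<open>e\<close>; both
  two-sided estimates are then elementary (\<open>two_sided_bound\<close>).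

  Everything else makes the two integrations by parts rigorous for functions that are only weakly
  differentiable.

  \<^emph>\<open>Space.\<close> Membership in \<^const>\<open>H1_ring\<close> is given for almost every fixed time, whereas the gradient
  and the divergence are given by testing on the cylinder. Testing with products of functions of
  time and of space shows, for each single test function on \<open>\<Omega>\<close>, that the identity defining the
  divergence holds at almost every time. To get one exceptional null set for all test functions, a
  countable family is used that is uniformly dense together with its gradients
  (\<open>countable_uniformly_dense\<close>, \<open>slice_has_div\<close>). At a fixed time, approximation by test functions
  gives the integration by parts (\<open>H1_ring_integration_by_parts\<close>).

  \<^emph>\<open>Time.\<close> A function with weak time derivative \<open>h\<close> differs from the primitive
  \<open>W(t,x) = \<integral>\<^sub>0\<^sup>t h(s,x) ds\<close> by a function with vanishing weak time derivative. Such a function does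
  not depend on time, because every test function in time is, up to a multiple of a fixed bump, the
  derivative of a test function (\<open>test_primitive\<close>). So \<open>c(x) + W(t,x)\<close> is the representative that is
  continuous in time, and its energy balance is a Fubini computation for each fixed \<open>x\<close>
  (\<open>primitive_energy\<close>).

  Uniqueness of weak derivatives, and the vanishing of the functions above, come from the fundamental
  lemma of the calculus of variations. It is proved with explicit smooth bumps on boxes; these are
  products of bumps in the single coordinates, so that in the cylinder it is enough to test with
  products of functions of time and of space.
\<close>

section \<open>Smooth functions\<close>

text \<open>
  The class \<^const>\<open>times_cont_diff\<close> is defined through \<^const>\<open>frechet_derivative\<close>; any explicitly
  known derivative may be used instead, which is what makes the inductions below possible.
\<close>

lemma times_cont_diff_SucI:
  assumes "\<And>x. (f has_derivative f' x) (at x)" "\<And>v. times_cont_diff k (\<lambda>x. f' x v)"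
  shows "times_cont_diff (Suc k) f"
proof -
  have "frechet_derivative f (at x) = f' x" for x
    using frechet_derivative_at[OF assms(1)] by simp
  then show ?thesis
    using assms by (auto simp: differentiable_def)
qed

lemma times_cont_diff_SucD:
  assumes "times_cont_diff (Suc k) f"
  shows "(f has_derivative frechet_derivative f (at x)) (at x)"
    "times_cont_diff k (\<lambda>x. frechet_derivative f (at x) v)"
  using assms by (auto simp: frechet_derivative_works[symmetric])

lemma times_cont_diff_Suc_imp: "times_cont_diff (Suc k) f \<Longrightarrow> times_cont_diff k f"
proof (induction k arbitrary: f)
  case 0
  then show ?case
    using times_cont_diff_SucD(1)[OF 0] by (auto intro!: has_derivative_continuous_on)
next
  case (Suc k)
  show ?case
  proof (rule times_cont_diff_SucI)
    show "(f has_derivative frechet_derivative f (at x)) (at x)" for x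
      using times_cont_diff_SucD(1)[OF Suc.prems] .
    show "times_cont_diff k (\<lambda>x. frechet_derivative f (at x) v)" for v
      using times_cont_diff_SucD(2)[OF Suc.prems] by (rule Suc.IH)
  qed
qed

lemma times_cont_diff_const: "times_cont_diff k (\<lambda>x. c)"
proof (induction k arbitrary: c)
  case (Suc k)
  show ?case by (rule times_cont_diff_SucI[where f' = "\<lambda>x v. 0"]) (auto intro: Suc)
qed simp

lemma times_cont_diff_add:
  "times_cont_diff k f \<Longrightarrow> times_cont_diff k g \<Longrightarrow> times_cont_diff k (\<lambda>x. f x + g x)"
proof (induction k arbitrary: f g)
  case (Suc k)
  note D = times_cont_diff_SucD[OF Suc.prems(1)] times_cont_diff_SucD[OF Suc.prems(2)]
  show ?case
    by (rule times_cont_diff_SucI[OF has_derivative_add[OF D(1,3)] Suc.IH[OF D(2,4)]])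
qed (auto intro: continuous_intros)

lemma times_cont_diff_mult:
  "times_cont_diff k f \<Longrightarrow> times_cont_diff k g \<Longrightarrow> times_cont_diff k (\<lambda>x. f x * g x)"
proof (induction k arbitrary: f g)
  case (Suc k)
  note D = times_cont_diff_SucD[OF Suc.prems(1)] times_cont_diff_SucD[OF Suc.prems(2)]
  show ?case
  proof (rule times_cont_diff_SucI)
    show "((\<lambda>x. f x * g x) has_derivative
      (\<lambda>v. f x * frechet_derivative g (at x) v + frechet_derivative f (at x) v * g x)) (at x)" for x
      by (intro has_derivative_mult D)
    show "times_cont_diff k (\<lambda>x. f x * frechet_derivative g (at x) v + frechet_derivative f (at x) v * g x)" for v
      by (rule times_cont_diff_add[OF Suc.IH[OF times_cont_diff_Suc_imp[OF Suc.prems(1)] D(4)]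
            Suc.IH[OF D(2) times_cont_diff_Suc_imp[OF Suc.prems(2)]]])
  qed
qed (auto intro: continuous_intros)

lemma times_cont_diff_affine:
  assumes L: "bounded_linear L"
  shows "times_cont_diff k f \<Longrightarrow> times_cont_diff k (\<lambda>x. f (c + L x))"
proof (induction k arbitrary: f)
  case 0
  have "continuous_on UNIV (\<lambda>x. c + L x)"
    by (intro continuous_intros linear_continuous_on L)
  with 0 show ?case
    by (auto intro: continuous_on_compose2[where t = UNIV])
next
  case (Suc k)
  note D = times_cont_diff_SucD[OF Suc.prems(1)]
  show ?case
  proof (rule times_cont_diff_SucI)
    have "((\<lambda>x. c + L x) has_derivative L) (at x)" for x
      using L by (auto intro!: derivative_eq_intros bounded_linear_imp_has_derivative)
    then show "((\<lambda>x. f (c + L x)) has_derivative (\<lambda>v. frechet_derivative f (at (c + L x)) (L v))) (at x)" for x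
      by (rule has_derivative_compose[OF _ D(1)])
    show "times_cont_diff k (\<lambda>x. frechet_derivative f (at (c + L x)) (L v))" for v
      by (rule Suc.IH[OF D(2)])
  qed
qed

lemma smooth_const: "smooth (\<lambda>x. c)"
  by (simp add: smooth_def times_cont_diff_const)

lemma smooth_add: "smooth f \<Longrightarrow> smooth g \<Longrightarrow> smooth (\<lambda>x. f x + g x)"
  by (simp add: smooth_def times_cont_diff_add)

lemma smooth_mult: "smooth f \<Longrightarrow> smooth g \<Longrightarrow> smooth (\<lambda>x. f x * g x)"
  by (simp add: smooth_def times_cont_diff_mult)

lemma smooth_diff: "smooth f \<Longrightarrow> smooth g \<Longrightarrow> smooth (\<lambda>x. f x - g x)"
  using smooth_add[of f "\<lambda>x. -1 * g x"] smooth_mult[OF smooth_const, of g "-1"] by simp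

lemma smooth_affine: "bounded_linear L \<Longrightarrow> smooth f \<Longrightarrow> smooth (\<lambda>x. f (c + L x))"
  by (simp add: smooth_def times_cont_diff_affine)

lemma smooth_linear: "bounded_linear L \<Longrightarrow> smooth f \<Longrightarrow> smooth (\<lambda>x. f (L x))"
  using smooth_affine[of L f 0] by simp

lemma smooth_prod: "(\<And>i. i \<in> I \<Longrightarrow> smooth (f i)) \<Longrightarrow> smooth (\<lambda>x. \<Prod>i\<in>I. f i x)"
  by (induction I rule: infinite_finite_induct) (auto intro: smooth_const smooth_mult)

lemma smooth_deriv: "smooth f \<Longrightarrow> smooth (\<lambda>x. frechet_derivative f (at x) v)"
  unfolding smooth_def using times_cont_diff_SucD(2) by blast

lemma smooth_has_derivative: "smooth f \<Longrightarrow> (f has_derivative frechet_derivative f (at x)) (at x)"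
  unfolding smooth_def using times_cont_diff_SucD(1) by blast

lemma smooth_continuous: "smooth f \<Longrightarrow> continuous_on UNIV f"
  unfolding smooth_def by (metis times_cont_diff.simps(1))

lemma smooth_borel [measurable_dest]: "smooth f \<Longrightarrow> f \<in> borel_measurable borel"
  by (intro borel_measurable_continuous_onI smooth_continuous)

lemma smooth_realI:
  fixes f f' :: "real \<Rightarrow> real"
  assumes "\<And>x. (f has_real_derivative f' x) (at x)" "smooth f'"
  shows "smooth f"
  unfolding smooth_def
proof
  fix k
  have "times_cont_diff (Suc k) f"
    by (rule times_cont_diff_SucI[where f' = "\<lambda>x v. f' x * v"])
      (use assms in \<open>auto simp: has_field_derivative_def smooth_def intro!: times_cont_diff_mult times_cont_diff_const\<close>)
  then show "times_cont_diff k f"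
    by (rule times_cont_diff_Suc_imp)
qed

lemma smooth_real_derivative:
  fixes f :: "real \<Rightarrow> real"
  assumes "smooth f"
  shows "(f has_real_derivative frechet_derivative f (at x) 1) (at x)"
proof -
  have D: "(f has_derivative frechet_derivative f (at x)) (at x)"
    by (rule smooth_has_derivative[OF assms])
  have "frechet_derivative f (at x) v = frechet_derivative f (at x) 1 * v" for v
    using linear_scale[OF has_derivative_linear[OF D], of v 1] by simp
  then show ?thesis
    using D unfolding has_field_derivative_def by (metis (no_types, lifting) ext)
qed

lemma frechet_derivative_real:
  fixes f :: "real \<Rightarrow> real"
  assumes "(f has_real_derivative D) (at x)"
  shows "frechet_derivative f (at x) v = D * v"
  using frechet_derivative_at[OF assms[unfolded has_field_derivative_def]] by metis

section \<open>Bump functions\<close>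

text \<open>
  The derivatives of \<open>exp (- 1 / x)\<close>, extended by \<open>0\<close> to the left, are combinations of the functions
  \<open>flat k\<close>; this family is closed under differentiation, so smoothness follows by one induction.
\<close>

definition flat :: "nat \<Rightarrow> real \<Rightarrow> real" where
  "flat k x = (if x \<le> 0 then 0 else exp (- (1 / x)) / x ^ k)"

lemma flat_nonneg: "flat k x \<ge> 0"
  by (simp add: flat_def)

text \<open>
  This bound gives the differentiability at \<open>0\<close>. With \<open>y = 1 / x\<close> it says that
  \<open>exp y\<close> is at least the Taylor term \<open>y ^ (k + 1) / fact (k + 1)\<close>.
\<close>

lemma flat_le: "flat k x \<le> fact (Suc k) * \<bar>x\<bar>"
proof (cases "x \<le> 0")
  case False
  define y where "y = 1 / x"
  have y: "y > 0" using False by (simp add: y_def)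
  have "(\<Sum>n\<in>{Suc k}. y ^ n /\<^sub>R fact n) \<le> exp y"
    unfolding exp_def using y by (intro sum_le_suminf summable_exp_generic) auto
  then have "y ^ Suc k \<le> fact (Suc k) * exp y"
    by (simp add: divide_simps mult.commute del: power_Suc fact_Suc)
  then have "y ^ Suc k * exp (- y) \<le> fact (Suc k)"
    by (simp add: exp_minus divide_simps del: power_Suc fact_Suc)
  then have "y ^ Suc k * exp (- y) * x \<le> fact (Suc k) * x"
    using False by (intro mult_right_mono) auto
  moreover have "flat k x = y ^ Suc k * exp (- y) * x"
    using False by (simp add: flat_def y_def field_simps)
  ultimately show ?thesis using False by (simp del: fact_Suc)
qed (simp add: flat_def mult_nonneg_nonpos del: fact_Suc)

lemma flat_derivative:
  "(flat k has_real_derivative flat (k + 2) x - real k * flat (k + 1) x) (at x)"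
proof -
  consider "x < 0" | "x > 0" | "x = 0" by linarith
  then show ?thesis
  proof cases
    case 1
    have "((\<lambda>_. 0) has_real_derivative 0) (at x)" by simp
    then have "(flat k has_real_derivative 0) (at x)"
      by (rule has_field_derivative_transform_within_open[where S = "{..<0}"])
        (use 1 in \<open>auto simp: flat_def\<close>)
    then show ?thesis using 1 by (simp add: flat_def)
  next
    case 2
    have "((\<lambda>x. exp (- (1 / x)) * (1 / x) ^ k) has_real_derivative
        exp (- (1 / x)) / x^(k+2) - real k * (exp (- (1 / x)) / x^(k+1))) (at x)"
      using 2
      apply (cases k)
       apply (auto intro!: derivative_eq_intros simp: field_simps power2_eq_square)
      subgoal for m by (cases m) auto
      done
    then have "((\<lambda>x. exp (- (1 / x)) * (1 / x) ^ k) has_real_derivative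
        flat (k + 2) x - real k * flat (k + 1) x) (at x)"
      using 2 by (simp add: flat_def)
    then show ?thesis
      by (rule has_field_derivative_transform_within_open[where S = "{0<..}"])
        (use 2 in \<open>auto simp: flat_def field_simps\<close>)
  next
    case 3
    \<comment> \<open>The difference quotient of \<open>flat k\<close> at \<open>0\<close> is \<open>flat (k + 1)\<close>.\<close>
    have "((\<lambda>h. flat (k + 1) h) \<longlongrightarrow> 0) (at 0)"
    proof (rule tendsto_sandwich[of "\<lambda>_. 0" _ _ "\<lambda>h. fact (Suc (k+1)) * \<bar>h\<bar>"])
      have "((\<lambda>h::real. fact (Suc (k+1)) * \<bar>h\<bar>) \<longlongrightarrow> fact (Suc (k+1)) * \<bar>0\<bar>) (at 0)"
        by (intro tendsto_intros)
      then show "((\<lambda>h::real. fact (Suc (k+1)) * \<bar>h\<bar>) \<longlongrightarrow> 0) (at 0)" by simp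
    qed (use flat_nonneg flat_le in \<open>auto simp del: fact_Suc\<close>)
    moreover have "(flat k (0 + h) - flat k 0) / h = flat (k + 1) h" for h
      by (simp add: flat_def)
    ultimately have "(flat k has_real_derivative 0) (at 0)"
      by (simp add: DERIV_def)
    then show ?thesis using 3 by (simp add: flat_def)
  qed
qed

lemma smooth_flat: "smooth (flat k)"
  unfolding smooth_def
proof
  fix n
  show "times_cont_diff n (flat k)"
  proof (induction n arbitrary: k)
    case 0
    show ?case
      using flat_derivative[of k] by (auto intro!: continuous_at_imp_continuous_on DERIV_isCont)
  next
    case (Suc n)
    show ?case
    proof (rule times_cont_diff_SucI[where f' = "\<lambda>x v. (flat (k + 2) x + (- real k) * flat (k + 1) x) * v"])
      show "(flat k has_derivative (\<lambda>v. (flat (k + 2) x + (- real k) * flat (k + 1) x) * v)) (at x)" for x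
        using flat_derivative[of k x] by (simp add: has_field_derivative_def)
      show "times_cont_diff n (\<lambda>x. (flat (k + 2) x + (- real k) * flat (k + 1) x) * v)" for v
        by (intro times_cont_diff_mult times_cont_diff_add times_cont_diff_const Suc.IH)
    qed
  qed
qed

text \<open>
  A smooth function that is positive exactly on the box between \<open>a\<close> and \<open>b\<close> (for \<open>n > 0\<close>). The
  parameter \<open>n\<close> scales the arguments, since \<open>exp (- 1 / (n * x))\<close> tends to \<open>1\<close> for every \<open>x > 0\<close>; so
  the bumps converge boundedly to the indicator function of the box.
\<close>

definition box_bump :: "nat \<Rightarrow> 'a::euclidean_space \<Rightarrow> 'a \<Rightarrow> 'a \<Rightarrow> real" where
  "box_bump n a b x =
     (\<Prod>i\<in>Basis. flat 0 (real n * (x \<bullet> i - a \<bullet> i)) * flat 0 (real n * (b \<bullet> i - x \<bullet> i)))"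

lemma flat0_le_1: "flat 0 x \<le> 1"
  by (simp add: flat_def)

lemma box_bump_nonneg: "box_bump n a b x \<ge> 0"
  unfolding box_bump_def by (intro prod_nonneg ballI mult_nonneg_nonneg flat_nonneg)

lemma box_bump_le_1: "box_bump n a b x \<le> 1"
  unfolding box_bump_def
  by (intro prod_le_1 conjI mult_nonneg_nonneg flat_nonneg mult_le_one flat0_le_1)

lemma smooth_box_bump: "smooth (box_bump n a b)"
proof -
  have "smooth (\<lambda>x. flat 0 (- (real n * (a \<bullet> i)) + real n * (x \<bullet> i)) *
       flat 0 (real n * (b \<bullet> i) + (- real n) * (x \<bullet> i)))" for i :: 'a
    by (intro smooth_mult smooth_affine smooth_flat bounded_linear_intros)
  then show ?thesis
    unfolding box_bump_def[abs_def]
    by (intro smooth_prod) (simp add: algebra_simps)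
qed

lemma box_bump_eq_0: "x \<notin> box a b \<Longrightarrow> box_bump n a b x = 0"
  unfolding box_bump_def box_def
  by (fastforce simp: flat_def mult_le_0_iff not_less intro!: prod_zero)

lemma box_bump_pos: "x \<in> box a b \<Longrightarrow> n > 0 \<Longrightarrow> box_bump n a b x > 0"
  unfolding box_bump_def box_def
  by (auto simp: flat_def mult_le_0_iff intro!: prod_pos)

lemma box_bump_tendsto: "(\<lambda>n. box_bump n a b x) \<longlonglongrightarrow> indicator (box a b) x"
proof (cases "x \<in> box a b")
  case True
  have *: "(\<lambda>n. flat 0 (real n * y)) \<longlonglongrightarrow> 1" if "y > 0" for y
  proof (rule Lim_transform_eventually)
    have "(\<lambda>n. exp (- (inverse (real n) * inverse y))) \<longlonglongrightarrow> exp (- (0 * inverse y))"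
      by (intro tendsto_intros lim_inverse_n)
    then show "(\<lambda>n. exp (- (inverse (real n) * inverse y))) \<longlonglongrightarrow> 1" by simp
    show "\<forall>\<^sub>F n in sequentially. exp (- (inverse (real n) * inverse y)) = flat 0 (real n * y)"
      using eventually_gt_at_top[of 0]
      by eventually_elim (use that in \<open>auto simp: flat_def mult_le_0_iff divide_inverse\<close>)
  qed
  have "(\<lambda>n. box_bump n a b x) \<longlonglongrightarrow> (\<Prod>i\<in>(Basis::'a set). 1 * 1)"
    unfolding box_bump_def using True
    by (intro tendsto_prod tendsto_mult *) (auto simp: box_def)
  then show ?thesis using True by simp
qed (simp add: box_bump_eq_0)

lemma box_bump_test:
  assumes "cbox a b \<subseteq> S"
  shows "box_bump n a b \<in> test_functions S"
proof -
  have "closure {x. box_bump n a b x \<noteq> 0} \<subseteq> cbox a b"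
    using box_bump_eq_0 box_subset_cbox[of a b] by (intro closure_minimal subsetI) blast+
  moreover from this have "compact (closure {x. box_bump n a b x \<noteq> 0})"
    by (meson bounded_cbox bounded_subset closed_closure compact_eq_bounded_closed)
  ultimately show ?thesis
    using assms smooth_box_bump by (auto simp: test_functions_def)
qed

text \<open>
  The product structure is what allows testing in the space-time cylinder with a function of time
  times a function of space.
\<close>

lemma box_bump_Pair:
  "box_bump n (a, a') (b, b') (x, x') = box_bump n a b x * box_bump n a' b' x'"
  unfolding box_bump_def sum_Basis_prod_eq prod.union_disjoint
  apply (subst Basis_prod_def)
  apply (subst prod.union_disjoint)
     apply (auto simp: prod.reindex inj_on_def)
  done

section \<open>The fundamental lemma of the calculus of variations\<close>

text \<open>
  The positive and the negative part of \<open>g\<close> define two finite measures that agree on boxes, an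
  intersection-stable generator of the Borel sets. Hence they are equal, and so are their densities.
\<close>

lemma AE_0_if_box_integrals_0:
  fixes g :: "'a::euclidean_space \<Rightarrow> real"
  assumes g: "integrable lborel g"
    and z: "\<And>a b. (\<integral>x. indicator (box a b) x * g x \<partial>lborel) = 0"
  shows "AE x in lborel. g x = 0"
proof -
  note [measurable] = borel_measurable_integrable[OF g]
  let ?P = "\<lambda>x. max 0 (g x)" and ?N = "\<lambda>x. max 0 (- g x)"
  have int: "integrable lborel ?P" "integrable lborel ?N"
    using g by auto
  have em: "emeasure (density lborel (\<lambda>x. ennreal (h x))) (box a b) = ennreal (\<integral>x. indicator (box a b) x * h x \<partial>lborel)"
    if h: "integrable lborel h" "\<And>x. h x \<ge> 0" for h :: "'a \<Rightarrow> real" and a b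
  proof -
    note [measurable] = borel_measurable_integrable[OF h(1)]
    have "emeasure (density lborel (\<lambda>x. ennreal (h x))) (box a b) = (\<integral>\<^sup>+x. ennreal (indicator (box a b) x * h x) \<partial>lborel)"
      by (subst emeasure_density) (auto intro!: nn_integral_cong simp: indicator_def)
    also have "\<dots> = ennreal (\<integral>x. indicator (box a b) x * h x \<partial>lborel)"
      using h integrable_mult_indicator[of "box a b" lborel h]
      by (intro nn_integral_eq_integral) auto
    finally show ?thesis .
  qed
  have "density lborel (\<lambda>x. ennreal (?P x)) = density lborel (\<lambda>x. ennreal (?N x))"
  proof (rule measure_eqI_generator_eq)
    let ?E = "range (\<lambda>(a, b). box a b::'a set)"
    show "Int_stable ?E"
      by (auto simp: Int_stable_def box_Int_box)
    show "?E \<subseteq> Pow UNIV" "sets (density lborel (\<lambda>x. ennreal (?P x))) = sigma_sets UNIV ?E"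
      "sets (density lborel (\<lambda>x. ennreal (?N x))) = sigma_sets UNIV ?E"
      by (simp_all add: borel_eq_box)
    let ?A = "\<lambda>n::nat. box (- (real n *\<^sub>R One)) (real n *\<^sub>R One) :: 'a set"
    show "range ?A \<subseteq> ?E" "(\<Union>i. ?A i) = UNIV"
      unfolding UN_box_eq_UNIV by auto
    show "emeasure (density lborel (\<lambda>x. ennreal (?P x))) (?A i) \<noteq> \<infinity>" for i
      by (subst em) (use int in auto)
    fix X assume "X \<in> ?E"
    then obtain a b where X: "X = box a b" by auto
    have "(\<integral>x. indicator (box a b) x * ?P x \<partial>lborel) - (\<integral>x. indicator (box a b) x * ?N x \<partial>lborel)
        = (\<integral>x. indicator (box a b) x * ?P x - indicator (box a b) x * ?N x \<partial>lborel)"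
      using integrable_mult_indicator[of "box a b" lborel ?P] integrable_mult_indicator[of "box a b" lborel ?N] int
      by (intro Bochner_Integration.integral_diff[symmetric]) auto
    also have "\<dots> = (\<integral>x. indicator (box a b) x * g x \<partial>lborel)"
      by (intro Bochner_Integration.integral_cong) (auto simp: indicator_def)
    finally show "emeasure (density lborel (\<lambda>x. ennreal (?P x))) X =
        emeasure (density lborel (\<lambda>x. ennreal (?N x))) X"
      using z[of a b] int unfolding X by (subst (1 2) em) auto
  qed
  then have "AE x in lborel. ennreal (?P x) = ennreal (?N x)"
    by (intro sigma_finite_measure.density_unique[OF sigma_finite_lborel]) auto
  then show ?thesis
    by eventually_elim (auto simp: max_def split: if_splits)
qed

text \<open>
  By dominated convergence, integrals against bumps pass to integrals over boxes. Localising to one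
  closed box in \<open>S\<close> reduces the claim to the preceding lemma, and countably many closed boxes cover \<open>S\<close>.
\<close>

lemma AE_0_if_box_bump_integrals_0:
  fixes g :: "'a::euclidean_space \<Rightarrow> real"
  assumes S: "open S" and [measurable]: "g \<in> borel_measurable borel"
    and int: "\<And>a b. cbox a b \<subseteq> S \<Longrightarrow> integrable lborel (\<lambda>x. indicator (cbox a b) x * g x)"
    and z: "\<And>a b n. cbox a b \<subseteq> S \<Longrightarrow> (\<integral>x. g x * box_bump n a b x \<partial>lborel) = 0"
  shows "AE x in lborel. x \<in> S \<longrightarrow> g x = 0"
proof -
  have box0: "(\<integral>x. indicator (box a b) x * g x \<partial>lborel) = 0" if ab: "cbox a b \<subseteq> S" for a b
  proof -
    have [measurable]: "box_bump n a b \<in> borel_measurable borel" for n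
      by (intro smooth_borel smooth_box_bump)
    have "(\<lambda>n. \<integral>x. g x * box_bump n a b x \<partial>lborel) \<longlonglongrightarrow> (\<integral>x. g x * indicator (box a b) x \<partial>lborel)"
    proof (rule integral_dominated_convergence[where w = "\<lambda>x. norm (indicator (cbox a b) x * g x)"])
      show "integrable lborel (\<lambda>x. norm (indicator (cbox a b) x * g x))"
        by (intro integrable_norm int ab)
      show "AE x in lborel. (\<lambda>n. g x * box_bump n a b x) \<longlonglongrightarrow> g x * indicator (box a b) x"
        by (intro AE_I2 tendsto_mult tendsto_const box_bump_tendsto)
      show "AE x in lborel. norm (g x * box_bump n a b x) \<le> norm (indicator (cbox a b) x * g x)" for n
      proof (rule AE_I2)
        fix x
        show "norm (g x * box_bump n a b x) \<le> norm (indicator (cbox a b) x * g x)"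
        proof (cases "x \<in> cbox a b")
          case True
          then show ?thesis
            using box_bump_nonneg[of n a b x] box_bump_le_1[of n a b x]
            by (auto simp: abs_mult intro: mult_right_le_one_le)
        next
          case False
          then have "x \<notin> box a b" using box_subset_cbox[of a b] by blast
          then show ?thesis by (simp add: box_bump_eq_0)
        qed
      qed
    qed auto
    then have "(\<integral>x. g x * indicator (box a b) x \<partial>lborel) = 0"
      by (simp add: z[OF ab] LIMSEQ_const_iff)
    then show ?thesis by (simp add: mult.commute)
  qed
  have loc: "AE x in lborel. x \<in> cbox a b \<longrightarrow> g x = 0" if ab: "cbox a b \<subseteq> S" for a b
  proof -
    have "AE x in lborel. indicator (box a b) x * g x = 0"
    proof (rule AE_0_if_box_integrals_0)
      have "integrable lborel (\<lambda>x. indicator (box a b) x *\<^sub>R (indicator (cbox a b) x * g x))"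
        by (intro integrable_mult_indicator int ab) auto
      also have "(\<lambda>x. indicator (box a b) x *\<^sub>R (indicator (cbox a b) x * g x)) = (\<lambda>x. indicator (box a b) x * g x)"
        using box_subset_cbox[of a b] by (auto simp: indicator_def fun_eq_iff)
      finally show "integrable lborel (\<lambda>x. indicator (box a b) x * g x)" .
      fix c d
      obtain l u where lu: "box c d \<inter> box a b = box l u"
        using box_Int_box by blast
      have eq: "(\<integral>x. indicator (box c d) x * (indicator (box a b) x * g x) \<partial>lborel)
          = (\<integral>x. indicator (box l u) x * g x \<partial>lborel)"
        unfolding lu[symmetric] by (intro Bochner_Integration.integral_cong) (auto simp: indicator_def)
      show "(\<integral>x. indicator (box c d) x * (indicator (box a b) x * g x) \<partial>lborel) = 0"
      proof (cases "box l u = {}")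
        case False
        then have "cbox l u = closure (box l u)"
          by (simp add: closure_box)
        also have "\<dots> \<subseteq> cbox a b"
          using lu box_subset_cbox[of a b] by (intro closure_minimal) auto
        finally show ?thesis
          unfolding eq using ab by (intro box0) auto
      qed (simp add: eq)
    qed
    moreover have "AE x in lborel. x \<notin> cbox a b - box a b"
    proof -
      have "cbox a b - box a b \<in> null_sets lebesgue"
        using negligible_frontier_interval[of a b] by (simp add: negligible_iff_null_sets)
      then have "AE x in lebesgue. x \<notin> cbox a b - box a b"
        by (rule AE_not_in)
      then show ?thesis by (simp add: AE_completion_iff)
    qed
    ultimately show ?thesis
      by eventually_elim (auto simp: indicator_def)
  qed
  obtain D where D: "countable D" "D \<subseteq> Pow S" "\<And>X. X \<in> D \<Longrightarrow> \<exists>a b. X = cbox a b" "\<Union>D = S"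
    using open_countable_Union_open_cbox[OF S] by metis
  have "AE x in lborel. \<forall>X\<in>D. x \<in> X \<longrightarrow> g x = 0"
  proof (subst AE_ball_countable[OF D(1)], intro ballI)
    fix X assume X: "X \<in> D"
    then obtain a b where "X = cbox a b" using D(3) by blast
    then show "AE x in lborel. x \<in> X \<longrightarrow> g x = 0"
      using loc[of a b] D(2) X by auto
  qed
  then show ?thesis
    by eventually_elim (use D(4) in auto)
qed

section \<open>Square-integrable functions\<close>

lemma open_sets_lebesgue [simp]: "open S \<Longrightarrow> S \<in> sets lebesgue"
  by (intro sets_completionI_sets) auto

lemma L2_measurable: "f \<in> L2 S \<Longrightarrow> f \<in> borel_measurable (lebesgue_on S)"
  by (simp add: L2_def)

lemma L2_integrable: "f \<in> L2 S \<Longrightarrow> integrable (lebesgue_on S) (\<lambda>x. (norm (f x))\<^sup>2)"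
  by (simp add: L2_def)

lemma L2_norm_sq: "(L2_norm S f)\<^sup>2 = (LINT x|lebesgue_on S. (norm (f x))\<^sup>2)"
  by (simp add: L2_norm_def)

lemma L2I_bound:
  assumes "f \<in> borel_measurable (lebesgue_on S)" "integrable (lebesgue_on S) h"
    "AE x in lebesgue_on S. (norm (f x))\<^sup>2 \<le> h x"
  shows "f \<in> L2 S"
proof -
  have "integrable (lebesgue_on S) (\<lambda>x. (norm (f x))\<^sup>2)"
    by (rule Bochner_Integration.integrable_bound[OF assms(2)]) (use assms in auto)
  then show ?thesis using assms by (simp add: L2_def)
qed

lemma norm_add_sq_le: "(norm (a + b))\<^sup>2 \<le> 2 * (norm a)\<^sup>2 + 2 * (norm b)\<^sup>2"
  for a :: "'b::real_normed_vector"
proof -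
  have "(norm (a + b))\<^sup>2 \<le> (norm a + norm b)\<^sup>2"
    by (intro power_mono norm_triangle_ineq norm_ge_zero)
  also have "\<dots> \<le> 2 * (norm a)\<^sup>2 + 2 * (norm b)\<^sup>2"
    using sum_squares_bound[of "norm a" "norm b"] by (simp add: power2_sum)
  finally show ?thesis .
qed

lemma L2_add:
  assumes "f \<in> L2 S" "g \<in> L2 S" shows "(\<lambda>x. f x + g x) \<in> L2 S"
proof (rule L2I_bound)
  show "(\<lambda>x. f x + g x) \<in> borel_measurable (lebesgue_on S)"
    using assms by (intro borel_measurable_add L2_measurable)
  show "integrable (lebesgue_on S) (\<lambda>x. 2 * (norm (f x))\<^sup>2 + 2 * (norm (g x))\<^sup>2)"
    using assms by (intro Bochner_Integration.integrable_add integrable_mult_right L2_integrable)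
qed (auto simp: norm_add_sq_le)

lemma L2_scale:
  fixes f :: "'a::euclidean_space \<Rightarrow> 'b::euclidean_space"
  assumes "f \<in> L2 S" shows "(\<lambda>x. c *\<^sub>R f x) \<in> L2 S"
  using assms by (auto simp: L2_def power_mult_distrib)

lemma L2_diff:
  assumes "f \<in> L2 S" "g \<in> L2 S" shows "(\<lambda>x. f x - g x) \<in> L2 S"
  using L2_add[OF assms(1) L2_scale[OF assms(2), of "-1"]] by simp

lemma L2_inner_integrable:
  assumes "f \<in> L2 S" "g \<in> L2 S" shows "integrable (lebesgue_on S) (\<lambda>x. f x \<bullet> g x)"
proof (rule Bochner_Integration.integrable_bound)
  show "integrable (lebesgue_on S) (\<lambda>x. (norm (f x))\<^sup>2 + (norm (g x))\<^sup>2)"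
    using assms by (intro Bochner_Integration.integrable_add L2_integrable)
  show "(\<lambda>x. f x \<bullet> g x) \<in> borel_measurable (lebesgue_on S)"
    using assms by (intro borel_measurable_inner L2_measurable)
  have "\<bar>a \<bullet> b\<bar> \<le> (norm a)\<^sup>2 + (norm b)\<^sup>2" for a b :: 'b
    using Cauchy_Schwarz_ineq2[of a b] sum_squares_bound[of "norm a" "norm b"]
      mult_nonneg_nonneg[of "norm a" "norm b"] by simp
  then show "AE x in lebesgue_on S. norm (f x \<bullet> g x) \<le> norm ((norm (f x))\<^sup>2 + (norm (g x))\<^sup>2)"
    by auto
qed

lemma L2_mult_integrable:
  fixes f g :: "'a::euclidean_space \<Rightarrow> real"
  assumes "f \<in> L2 S" "g \<in> L2 S" shows "integrable (lebesgue_on S) (\<lambda>x. f x * g x)"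
  using L2_inner_integrable[OF assms] by simp

lemma L2_nth:
  fixes f :: "'a::euclidean_space \<Rightarrow> real^'d"
  assumes "f \<in> L2 S" shows "(\<lambda>x. f x $ i) \<in> L2 S"
proof (rule L2I_bound[OF _ L2_integrable[OF assms]])
  show "(\<lambda>x. f x $ i) \<in> borel_measurable (lebesgue_on S)"
    using borel_measurable_inner[OF L2_measurable[OF assms] borel_measurable_const[of "axis i 1"]]
    by (simp add: inner_axis)
  have "(norm (f x $ i))\<^sup>2 \<le> (norm (f x))\<^sup>2" for x
    using component_le_norm_cart[of "f x" i] by (intro power_mono) auto
  then show "AE x in lebesgue_on S. (norm (f x $ i))\<^sup>2 \<le> (norm (f x))\<^sup>2"
    by (rule AE_I2)
qed

lemma norm_vec_sq: "(norm v)\<^sup>2 = (\<Sum>i\<in>UNIV. (v $ i)\<^sup>2)" for v :: "real^'d"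
  by (simp add: norm_vec_def L2_set_def sum_nonneg)

lemma L2_vec:
  fixes f :: "'d::finite \<Rightarrow> 'a::euclidean_space \<Rightarrow> real"
  assumes "\<And>i. f i \<in> L2 S" shows "(\<lambda>x. (\<chi> i. f i x) :: real^'d) \<in> L2 S"
proof (rule L2I_bound)
  have "(\<lambda>x. \<Sum>i\<in>UNIV. f i x *\<^sub>R axis i 1 :: real^'d) \<in> borel_measurable (lebesgue_on S)"
    using assms by (intro borel_measurable_sum borel_measurable_scaleR L2_measurable borel_measurable_const)
  moreover have "(\<Sum>i\<in>UNIV. f i x *\<^sub>R axis i 1 :: real^'d) = (\<chi> i. f i x)" for x
    using basis_expansion[of "\<chi> i. f i x"] by (simp add: scalar_mult_eq_scaleR)
  ultimately show "(\<lambda>x. (\<chi> i. f i x) :: real^'d) \<in> borel_measurable (lebesgue_on S)"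
    by simp
  show "integrable (lebesgue_on S) (\<lambda>x. \<Sum>i\<in>UNIV. (norm (f i x))\<^sup>2)"
    using assms by (intro Bochner_Integration.integrable_sum L2_integrable)
qed (simp add: norm_vec_sq)

subsection \<open>Borel representatives\<close>

text \<open>
  Lebesgue measure on a product is not a product measure, so Fubini's theorem is only available for
  \<^const>\<open>lborel\<close>. A Borel representative, extended by zero, transports it to \<open>lebesgue_on\<close>.
\<close>

lemma borel_representative:
  fixes f :: "'a::euclidean_space \<Rightarrow> real"
  assumes S: "open S" and f: "f \<in> borel_measurable (lebesgue_on S)"
  obtains f' where "f' \<in> borel_measurable borel" "\<And>x. x \<notin> S \<Longrightarrow> f' x = 0"
    "AE x in lborel. x \<in> S \<longrightarrow> f x = f' x"
proof -
  have [measurable]: "S \<in> sets borel" using S by auto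
  have "(\<lambda>x. if x \<in> S then f x else 0) \<in> borel_measurable lebesgue"
    using S f by (subst borel_measurable_if) auto
  then obtain h where h: "h \<in> borel_measurable lborel"
    "AE x in lborel. (if x \<in> S then f x else 0) = h x"
    using completion_ex_borel_measurable_real by blast
  from h(1) have [measurable]: "h \<in> borel_measurable borel" by simp
  show ?thesis
  proof (rule that)
    show "(\<lambda>x. if x \<in> S then h x else 0) \<in> borel_measurable borel"
      by measurable
    show "AE x in lborel. x \<in> S \<longrightarrow> f x = (if x \<in> S then h x else 0)"
      using h(2) by eventually_elim auto
  qed auto
qed

lemma AE_lebesgue_on_iff:
  assumes "open S"
  shows "(AE x in lebesgue_on S. P x) \<longleftrightarrow> (AE x in lborel. x \<in> S \<longrightarrow> P x)"
  using assms by (subst AE_restrict_space_iff) (auto simp: AE_completion_iff)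

lemma
  fixes f :: "'a::euclidean_space \<Rightarrow> real"
  assumes S: "open S" and f: "f \<in> borel_measurable borel" "\<And>x. x \<notin> S \<Longrightarrow> f x = 0"
  shows integral_lebesgue_on_eq_lborel: "(LINT x|lebesgue_on S. f x) = (LINT x|lborel. f x)"
    and integrable_lebesgue_on_iff_lborel: "integrable (lebesgue_on S) f \<longleftrightarrow> integrable lborel f"
proof -
  have "(\<lambda>x. indicator S x *\<^sub>R f x) = f"
    using f(2) by (auto simp: indicator_def fun_eq_iff)
  then show "(LINT x|lebesgue_on S. f x) = (LINT x|lborel. f x)"
    "integrable (lebesgue_on S) f \<longleftrightarrow> integrable lborel f"
    using S f(1) by (simp_all add: integral_restrict_space integrable_restrict_space
        integral_completion integrable_completion)
qed

lemma borel_measurable_lebesgue_on: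
  assumes "f \<in> borel_measurable borel"
  shows "f \<in> borel_measurable (lebesgue_on S)"
  using assms by (intro measurable_restrict_space1 measurable_completion) auto

text \<open>
  Lebesgue measure is complete, so a function that is almost everywhere equal to a measurable one is
  measurable.
\<close>

lemma borel_measurable_lebesgue_on_AE_cong:
  fixes f g :: "'a::euclidean_space \<Rightarrow> real"
  assumes S: "open S" and g: "g \<in> borel_measurable (lebesgue_on S)"
    and eq: "AE x in lebesgue_on S. f x = g x"
  shows "f \<in> borel_measurable (lebesgue_on S)"
proof -
  let ?f = "\<lambda>x. if x \<in> S then f x else 0" and ?g = "\<lambda>x. if x \<in> S then g x else 0"
  have g': "?g \<in> borel_measurable lebesgue"
    using S g by (subst borel_measurable_if) auto
  have ae: "AE x in lebesgue. ?f x = ?g x"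
    using eq S by (subst (asm) AE_restrict_space_iff) (auto elim!: eventually_mono)
  have "?f \<in> borel_measurable lebesgue"
  proof (rule borel_measurableI)
    fix A :: "real set" assume "open A"
    then have m: "{x\<in>space lebesgue. ?g x \<in> A} \<in> sets lebesgue"
      using g' by (intro measurable_sets_Collect[OF g']) auto
    have a: "AE x in lebesgue. x \<in> {x\<in>space lebesgue. ?g x \<in> A} \<longleftrightarrow> x \<in> ?f -` A \<inter> space lebesgue"
      using ae by eventually_elim (simp split del: if_split)
    show "?f -` A \<inter> space lebesgue \<in> sets lebesgue"
      by (rule completion.in_sets_AE[OF a m]) simp
  qed
  then show ?thesis
    using S by (subst (asm) borel_measurable_if) auto
qed

section \<open>Test functions\<close>

lemma test_functionsI:
  assumes "smooth \<phi>" "compact K" "K \<subseteq> S" "\<And>x. x \<notin> K \<Longrightarrow> \<phi> x = 0"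
  shows "\<phi> \<in> test_functions S"
proof -
  have "closure {x. \<phi> x \<noteq> 0} \<subseteq> K"
    using assms(2,4) by (intro closure_minimal compact_imp_closed) auto
  moreover from this have "compact (closure {x. \<phi> x \<noteq> 0})"
    using assms(2) by (meson bounded_subset closed_closure compact_eq_bounded_closed)
  ultimately show ?thesis
    using assms by (auto simp: test_functions_def)
qed

lemma test_functionsE:
  assumes "\<phi> \<in> test_functions S"
  obtains K where "smooth \<phi>" "compact K" "K \<subseteq> S" "\<And>x. x \<notin> K \<Longrightarrow> \<phi> x = 0"
proof (rule that[of "closure {x. \<phi> x \<noteq> 0}"])
  show "\<phi> x = 0" if "x \<notin> closure {x. \<phi> x \<noteq> 0}" for x
    using that closure_subset[of "{x. \<phi> x \<noteq> 0}"] by auto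
qed (use assms in \<open>auto simp: test_functions_def\<close>)

lemma frechet_derivative_0_outside:
  fixes \<phi> :: "'a::euclidean_space \<Rightarrow> real"
  assumes "closed K" "\<And>x. x \<notin> K \<Longrightarrow> \<phi> x = 0" "x \<notin> K"
  shows "frechet_derivative \<phi> (at x) v = 0"
proof -
  have "((\<lambda>_. 0) has_derivative (\<lambda>_. 0)) (at x)" by simp
  then have "(\<phi> has_derivative (\<lambda>_. 0)) (at x)"
    by (rule has_derivative_transform_within_open[where s = "- K"])
      (use assms in \<open>auto simp: open_Compl\<close>)
  from frechet_derivative_at[OF this] show ?thesis by metis
qed

lemma test_smooth: "\<phi> \<in> test_functions S \<Longrightarrow> smooth \<phi>"
  by (simp add: test_functions_def)

lemma test_deriv:
  assumes "\<phi> \<in> test_functions S"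
  shows "(\<lambda>x. frechet_derivative \<phi> (at x) v) \<in> test_functions S"
proof -
  obtain K where "smooth \<phi>" "compact K" "K \<subseteq> S" "\<And>x. x \<notin> K \<Longrightarrow> \<phi> x = 0"
    by (rule test_functionsE[OF assms]) (rule that)
  then show ?thesis
    by (intro test_functionsI[of _ K] smooth_deriv)
      (auto intro: frechet_derivative_0_outside compact_imp_closed)
qed

lemma test_diff:
  assumes "\<phi> \<in> test_functions S" "\<psi> \<in> test_functions S"
  shows "(\<lambda>x. \<phi> x - \<psi> x) \<in> test_functions S"
proof -
  obtain K where K: "smooth \<phi>" "compact K" "K \<subseteq> S" "\<And>x. x \<notin> K \<Longrightarrow> \<phi> x = 0"
    by (rule test_functionsE[OF assms(1)]) (rule that)
  obtain L where L: "smooth \<psi>" "compact L" "L \<subseteq> S" "\<And>x. x \<notin> L \<Longrightarrow> \<psi> x = 0"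
    by (rule test_functionsE[OF assms(2)]) (rule that)
  from K L show ?thesis
    by (intro test_functionsI[of _ "K \<union> L"]) (auto intro: smooth_diff)
qed

lemma test_mult:
  assumes "\<phi> \<in> test_functions S" "smooth \<psi>"
  shows "(\<lambda>x. \<phi> x * \<psi> x) \<in> test_functions S"
proof -
  obtain K where "smooth \<phi>" "compact K" "K \<subseteq> S" "\<And>x. x \<notin> K \<Longrightarrow> \<phi> x = 0"
    by (rule test_functionsE[OF assms(1)]) (rule that)
  then show ?thesis
    using assms(2) by (intro test_functionsI[of _ K]) (auto intro: smooth_mult)
qed

text \<open>
  Products of a function of the first and a function of the second variable are the only test
  functions on a product domain that the proof evaluates.
\<close>

lemma test_tensor:
  assumes \<psi>: "\<psi> \<in> test_functions A" and \<eta>: "\<eta> \<in> test_functions B"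
  shows "(\<lambda>z. \<psi> (fst z) * \<eta> (snd z)) \<in> test_functions (A \<times> B)"
proof -
  obtain K where K: "smooth \<psi>" "compact K" "K \<subseteq> A" "\<And>x. x \<notin> K \<Longrightarrow> \<psi> x = 0"
    by (rule test_functionsE[OF \<psi>]) (rule that)
  obtain L where L: "smooth \<eta>" "compact L" "L \<subseteq> B" "\<And>x. x \<notin> L \<Longrightarrow> \<eta> x = 0"
    by (rule test_functionsE[OF \<eta>]) (rule that)
  show ?thesis
  proof (rule test_functionsI[of _ "K \<times> L"])
    show "smooth (\<lambda>z. \<psi> (fst z) * \<eta> (snd z))"
      by (rule smooth_mult[OF smooth_linear[OF bounded_linear_fst K(1)] smooth_linear[OF bounded_linear_snd L(1)]])
    show "\<psi> (fst z) * \<eta> (snd z) = 0" if "z \<notin> K \<times> L" for z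
      using that K(4)[of "fst z"] L(4)[of "snd z"] by (cases z) auto
    show "compact (K \<times> L)" "K \<times> L \<subseteq> A \<times> B"
      using K(2,3) L(2,3) by (auto intro!: compact_Times)
  qed
qed

lemma frechet_derivative_mult:
  fixes f g :: "'a::euclidean_space \<Rightarrow> real"
  assumes "smooth f" "smooth g"
  shows "frechet_derivative (\<lambda>x. f x * g x) (at x) v =
    f x * frechet_derivative g (at x) v + frechet_derivative f (at x) v * g x"
  using frechet_derivative_at[OF has_derivative_mult[OF smooth_has_derivative[OF assms(1)]
        smooth_has_derivative[OF assms(2)]], of x] by metis

lemma frechet_derivative_tensor:
  fixes \<psi> :: "'a::euclidean_space \<Rightarrow> real" and \<eta> :: "'b::euclidean_space \<Rightarrow> real"
  assumes "smooth \<psi>" "smooth \<eta>"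
  shows "frechet_derivative (\<lambda>z. \<psi> (fst z) * \<eta> (snd z)) (at z) v =
    \<psi> (fst z) * frechet_derivative \<eta> (at (snd z)) (snd v) + frechet_derivative \<psi> (at (fst z)) (fst v) * \<eta> (snd z)"
proof -
  have a: "((\<lambda>z. \<psi> (fst z)) has_derivative (\<lambda>v. frechet_derivative \<psi> (at (fst z)) (fst v))) (at z)"
    by (rule has_derivative_compose[OF has_derivative_fst[OF has_derivative_ident] smooth_has_derivative[OF assms(1)]])
  have b: "((\<lambda>z. \<eta> (snd z)) has_derivative (\<lambda>v. frechet_derivative \<eta> (at (snd z)) (snd v))) (at z)"
    by (rule has_derivative_compose[OF has_derivative_snd[OF has_derivative_ident] smooth_has_derivative[OF assms(2)]])
  show ?thesis
    using fun_cong[OF frechet_derivative_at[OF has_derivative_mult[OF a b]], of v] by simp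
qed

lemma integrable_lebesgue_onI:
  fixes h :: "'a::euclidean_space \<Rightarrow> real"
  assumes "integrable lborel h" "open S"
  shows "integrable (lebesgue_on S) h"
proof -
  have "integrable lebesgue h"
    using assms by (simp add: integrable_completion borel_measurable_integrable)
  then have "integrable lebesgue (\<lambda>x. indicator S x *\<^sub>R h x)"
    using assms(2) by (intro integrable_mult_indicator) auto
  then show ?thesis
    using assms(2) by (simp add: integrable_restrict_space)
qed

lemma L2_compact_support:
  fixes f :: "'a::euclidean_space \<Rightarrow> real"
  assumes "open S" "continuous_on UNIV f" "compact K" "\<And>x. x \<in> S \<Longrightarrow> x \<notin> K \<Longrightarrow> f x = 0"
  shows "f \<in> L2 S"
proof (rule L2I_bound)
  show "f \<in> borel_measurable (lebesgue_on S)"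
    by (intro borel_measurable_lebesgue_on borel_measurable_continuous_onI assms)
  have "integrable lborel (\<lambda>x. indicator K x *\<^sub>R (f x)\<^sup>2)"
    by (intro borel_integrable_compact assms continuous_intros continuous_on_subset[OF assms(2)]) auto
  then show "integrable (lebesgue_on S) (\<lambda>x. indicator K x *\<^sub>R (f x)\<^sup>2)"
    by (rule integrable_lebesgue_onI) fact
  show "AE x in lebesgue_on S. (norm (f x))\<^sup>2 \<le> indicator K x *\<^sub>R (f x)\<^sup>2"
    using assms(4) by (intro AE_I2) (auto simp: indicator_def)
qed

lemma test_L2: "\<phi> \<in> test_functions S' \<Longrightarrow> open S \<Longrightarrow> \<phi> \<in> L2 S"
  by (erule test_functionsE) (rule L2_compact_support[OF _ smooth_continuous], auto)

text \<open>
  Transfer of the fundamental lemma to \<open>lebesgue_on\<close> through a Borel representative.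
\<close>

lemma AE_0_if_box_bump_orthogonal:
  fixes g :: "'a::euclidean_space \<Rightarrow> real"
  assumes S: "open S" and g: "g \<in> borel_measurable (lebesgue_on S)"
    and int: "\<And>a b. cbox a b \<subseteq> S \<Longrightarrow> integrable (lebesgue_on S) (\<lambda>x. indicator (cbox a b) x * g x)"
    and z: "\<And>a b n. cbox a b \<subseteq> S \<Longrightarrow> (LINT x|lebesgue_on S. g x * box_bump n a b x) = 0"
  shows "AE x in lebesgue_on S. g x = 0"
proof -
  obtain g' where g': "g' \<in> borel_measurable borel" "\<And>x. x \<notin> S \<Longrightarrow> g' x = 0"
    "AE x in lborel. x \<in> S \<longrightarrow> g x = g' x"
    by (rule borel_representative[OF S g]) (rule that)
  note [measurable] = g'(1) smooth_borel[OF smooth_box_bump] borel_measurable_lebesgue_on[OF g'(1)] g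
  have ae: "AE x in lebesgue_on S. g x = g' x"
    using g'(3) S by (simp add: AE_lebesgue_on_iff)
  have mb: "box_bump n a b \<in> borel_measurable (lebesgue_on S)" for n and a b :: 'a
    by (intro borel_measurable_lebesgue_on smooth_borel smooth_box_bump)
  have mi: "indicator (cbox a b) \<in> borel_measurable (lebesgue_on S)" for a b :: 'a
    by (intro borel_measurable_lebesgue_on) auto
  note [measurable] = mb mi
  have "AE x in lborel. x \<in> S \<longrightarrow> g' x = 0"
  proof (rule AE_0_if_box_bump_integrals_0[OF S g'(1)])
    fix a b :: 'a and n assume ab: "cbox a b \<subseteq> S"
    have "integrable (lebesgue_on S) (\<lambda>x. indicator (cbox a b) x * g' x)"
      by (rule integrable_cong_AE_imp[OF int[OF ab]]) (use ae in \<open>auto elim!: eventually_mono\<close>)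
    then show "integrable lborel (\<lambda>x. indicator (cbox a b) x * g' x)"
      using S g'(2) by (subst (asm) integrable_lebesgue_on_iff_lborel) auto
    have "(LINT x|lborel. g' x * box_bump n a b x) = (LINT x|lebesgue_on S. g' x * box_bump n a b x)"
      using S g'(2) by (intro integral_lebesgue_on_eq_lborel[symmetric]) auto
    also have "\<dots> = (LINT x|lebesgue_on S. g x * box_bump n a b x)"
      by (rule integral_cong_AE) (use ae in \<open>auto elim!: eventually_mono\<close>)
    finally show "(LINT x|lborel. g' x * box_bump n a b x) = 0"
      using z[OF ab] by simp
  qed
  then have "AE x in lebesgue_on S. g' x = 0"
    using S by (simp add: AE_lebesgue_on_iff)
  with ae show ?thesis by eventually_elim simp
qed

lemma L2_indicator_integrable:
  fixes g :: "'a::euclidean_space \<Rightarrow> real"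
  assumes "open S" "g \<in> L2 S"
  shows "integrable (lebesgue_on S) (\<lambda>x. indicator (cbox a b) x * g x)"
proof (rule L2_mult_integrable[OF _ assms(2)])
  have "integrable lborel (\<lambda>x. indicator (cbox a b) x *\<^sub>R (1::real))"
    by (intro borel_integrable_compact) auto
  then have i: "integrable (lebesgue_on S) (\<lambda>x. indicator (cbox a b) x *\<^sub>R (1::real))"
    by (rule integrable_lebesgue_onI[OF _ assms(1)])
  show "(indicator (cbox a b) :: 'a \<Rightarrow> real) \<in> L2 S"
  proof (rule L2I_bound[OF _ i])
    show "(indicator (cbox a b) :: 'a \<Rightarrow> real) \<in> borel_measurable (lebesgue_on S)"
      by (intro borel_measurable_lebesgue_on) auto
  qed (auto simp: indicator_def)
qed

lemma L2_AE_0_if_test_orthogonal: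
  fixes g :: "'a::euclidean_space \<Rightarrow> real"
  assumes "open S" "g \<in> L2 S"
    and "\<And>\<phi>. \<phi> \<in> test_functions S \<Longrightarrow> (LINT x|lebesgue_on S. g x * \<phi> x) = 0"
  shows "AE x in lebesgue_on S. g x = 0"
  by (rule AE_0_if_box_bump_orthogonal[OF assms(1) L2_measurable[OF assms(2)]
        L2_indicator_integrable[OF assms(1,2)] assms(3)[OF box_bump_test]])

section \<open>Weak derivatives\<close>

lemma L2_AE_eq_if_same_test_integrals:
  fixes g h :: "'a::euclidean_space \<Rightarrow> real"
  assumes S: "open S" and L: "g \<in> L2 S" "h \<in> L2 S"
    and eq: "\<And>\<phi>. \<phi> \<in> test_functions S \<Longrightarrow>
      (LINT x|lebesgue_on S. g x * \<phi> x) = (LINT x|lebesgue_on S. h x * \<phi> x)"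
  shows "AE x in lebesgue_on S. g x = h x"
proof -
  have "AE x in lebesgue_on S. g x - h x = 0"
  proof (rule L2_AE_0_if_test_orthogonal[OF S L2_diff[OF L]])
    fix \<phi> assume \<phi>: "\<phi> \<in> test_functions S"
    show "(LINT x|lebesgue_on S. (g x - h x) * \<phi> x) = 0"
      using eq[OF \<phi>] L2_mult_integrable[OF L(1) test_L2[OF \<phi> S]] L2_mult_integrable[OF L(2) test_L2[OF \<phi> S]]
      unfolding left_diff_distrib by simp
  qed
  then show ?thesis by eventually_elim simp
qed

lemma has_weak_deriv_unique:
  "open S \<Longrightarrow> has_weak_deriv S v f g \<Longrightarrow> has_weak_deriv S v f h \<Longrightarrow> AE x in lebesgue_on S. g x = h x"
  by (rule L2_AE_eq_if_same_test_integrals) (auto simp: has_weak_deriv_def)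

lemma has_weak_deriv_diff:
  assumes S: "open S" and "f \<in> L2 S" "f' \<in> L2 S" "has_weak_deriv S v f g" "has_weak_deriv S v f' g'"
  shows "has_weak_deriv S v (\<lambda>x. f x - f' x) (\<lambda>x. g x - g' x)"
  unfolding has_weak_deriv_def
proof (intro conjI ballI)
  have L: "g \<in> L2 S" "g' \<in> L2 S" using assms by (auto simp: has_weak_deriv_def)
  then show "(\<lambda>x. g x - g' x) \<in> L2 S" by (rule L2_diff)
  fix \<phi> assume \<phi>: "\<phi> \<in> test_functions S"
  note T = test_L2[OF \<phi> S] test_L2[OF test_deriv[OF \<phi>] S]
  show "(LINT x|lebesgue_on S. (f x - f' x) * frechet_derivative \<phi> (at x) v) =
      - (LINT x|lebesgue_on S. (g x - g' x) * \<phi> x)"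
    using assms \<phi> T L unfolding left_diff_distrib
    by (simp add: Bochner_Integration.integral_diff L2_mult_integrable has_weak_deriv_def)
qed

lemma weak_deriv_has_weak_deriv:
  "has_weak_deriv S v f g \<Longrightarrow> has_weak_deriv S v f (weak_deriv S v f)"
  unfolding weak_deriv_def by (rule someI[where P = "has_weak_deriv S v f"])

lemma weak_deriv_AE_eq:
  "open S \<Longrightarrow> has_weak_deriv S v f g \<Longrightarrow> AE x in lebesgue_on S. weak_deriv S v f x = g x"
  by (metis has_weak_deriv_unique weak_deriv_has_weak_deriv)

lemma L2_space_gradient_integrable:
  fixes q :: "real \<times> (real^'d) \<Rightarrow> real^'d"
  assumes S: "open S" and q: "q \<in> L2 S" and \<phi>: "\<phi> \<in> test_functions S"
  shows "integrable (lebesgue_on S) (\<lambda>z. \<Sum>i\<in>UNIV. q z $ i * frechet_derivative \<phi> (at z) (0, axis i 1))"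
  by (intro Bochner_Integration.integrable_sum L2_mult_integrable L2_nth q test_L2[OF test_deriv[OF \<phi>] S])

lemma has_space_div_unique:
  "open S \<Longrightarrow> has_space_div S q g \<Longrightarrow> has_space_div S q h \<Longrightarrow> AE x in lebesgue_on S. g x = h x"
  by (rule L2_AE_eq_if_same_test_integrals) (auto simp: has_space_div_def)

lemma has_space_div_diff:
  fixes q q' :: "real \<times> (real^'d) \<Rightarrow> real^'d"
  assumes S: "open S" and "q \<in> L2 S" "q' \<in> L2 S" "has_space_div S q g" "has_space_div S q' g'"
  shows "has_space_div S (\<lambda>x. q x - q' x) (\<lambda>x. g x - g' x)"
  unfolding has_space_div_def
proof (intro conjI ballI)
  have L: "g \<in> L2 S" "g' \<in> L2 S" using assms by (auto simp: has_space_div_def)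
  then show "(\<lambda>x. g x - g' x) \<in> L2 S" by (rule L2_diff)
  fix \<phi> assume \<phi>: "\<phi> \<in> test_functions S"
  note T = test_L2[OF \<phi> S] L2_space_gradient_integrable[OF S assms(2) \<phi>] L2_space_gradient_integrable[OF S assms(3) \<phi>]
  show "(LINT z|lebesgue_on S. (\<Sum>i\<in>UNIV. (q z - q' z) $ i * frechet_derivative \<phi> (at z) (0, axis i 1))) =
      - (LINT z|lebesgue_on S. (g z - g' z) * \<phi> z)"
    using assms \<phi> T L
    by (simp add: left_diff_distrib sum_subtractf Bochner_Integration.integral_diff L2_mult_integrable has_space_div_def)
qed

lemma space_div_has_space_div:
  "has_space_div S q g \<Longrightarrow> has_space_div S q (space_div S q)"
  unfolding space_div_def by (rule someI[where P = "has_space_div S q"])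

lemma space_div_AE_eq:
  "open S \<Longrightarrow> has_space_div S q g \<Longrightarrow> AE x in lebesgue_on S. space_div S q x = g x"
  by (metis has_space_div_unique space_div_has_space_div)

section \<open>Slices of functions on a product\<close>

text \<open>
  The next lemmas are the theorems of Tonelli and Fubini for \<open>lebesgue_on\<close> of a product of open
  sets, by passing to Borel representatives.
\<close>

lemma AE_lebesgue_on_slices:
  fixes A :: "'a::euclidean_space set" and B :: "'b::euclidean_space set"
  assumes "open A" "open B" "AE z in lebesgue_on (A \<times> B). P z"
  shows "AE x in lebesgue_on A. AE y in lebesgue_on B. P (x, y)"
proof -
  have "AE z in lborel. z \<in> A \<times> B \<longrightarrow> P z"
    using assms by (simp add: AE_lebesgue_on_iff open_Times)
  then have "AE z in lborel \<Otimes>\<^sub>M lborel. z \<in> A \<times> B \<longrightarrow> P z"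
    by (simp only: lborel_prod)
  from lborel_pair.AE_pair[OF this] show ?thesis
    using assms by (auto simp: AE_lebesgue_on_iff elim!: eventually_mono)
qed

lemma measurable_slices:
  fixes A :: "'a::euclidean_space set" and B :: "'b::euclidean_space set" and F :: "'a \<times> 'b \<Rightarrow> real"
  assumes A: "open A" and B: "open B" and F: "F \<in> borel_measurable (lebesgue_on (A \<times> B))"
  shows "AE x in lebesgue_on A. (\<lambda>y. F (x, y)) \<in> borel_measurable (lebesgue_on B)"
proof -
  have AB: "open (A \<times> B)" using A B by (rule open_Times)
  obtain F' where F': "F' \<in> borel_measurable borel" "AE z in lborel. z \<in> A \<times> B \<longrightarrow> F z = F' z"
    by (rule borel_representative[OF AB F]) (rule that)
  have "AE z in lebesgue_on (A \<times> B). F z = F' z"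
    using F'(2) AB by (simp add: AE_lebesgue_on_iff)
  from AE_lebesgue_on_slices[OF A B this] show ?thesis
  proof eventually_elim
    fix x assume ae: "AE y in lebesgue_on B. F (x, y) = F' (x, y)"
    have m: "(\<lambda>y. F' (x, y)) \<in> borel_measurable (lebesgue_on B)"
      by (rule borel_measurable_lebesgue_on, rule measurable_compose[OF measurable_Pair1' F'(1)[folded borel_prod]]) simp
    show "(\<lambda>y. F (x, y)) \<in> borel_measurable (lebesgue_on B)"
      by (rule borel_measurable_lebesgue_on_AE_cong[OF B m ae])
  qed
qed

lemma
  fixes A :: "'a::euclidean_space set" and B :: "'b::euclidean_space set" and F :: "'a \<times> 'b \<Rightarrow> real"
  assumes A: "open A" and B: "open B" and F: "integrable (lebesgue_on (A \<times> B)) F"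
  shows integrable_slices: "AE x in lebesgue_on A. integrable (lebesgue_on B) (\<lambda>y. F (x, y))"
    and integrable_slice_integral: "integrable (lebesgue_on A) (\<lambda>x. LINT y|lebesgue_on B. F (x, y))"
    and integral_slice_integral: "(LINT x|lebesgue_on A. (LINT y|lebesgue_on B. F (x, y))) = (LINT z|lebesgue_on (A \<times> B). F z)"
proof -
  have AB: "open (A \<times> B)" using A B by (rule open_Times)
  obtain F' where F': "F' \<in> borel_measurable borel" "\<And>z. z \<notin> A \<times> B \<Longrightarrow> F' z = 0"
    "AE z in lborel. z \<in> A \<times> B \<longrightarrow> F z = F' z"
    by (rule borel_representative[OF AB borel_measurable_integrable[OF F]]) (rule that)
  note [measurable] = borel_measurable_lebesgue_on[OF F'(1)] borel_measurable_integrable[OF F]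
  have ae: "AE z in lebesgue_on (A \<times> B). F z = F' z"
    using F'(3) AB by (simp add: AE_lebesgue_on_iff)
  have "integrable (lebesgue_on (A \<times> B)) F'"
    by (rule integrable_cong_AE_imp[OF F _ ae]) simp
  then have "integrable lborel F'"
    using integrable_lebesgue_on_iff_lborel[OF AB F'(1,2)] by simp
  then have I: "integrable (lborel \<Otimes>\<^sub>M lborel) F'"
    by (simp add: lborel_prod)
  have sl: "(\<lambda>y. F' (x, y)) \<in> borel_measurable borel" for x
    by (rule measurable_compose[OF measurable_Pair1' F'(1)[folded borel_prod]]) simp
  note eqB = integrable_lebesgue_on_iff_lborel[OF B sl] integral_lebesgue_on_eq_lborel[OF B sl]
  have 1: "AE x in lebesgue_on A. integrable (lebesgue_on B) (\<lambda>y. F' (x, y))"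
    using lborel_pair.AE_integrable_fst'[OF I] A F'(2)
    by (auto simp: AE_lebesgue_on_iff eqB elim!: eventually_mono)
  have 2: "integrable lborel (\<lambda>x. LINT y|lborel. F' (x, y))"
    using lborel_pair.integrable_fst'[OF I] .
  have eq2: "(LINT y|lborel. F' (x, y)) = (LINT y|lebesgue_on B. F' (x, y))" for x
    using F'(2) by (subst eqB) auto
  have z2: "(LINT y|lborel. F' (x, y)) = 0" if "x \<notin> A" for x
    using F'(2) that by simp
  have 3: "integrable (lebesgue_on A) (\<lambda>x. LINT y|lborel. F' (x, y))"
    using 2 z2 by (subst integrable_lebesgue_on_iff_lborel[OF A]) auto
  have 4: "(LINT x|lebesgue_on A. LINT y|lborel. F' (x, y)) = (LINT z|lebesgue_on (A \<times> B). F' z)"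
    using lborel_pair.integral_fst'[OF I] 2 z2
    by (simp add: integral_lebesgue_on_eq_lborel[OF A] integral_lebesgue_on_eq_lborel[OF AB F'(1,2)] lborel_prod)
  have sae: "AE x in lebesgue_on A. AE y in lebesgue_on B. F (x, y) = F' (x, y)"
    by (rule AE_lebesgue_on_slices[OF A B ae])
  have sm: "AE x in lebesgue_on A. (\<lambda>y. F (x, y)) \<in> borel_measurable (lebesgue_on B)"
    by (rule measurable_slices[OF A B borel_measurable_integrable[OF F]])
  show "AE x in lebesgue_on A. integrable (lebesgue_on B) (\<lambda>y. F (x, y))"
    using 1 sae sm by eventually_elim (rule integrable_cong_AE_imp, auto elim: eventually_mono)
  have ie: "AE x in lebesgue_on A. (LINT y|lebesgue_on B. F (x, y)) = (LINT y|lborel. F' (x, y))"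
    using sae sm unfolding eq2
    by eventually_elim (intro integral_cong_AE, auto intro: borel_measurable_lebesgue_on sl)
  have m: "(\<lambda>x. LINT y|lebesgue_on B. F (x, y)) \<in> borel_measurable (lebesgue_on A)"
    by (rule borel_measurable_lebesgue_on_AE_cong[OF A borel_measurable_integrable[OF 3] ie])
  show "integrable (lebesgue_on A) (\<lambda>x. LINT y|lebesgue_on B. F (x, y))"
    by (rule integrable_cong_AE_imp[OF 3 m]) (use ie in \<open>auto elim: eventually_mono\<close>)
  have "(LINT x|lebesgue_on A. (LINT y|lebesgue_on B. F (x, y))) = (LINT x|lebesgue_on A. LINT y|lborel. F' (x, y))"
    by (rule integral_cong_AE[OF m borel_measurable_integrable[OF 3] ie])
  also have "\<dots> = (LINT z|lebesgue_on (A \<times> B). F z)"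
    unfolding 4 by (rule integral_cong_AE) (use ae in \<open>auto elim: eventually_mono\<close>)
  finally show "(LINT x|lebesgue_on A. (LINT y|lebesgue_on B. F (x, y))) = (LINT z|lebesgue_on (A \<times> B). F z)" .
qed

lemma L2_slices:
  fixes A :: "'a::euclidean_space set" and B :: "'b::euclidean_space set" and f :: "'a \<times> 'b \<Rightarrow> real"
  assumes A: "open A" and B: "open B" and f: "f \<in> L2 (A \<times> B)"
  shows "AE x in lebesgue_on A. (\<lambda>y. f (x, y)) \<in> L2 B"
  using measurable_slices[OF A B L2_measurable[OF f]] integrable_slices[OF A B L2_integrable[OF f]]
  by eventually_elim (simp add: L2_def)

section \<open>Weak derivatives of slices\<close>

text \<open>
  Separability of a family of compactly supported continuous functions, with approximants taken from
  the family itself. A \<open>code\<close> is a finite list of balls with centres in a countable dense set, together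
  with approximate values on these balls. A function fits a code if the balls cover its support and the
  values are accurate up to \<open>1 / (k + 1)\<close>. By compactness every function fits some code, and two
  functions that fit the same code are uniformly close. So it suffices to choose one function for
  each of the countably many codes.
\<close>

lemma countable_uniformly_dense:
  fixes F :: "'i \<Rightarrow> 'a::euclidean_space \<Rightarrow> 'b::euclidean_space" and K :: "nat \<Rightarrow> 'a set"
  assumes cont: "\<And>\<phi>. \<phi> \<in> X \<Longrightarrow> continuous_on UNIV (F \<phi>)"
    and supp: "\<And>\<phi>. \<phi> \<in> X \<Longrightarrow> \<exists>N. \<forall>x. x \<notin> K N \<longrightarrow> F \<phi> x = 0"
    and K: "\<And>N. compact (K N)"
  obtains D where "countable D" "D \<subseteq> X"
    "\<And>\<phi>. \<phi> \<in> X \<Longrightarrow> \<exists>N. \<forall>\<epsilon>>0. \<exists>\<psi>\<in>D. \<forall>x. norm (F \<phi> x - F \<psi> x) \<le> \<epsilon> * indicator (K N) x"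
proof -
  obtain Q :: "'a set" where Q: "countable Q" "\<And>X. open X \<Longrightarrow> X \<noteq> {} \<Longrightarrow> \<exists>d\<in>Q. d \<in> X"
    using countable_dense_setE by blast
  obtain R :: "'b set" where R: "countable R" "\<And>X. open X \<Longrightarrow> X \<noteq> {} \<Longrightarrow> \<exists>d\<in>R. d \<in> X"
    using countable_dense_setE by blast
  define C where "C = lists (Q \<times> (UNIV :: nat set) \<times> R)"
  have C: "countable C"
    unfolding C_def using Q(1) R(1) by (intro countable_lists countable_SIGMA) auto
  define B where "B = (\<lambda>b::'a \<times> nat \<times> 'b. ball (fst b) (inverse (real (Suc (fst (snd b))))))"
  define ok where "ok \<phi> = (\<lambda>(N, k::nat, c). \<phi> \<in> X \<and> (\<forall>x. x \<notin> K N \<longrightarrow> F \<phi> x = 0) \<and>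
     K N \<subseteq> (\<Union>b\<in>set c. B b) \<and>
     (\<forall>b\<in>set c. \<forall>x\<in>B b. norm (F \<phi> x - snd (snd b)) < inverse (real (Suc k))))" for \<phi>
  define D where "D = (\<lambda>p. SOME \<phi>. ok \<phi> p) ` {p \<in> UNIV \<times> UNIV \<times> C. \<exists>\<phi>. ok \<phi> p}"
  have ex: "\<exists>c\<in>C. ok \<phi> (N, k, c)" if \<phi>: "\<phi> \<in> X" and N: "\<forall>x. x \<notin> K N \<longrightarrow> F \<phi> x = 0" for \<phi> N k
  proof -
    define \<epsilon> where "\<epsilon> = inverse (real (Suc k))"
    have \<epsilon>: "\<epsilon> > 0" by (simp add: \<epsilon>_def)
    define P where "P x b \<longleftrightarrow> b \<in> Q \<times> UNIV \<times> R \<and> x \<in> B b \<and> (\<forall>y\<in>B b. norm (F \<phi> y - snd (snd b)) < \<epsilon>)" for x b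
    have "\<exists>b. P x b" for x
    proof -
      have "isCont (F \<phi>) x" using cont[OF \<phi>] by (simp add: continuous_on_eq_continuous_at)
      then obtain \<delta> where \<delta>: "\<delta> > 0" "\<And>y. dist y x < \<delta> \<Longrightarrow> dist (F \<phi> y) (F \<phi> x) < \<epsilon> / 2"
        using \<epsilon> unfolding continuous_at_eps_delta by (metis half_gt_zero)
      obtain n where n: "inverse (real (Suc n)) < \<delta> / 2"
        using \<delta>(1) reals_Archimedean[of "\<delta> / 2"] by auto
      have "ball x (inverse (real (Suc n))) \<noteq> {}" by simp
      then obtain a where a: "a \<in> Q" "a \<in> ball x (inverse (real (Suc n)))"
        using Q(2)[OF open_ball] by blast
      have "ball (F \<phi> x) (\<epsilon> / 2) \<noteq> {}" using \<epsilon> by simp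
      then obtain v where v: "v \<in> R" "v \<in> ball (F \<phi> x) (\<epsilon> / 2)"
        using R(2)[OF open_ball] by blast
      have "norm (F \<phi> y - v) < \<epsilon>" if "y \<in> ball a (inverse (real (Suc n)))" for y
      proof -
        have "dist y x \<le> dist a y + dist x a"
          by (metis dist_commute dist_triangle add.commute)
        also have "\<dots> < \<delta>" using that a n by simp
        finally have "dist (F \<phi> y) (F \<phi> x) < \<epsilon> / 2" by (rule \<delta>(2))
        then show ?thesis
          using v(2) dist_triangle[of "F \<phi> y" v "F \<phi> x"] by (simp add: dist_norm)
      qed
      then show ?thesis
        using a v by (intro exI[of _ "(a, n, v)"]) (auto simp: P_def B_def dist_commute)
    qed
    then obtain b where Pb: "\<And>x. P x (b x)" by metis
    have b: "b x \<in> Q \<times> UNIV \<times> R" "x \<in> B (b x)"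
      "\<forall>y\<in>B (b x). norm (F \<phi> y - snd (snd (b x))) < \<epsilon>" for x
      using Pb[of x] by (simp_all add: P_def)
    obtain Y where Y: "Y \<subseteq> K N" "finite Y" "K N \<subseteq> (\<Union>x\<in>Y. B (b x))"
    proof (rule compactE_image[OF K[of N], of "K N" "\<lambda>x. B (b x)"])
      show "open (B (b x))" for x by (simp add: B_def)
      show "K N \<subseteq> (\<Union>x\<in>K N. B (b x))"
        using b(2) by blast
    qed (rule that)
    obtain c where c: "set c = b ` Y" using finite_list[of "b ` Y"] Y(2) by auto
    have "set c \<subseteq> Q \<times> UNIV \<times> R" unfolding c by (intro image_subsetI b(1))
    then have "c \<in> C" unfolding C_def lists_eq_set by blast
    moreover have "ok \<phi> (N, k, c)"
      unfolding ok_def prod.case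
    proof (intro conjI \<phi> N)
      show "K N \<subseteq> (\<Union>b\<in>set c. B b)" using Y(3) c by simp
      show "\<forall>b\<in>set c. \<forall>x\<in>B b. norm (F \<phi> x - snd (snd b)) < inverse (real (Suc k))"
        using b(3) unfolding c \<epsilon>_def by blast
    qed
    ultimately show ?thesis ..
  qed
  show ?thesis
  proof (rule that[of D])
    show "countable D"
      unfolding D_def using C by (intro countable_image countable_subset[OF _ countable_SIGMA[OF _ countable_SIGMA]]) auto
    have okD: "ok (SOME \<phi>. ok \<phi> p) p" if "\<exists>\<phi>. ok \<phi> p" for p
      using that by (rule someI_ex)
    show "D \<subseteq> X"
    proof
      fix \<phi> assume "\<phi> \<in> D"
      then obtain p where "\<exists>\<phi>. ok \<phi> p" "\<phi> = (SOME \<phi>. ok \<phi> p)" unfolding D_def by blast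
      then have "ok \<phi> p" using okD by simp
      then show "\<phi> \<in> X" by (auto simp: ok_def split: prod.splits)
    qed
    fix \<phi> assume \<phi>: "\<phi> \<in> X"
    then obtain N where N: "\<forall>x. x \<notin> K N \<longrightarrow> F \<phi> x = 0" using supp by blast
    have "\<exists>\<psi>\<in>D. \<forall>x. norm (F \<phi> x - F \<psi> x) \<le> \<epsilon> * indicator (K N) x" if \<epsilon>: "\<epsilon> > 0" for \<epsilon>
    proof -
      obtain k where k: "inverse (real (Suc k)) < \<epsilon> / 2"
        using \<epsilon> reals_Archimedean[of "\<epsilon> / 2"] by auto
      obtain c where c: "c \<in> C" "ok \<phi> (N, k, c)" using ex[OF \<phi> N] by blast
      define \<psi> where "\<psi> = (SOME \<psi>. ok \<psi> (N, k, c))"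
      have \<psi>: "ok \<psi> (N, k, c)" unfolding \<psi>_def using c(2) okD by blast
      have "\<psi> \<in> D" unfolding D_def \<psi>_def using c by blast
      moreover have "norm (F \<phi> x - F \<psi> x) \<le> \<epsilon> * indicator (K N) x" for x
      proof (cases "x \<in> K N")
        case True
        then obtain b where b: "b \<in> set c" "x \<in> B b"
          using c(2) by (auto simp: ok_def)
        then have "norm (F \<phi> x - snd (snd b)) < inverse (real (Suc k))" "norm (F \<psi> x - snd (snd b)) < inverse (real (Suc k))"
          using c(2) \<psi> by (simp_all add: ok_def)
        then have "norm (F \<phi> x - F \<psi> x) < \<epsilon>"
          using k norm_triangle_ineq4[of "F \<phi> x - snd (snd b)" "F \<psi> x - snd (snd b)"] by simp
        then show ?thesis using True by simp
      next
        case False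
        then show ?thesis using c(2) \<psi> by (simp add: ok_def)
      qed
      ultimately show ?thesis by blast
    qed
    then show "\<exists>N. \<forall>\<epsilon>>0. \<exists>\<psi>\<in>D. \<forall>x. norm (F \<phi> x - F \<psi> x) \<le> \<epsilon> * indicator (K N) x" by blast
  qed
qed

text \<open>
  The function together with its gradient. Convergence of test functions in the first-order Sobolev
  norm is convergence of jets.
\<close>

definition jet :: "(real^'d \<Rightarrow> real) \<Rightarrow> real^'d \<Rightarrow> real \<times> (real^'d)" where
  "jet \<phi> x = (\<phi> x, \<chi> i. frechet_derivative \<phi> (at x) (axis i 1))"

lemma continuous_jet:
  assumes "smooth \<phi>" shows "continuous_on UNIV (jet \<phi>)"
proof -
  have "continuous_on UNIV (\<lambda>x. frechet_derivative \<phi> (at x) v)" for v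
    by (rule smooth_continuous[OF smooth_deriv[OF assms]])
  then show ?thesis
    unfolding jet_def by (intro continuous_intros smooth_continuous[OF assms] continuous_on_vec_lambda)
qed

lemma L2_Pair:
  fixes f :: "'a::euclidean_space \<Rightarrow> 'b::euclidean_space" and g :: "'a \<Rightarrow> 'c::euclidean_space"
  assumes "f \<in> L2 S" "g \<in> L2 S" shows "(\<lambda>x. (f x, g x)) \<in> L2 S"
proof (rule L2I_bound)
  show "(\<lambda>x. (f x, g x)) \<in> borel_measurable (lebesgue_on S)"
    using assms by (intro borel_measurable_Pair L2_measurable)
  show "integrable (lebesgue_on S) (\<lambda>x. (norm (f x))\<^sup>2 + (norm (g x))\<^sup>2)"
    using assms by (intro Bochner_Integration.integrable_add L2_integrable)
qed (simp add: norm_Pair)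

lemma L2_norm_fun: "f \<in> L2 S \<Longrightarrow> (\<lambda>x. norm (f x)) \<in> L2 S"
  by (auto simp: L2_def)

lemma jet_L2:
  fixes \<Omega> :: "(real^'d) set"
  assumes "\<phi> \<in> test_functions \<Omega>'" "open \<Omega>" shows "jet \<phi> \<in> L2 \<Omega>"
  using assms unfolding jet_def[abs_def] by (intro L2_Pair L2_vec test_L2 test_deriv)

text \<open>
  The field \<open>q\<close> has weak divergence \<open>g\<close>. Function and gradient of the test function are paired at once
  through \<^const>\<open>jet\<close>, so that the condition is orthogonality to all jets of test functions.
\<close>

definition has_div :: "(real^'d) set \<Rightarrow> (real^'d \<Rightarrow> real^'d) \<Rightarrow> (real^'d \<Rightarrow> real) \<Rightarrow> bool" where
  "has_div \<Omega> q g \<longleftrightarrow> q \<in> L2 \<Omega> \<and> g \<in> L2 \<Omega> \<and>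
     (\<forall>\<phi>\<in>test_functions \<Omega>. (LINT x|lebesgue_on \<Omega>. (g x, q x) \<bullet> jet \<phi> x) = 0)"

lemma inner_jet: "(a, b) \<bullet> jet \<phi> x = a * \<phi> x + (\<Sum>i\<in>UNIV. b $ i * frechet_derivative \<phi> (at x) (axis i 1))"
  by (simp add: jet_def inner_vec_def)

text \<open>
  For a single test function \<open>\<psi>\<close> on \<open>\<Omega>\<close>, testing with \<open>\<beta>(t) \<psi>(x)\<close> shows that the defining integral,
  as a function of \<open>t\<close>, is orthogonal to all bumps \<open>\<beta>\<close> and therefore vanishes almost everywhere. The
  countable dense family of jets gives one null set of times for all test functions.
\<close>

lemma slice_has_div:
  fixes \<Omega> :: "(real^'d) set" and q :: "real \<times> (real^'d) \<Rightarrow> real^'d"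
  assumes \<Omega>: "open \<Omega>" and q: "q \<in> L2 ({0<..<T} \<times> \<Omega>)" and d: "has_space_div ({0<..<T} \<times> \<Omega>) q g"
  shows "AE t in lebesgue_on {0<..<T}. has_div \<Omega> (\<lambda>x. q (t, x)) (\<lambda>x. g (t, x))"
proof -
  let ?I = "{0<..<T}" let ?X = "?I \<times> \<Omega>"
  have I: "open ?I" by simp
  have X: "open ?X" using \<Omega> by (intro open_Times) auto
  have g: "g \<in> L2 ?X" using d by (simp add: has_space_div_def)
  have Q: "(\<lambda>z. (g z, q z)) \<in> L2 ?X" by (intro L2_Pair g q)
  let ?K = "\<lambda>N. cbox (- (real N *\<^sub>R One)) (real N *\<^sub>R One) :: (real^'d) set"
  obtain D where D: "countable D" "D \<subseteq> test_functions \<Omega>"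
    "\<And>\<phi>. \<phi> \<in> test_functions \<Omega> \<Longrightarrow> \<exists>N. \<forall>\<epsilon>>0. \<exists>\<psi>\<in>D. \<forall>x. norm (jet \<phi> x - jet \<psi> x) \<le> \<epsilon> * indicator (?K N) x"
  proof (rule countable_uniformly_dense[of "test_functions \<Omega>" jet ?K])
    fix \<phi> :: "real^'d \<Rightarrow> real" assume \<phi>: "\<phi> \<in> test_functions \<Omega>"
    show "continuous_on UNIV (jet \<phi>)" by (intro continuous_jet test_smooth[OF \<phi>])
    obtain K where K: "smooth \<phi>" "compact K" "K \<subseteq> \<Omega>" "\<And>x. x \<notin> K \<Longrightarrow> \<phi> x = 0"
      by (rule test_functionsE[OF \<phi>]) (rule that)
    obtain r where r: "\<And>x. x \<in> K \<Longrightarrow> norm x \<le> r"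
      using compact_imp_bounded[OF K(2)] by (auto simp: bounded_iff)
    obtain N where N: "r \<le> real N" using real_arch_simple by blast
    have "K \<subseteq> ?K N"
    proof
      fix x assume "x \<in> K"
      then have "norm x \<le> real N" using r N by fastforce
      then have "\<bar>x \<bullet> i\<bar> \<le> real N" if "i \<in> Basis" for i
        using Basis_le_norm[OF that, of x] by simp
      then show "x \<in> ?K N" by (fastforce simp: mem_box abs_le_iff)
    qed
    have "jet \<phi> x = 0" if "x \<notin> ?K N" for x
    proof -
      have "x \<notin> K" using \<open>K \<subseteq> ?K N\<close> that by blast
      then have "frechet_derivative \<phi> (at x) v = 0" for v
        using K(4) by (intro frechet_derivative_0_outside[OF compact_imp_closed[OF K(2)]])
      then show ?thesis
        using K(4)[OF \<open>x \<notin> K\<close>] by (simp add: jet_def zero_prod_def vec_eq_iff)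
    qed
    then show "\<exists>N. \<forall>x. x \<notin> ?K N \<longrightarrow> jet \<phi> x = 0" by blast
  qed auto
  \<comment> \<open>One test function in space: a null set that depends on it.\<close>
  have zero: "AE t in lebesgue_on ?I. (LINT x|lebesgue_on \<Omega>. (g (t, x), q (t, x)) \<bullet> jet \<psi> x) = 0"
    if \<psi>: "\<psi> \<in> test_functions \<Omega>" for \<psi>
  proof -
    obtain K where K: "smooth \<psi>" "compact K" "K \<subseteq> \<Omega>" "\<And>x. x \<notin> K \<Longrightarrow> \<psi> x = 0"
      by (rule test_functionsE[OF \<psi>]) (rule that)
    have sndL2: "(\<lambda>z. \<theta> (snd z)) \<in> L2 ?X" if \<theta>: "smooth \<theta>" "\<And>x. x \<notin> K \<Longrightarrow> \<theta> x = 0" for \<theta> :: "real^'d \<Rightarrow> real"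
    proof (rule L2_compact_support[OF X, of _ "cbox 0 T \<times> K"])
      show "continuous_on UNIV (\<lambda>z::real \<times> (real^'d). \<theta> (snd z))"
        by (intro continuous_on_compose2[OF smooth_continuous[OF \<theta>(1)]] continuous_intros) auto
      show "compact (cbox 0 T \<times> K)" by (intro compact_Times K(2) compact_cbox)
      show "\<theta> (snd z) = 0" if "z \<in> ?X" "z \<notin> cbox 0 T \<times> K" for z
        using that \<theta>(2)[of "snd z"] by (cases z) auto
    qed
    let ?F = "\<lambda>z. (g z, q z) \<bullet> jet \<psi> (snd z)"
    have "(\<lambda>z. jet \<psi> (snd z)) \<in> L2 ?X"
      unfolding jet_def
      by (intro L2_Pair L2_vec sndL2 K(1,4) smooth_deriv
          frechet_derivative_0_outside[OF compact_imp_closed[OF K(2)], where \<phi> = \<psi>])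
    then have F: "integrable (lebesgue_on ?X) ?F"
      by (rule L2_inner_integrable[OF Q])
    define b where "b t = (LINT x|lebesgue_on \<Omega>. ?F (t, x))" for t
    have b: "integrable (lebesgue_on ?I) b"
      unfolding b_def by (rule integrable_slice_integral[OF I \<Omega> F])
    have "AE t in lebesgue_on ?I. b t = 0"
    proof (rule AE_0_if_box_bump_orthogonal[OF I borel_measurable_integrable[OF b]])
      fix l u :: real and n assume lu: "cbox l u \<subseteq> ?I"
      show "integrable (lebesgue_on ?I) (\<lambda>t. indicator (cbox l u) t * b t)"
        using integrable_mult_indicator[OF _ b, of "cbox l u"] lu
        by (simp add: sets_restrict_space_iff)
      define \<beta> where "\<beta> = box_bump n l u"
      have \<beta>: "\<beta> \<in> test_functions ?I" unfolding \<beta>_def by (rule box_bump_test[OF lu])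
      have t: "(\<lambda>z. \<beta> (fst z) * \<psi> (snd z)) \<in> test_functions ?X"
        by (rule test_tensor[OF \<beta> \<psi>])
      have G: "(\<Sum>i\<in>UNIV. q z $ i * frechet_derivative (\<lambda>z. \<beta> (fst z) * \<psi> (snd z)) (at z) (0, axis i 1))
          + g z * (\<beta> (fst z) * \<psi> (snd z)) = ?F z * \<beta> (fst z)" for z
      proof -
        have "frechet_derivative \<beta> (at (fst z)) 0 = 0"
          by (rule linear_0[OF has_derivative_linear[OF smooth_has_derivative[OF test_smooth[OF \<beta>]]]])
        then show ?thesis
          by (simp add: frechet_derivative_tensor[OF test_smooth[OF \<beta>] test_smooth[OF \<psi>]] inner_jet
              sum_distrib_left sum_distrib_right algebra_simps)
      qed
      have i1: "integrable (lebesgue_on ?X) (\<lambda>z. \<Sum>i\<in>UNIV. q z $ i * frechet_derivative (\<lambda>z. \<beta> (fst z) * \<psi> (snd z)) (at z) (0, axis i 1))"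
        by (rule L2_space_gradient_integrable[OF X q t])
      have i2: "integrable (lebesgue_on ?X) (\<lambda>z. g z * (\<beta> (fst z) * \<psi> (snd z)))"
        by (rule L2_mult_integrable[OF g test_L2[OF t X]])
      have i3: "integrable (lebesgue_on ?X) (\<lambda>z. ?F z * \<beta> (fst z))"
        using Bochner_Integration.integrable_add[OF i1 i2] by (simp only: G)
      have "(LINT t|lebesgue_on ?I. b t * \<beta> t) = (LINT t|lebesgue_on ?I. (LINT x|lebesgue_on \<Omega>. ?F (t, x) * \<beta> (fst (t, x))))"
        unfolding b_def by simp
      also have "\<dots> = (LINT z|lebesgue_on ?X. ?F z * \<beta> (fst z))"
        by (rule integral_slice_integral[OF I \<Omega> i3])
      also have "\<dots> = 0"
        using Bochner_Integration.integral_add[OF i1 i2] d t by (simp only: G) (simp add: has_space_div_def)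
      finally show "(LINT t|lebesgue_on ?I. b t * box_bump n l u t) = 0" by (simp add: \<beta>_def)
    qed
    then show ?thesis by (simp add: b_def)
  qed
  have "AE t in lebesgue_on ?I. \<forall>\<psi>\<in>D. (LINT x|lebesgue_on \<Omega>. (g (t, x), q (t, x)) \<bullet> jet \<psi> x) = 0"
    using D(2) zero by (subst AE_ball_countable[OF D(1)]) auto
  moreover have "AE t in lebesgue_on ?I. (\<lambda>x. g (t, x)) \<in> L2 \<Omega>"
    by (rule L2_slices[OF I \<Omega> g])
  moreover have "AE t in lebesgue_on ?I. \<forall>i. (\<lambda>x. q (t, x) $ i) \<in> L2 \<Omega>"
    using L2_slices[OF I \<Omega> L2_nth[OF q]] by (subst AE_all_countable) auto
  ultimately show ?thesis
  proof eventually_elim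
    fix t assume z: "\<forall>\<psi>\<in>D. (LINT x|lebesgue_on \<Omega>. (g (t, x), q (t, x)) \<bullet> jet \<psi> x) = 0"
      and gt: "(\<lambda>x. g (t, x)) \<in> L2 \<Omega>" and qt: "\<forall>i. (\<lambda>x. q (t, x) $ i) \<in> L2 \<Omega>"
    have qt: "(\<lambda>x. q (t, x)) \<in> L2 \<Omega>" using L2_vec[of "\<lambda>i x. q (t, x) $ i"] qt by simp
    let ?Q = "\<lambda>x. (g (t, x), q (t, x))"
    have Qt: "?Q \<in> L2 \<Omega>" by (rule L2_Pair[OF gt qt])
    show "has_div \<Omega> (\<lambda>x. q (t, x)) (\<lambda>x. g (t, x))"
      unfolding has_div_def
    proof (intro conjI ballI gt qt)
      fix \<phi> assume \<phi>: "\<phi> \<in> test_functions \<Omega>"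
      obtain N where N: "\<And>\<epsilon>. \<epsilon> > 0 \<Longrightarrow> \<exists>\<psi>\<in>D. \<forall>x. norm (jet \<phi> x - jet \<psi> x) \<le> \<epsilon> * indicator (?K N) x"
        using D(3)[OF \<phi>] by blast
      \<comment> \<open>Uniform closeness of jets suffices because \<open>?Q\<close> is integrable over the common support \<open>?K N\<close>.\<close>
      define c where "c = (LINT x|lebesgue_on \<Omega>. indicator (?K N) x * norm (?Q x))"
      have ic: "integrable (lebesgue_on \<Omega>) (\<lambda>x. indicator (?K N) x * norm (?Q x))"
        by (rule L2_indicator_integrable[OF \<Omega> L2_norm_fun[OF Qt]])
      have c0: "c \<ge> 0" unfolding c_def by simp
      have "\<bar>LINT x|lebesgue_on \<Omega>. ?Q x \<bullet> jet \<phi> x\<bar> \<le> \<epsilon>" if \<epsilon>: "\<epsilon> > 0" for \<epsilon>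
      proof -
        have "\<epsilon> / (c + 1) > 0" using \<epsilon> c0 by simp
        then obtain \<psi> where \<psi>: "\<psi> \<in> D" "\<And>x. norm (jet \<phi> x - jet \<psi> x) \<le> \<epsilon> / (c + 1) * indicator (?K N) x"
          using N by blast
        have \<psi>t: "\<psi> \<in> test_functions \<Omega>" using D(2) \<psi>(1) by blast
        have "(LINT x|lebesgue_on \<Omega>. ?Q x \<bullet> jet \<phi> x) = (LINT x|lebesgue_on \<Omega>. ?Q x \<bullet> jet \<phi> x - ?Q x \<bullet> jet \<psi> x)"
          using z \<psi>(1) by (subst Bochner_Integration.integral_diff)
            (auto intro!: L2_inner_integrable Qt jet_L2[OF \<phi> \<Omega>] jet_L2[OF \<psi>t \<Omega>])
        also have "\<bar>\<dots>\<bar> \<le> (LINT x|lebesgue_on \<Omega>. \<epsilon> / (c + 1) * (indicator (?K N) x * norm (?Q x)))"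
        proof (rule order_trans[OF integral_abs_bound], rule integral_mono)
          show "integrable (lebesgue_on \<Omega>) (\<lambda>x. \<bar>?Q x \<bullet> jet \<phi> x - ?Q x \<bullet> jet \<psi> x\<bar>)"
            by (intro integrable_abs Bochner_Integration.integrable_diff L2_inner_integrable Qt jet_L2[OF \<phi> \<Omega>] jet_L2[OF \<psi>t \<Omega>])
          show "integrable (lebesgue_on \<Omega>) (\<lambda>x. \<epsilon> / (c + 1) * (indicator (?K N) x * norm (?Q x)))"
            by (intro integrable_mult_right ic)
          fix x
          have "\<bar>?Q x \<bullet> jet \<phi> x - ?Q x \<bullet> jet \<psi> x\<bar> \<le> norm (?Q x) * norm (jet \<phi> x - jet \<psi> x)"
            unfolding inner_diff_right[symmetric] by (rule Cauchy_Schwarz_ineq2)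
          also have "\<dots> \<le> norm (?Q x) * (\<epsilon> / (c + 1) * indicator (?K N) x)"
            by (intro mult_left_mono \<psi>(2) norm_ge_zero)
          finally show "\<bar>?Q x \<bullet> jet \<phi> x - ?Q x \<bullet> jet \<psi> x\<bar> \<le> \<epsilon> / (c + 1) * (indicator (?K N) x * norm (?Q x))"
            by (simp only: mult_ac)
        qed
        also have "\<dots> = \<epsilon> / (c + 1) * c" unfolding c_def by simp
        also have "\<dots> \<le> \<epsilon>" using \<epsilon> c0 by (simp add: field_simps)
        finally show ?thesis .
      qed
      then have "\<bar>LINT x|lebesgue_on \<Omega>. ?Q x \<bullet> jet \<phi> x\<bar> \<le> 0"
        by (subst add_0[symmetric]) (rule field_le_epsilon, simp only: add_0)
      then show "(LINT x|lebesgue_on \<Omega>. ?Q x \<bullet> jet \<phi> x) = 0" by simp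
    qed
  qed
qed

text \<open>
  A weak partial derivative is the weak divergence of the field with the function as its only nonzero
  component.
\<close>

lemma slice_has_weak_deriv:
  fixes \<Omega> :: "(real^'d) set" and f :: "real \<times> (real^'d) \<Rightarrow> real"
  assumes \<Omega>: "open \<Omega>" and f: "f \<in> L2 ({0<..<T} \<times> \<Omega>)"
    and d: "has_weak_deriv ({0<..<T} \<times> \<Omega>) (0, axis i 1) f g"
  shows "AE t in lebesgue_on {0<..<T}. has_weak_deriv \<Omega> (axis i 1) (\<lambda>x. f (t, x)) (\<lambda>x. g (t, x))"
proof -
  let ?X = "{0<..<T} \<times> \<Omega>"
  let ?q = "\<lambda>z. \<chi> j. if j = i then f z else 0"
  have s: "(\<Sum>j\<in>UNIV. (if j = i then a else 0) * h j) = a * h i" for a :: real and h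
    by (simp add: if_distrib[of "\<lambda>x. x * _"] cong: if_cong)
  have zero: "(\<lambda>x. 0) \<in> L2 ?X"
    by (simp add: L2_def)
  have "?q \<in> L2 ?X"
  proof (rule L2_vec)
    show "(\<lambda>z. if j = i then f z else 0) \<in> L2 ?X" for j
      using f zero by (cases "j = i") auto
  qed
  moreover have "has_space_div ?X ?q g"
    using d by (simp add: has_space_div_def has_weak_deriv_def s)
  ultimately have "AE t in lebesgue_on {0<..<T}. has_div \<Omega> (\<lambda>x. ?q (t, x)) (\<lambda>x. g (t, x))"
    by (rule slice_has_div[OF \<Omega>])
  moreover have "AE t in lebesgue_on {0<..<T}. (\<lambda>x. f (t, x)) \<in> L2 \<Omega>"
    by (rule L2_slices[OF _ \<Omega> f]) simp
  ultimately show ?thesis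
  proof eventually_elim
    fix t assume t: "has_div \<Omega> (\<lambda>x. ?q (t, x)) (\<lambda>x. g (t, x))" and ft: "(\<lambda>x. f (t, x)) \<in> L2 \<Omega>"
    then have gt: "(\<lambda>x. g (t, x)) \<in> L2 \<Omega>" by (simp add: has_div_def)
    show "has_weak_deriv \<Omega> (axis i 1) (\<lambda>x. f (t, x)) (\<lambda>x. g (t, x))"
      unfolding has_weak_deriv_def
    proof (intro conjI ballI gt)
      fix \<phi> assume \<phi>: "\<phi> \<in> test_functions \<Omega>"
      have "(LINT x|lebesgue_on \<Omega>. g (t, x) * \<phi> x + f (t, x) * frechet_derivative \<phi> (at x) (axis i 1)) = 0"
        using t \<phi> by (simp add: has_div_def inner_jet s)
      then show "(LINT x|lebesgue_on \<Omega>. f (t, x) * frechet_derivative \<phi> (at x) (axis i 1)) =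
          - (LINT x|lebesgue_on \<Omega>. g (t, x) * \<phi> x)"
        by (subst (asm) Bochner_Integration.integral_add)
          (auto intro!: L2_mult_integrable gt ft test_L2[OF \<phi> \<Omega>] test_L2[OF test_deriv[OF \<phi>] \<Omega>])
    qed
  qed
qed

section \<open>Integration by parts in space\<close>

text \<open>
  The integral of \<open>F\<close> is invariant under translation, so the difference quotients of \<open>F\<close> have integral
  \<open>0\<close>. They converge to the derivative and are dominated by the mean value theorem.
\<close>

lemma integral_derivative_eq_0:
  fixes F :: "'a::euclidean_space \<Rightarrow> real"
  assumes F: "smooth F" and K: "compact K" "\<And>x. x \<notin> K \<Longrightarrow> F x = 0"
  shows "(\<integral>x. frechet_derivative F (at x) v \<partial>lborel) = 0"
proof -
  let ?D = "\<lambda>x. frechet_derivative F (at x) v"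
  have D0: "?D x = 0" if "x \<notin> K" for x
    using K that by (intro frechet_derivative_0_outside[OF compact_imp_closed])
  have cD: "continuous_on UNIV ?D"
    by (rule smooth_continuous[OF smooth_deriv[OF F]])
  obtain M where M: "M \<ge> 0" "\<And>x. \<bar>?D x\<bar> \<le> M"
  proof -
    have "bounded (?D ` K)"
      by (intro compact_imp_bounded compact_continuous_image continuous_on_subset[OF cD] K) auto
    then obtain M where M: "\<And>x. x \<in> K \<Longrightarrow> \<bar>?D x\<bar> \<le> M"
      by (auto simp: bounded_iff)
    have "\<bar>?D x\<bar> \<le> max M 0" for x
      using M[of x] D0[of x] by (cases "x \<in> K") auto
    then show ?thesis by (intro that[of "max M 0"]) auto
  qed
  define h where "h n = inverse (real (Suc n))" for n
  have h: "0 < h n" "h n \<le> 1" for n by (auto simp: h_def field_simps)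
  let ?s = "\<lambda>n x. (F (h n *\<^sub>R v + x) - F x) / h n"
  \<comment> \<open>A compact set that contains the supports of all difference quotients with step at most \<open>1\<close>.\<close>
  define L where "L = (\<lambda>p. fst p - snd p *\<^sub>R v) ` (K \<times> {0..1::real})"
  have L: "compact L"
    unfolding L_def by (intro compact_continuous_image continuous_intros compact_Times K(1)) auto
  have [measurable]: "F \<in> borel_measurable borel" "?D \<in> borel_measurable borel"
    using F smooth_deriv[OF F] by (auto intro: smooth_borel)
  have FI: "integrable lborel F"
  proof -
    have "integrable lborel (\<lambda>x. indicator K x *\<^sub>R F x)"
      by (intro borel_integrable_compact K continuous_on_subset[OF smooth_continuous[OF F]]) auto
    also have "(\<lambda>x. indicator K x *\<^sub>R F x) = F"
      using K(2) by (auto simp: indicator_def fun_eq_iff)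
    finally show ?thesis .
  qed
  have tr: "has_bochner_integral lborel (\<lambda>x. F (c + x)) (\<integral>x. F x \<partial>lborel)" for c
  proof -
    have "has_bochner_integral (distr lborel borel ((+) c)) F (\<integral>x. F x \<partial>lborel)"
      using FI by (simp add: lborel_distr_plus has_bochner_integral_integrable)
    then show ?thesis
      by (simp add: has_bochner_integral_iff integrable_distr_eq integral_distr)
  qed
  have zero: "(\<integral>x. ?s n x \<partial>lborel) = 0" for n
    using tr[of "h n *\<^sub>R v"] FI by (simp add: has_bochner_integral_iff)
  have deriv: "((\<lambda>t. F (t *\<^sub>R v + x)) has_real_derivative ?D (t *\<^sub>R v + x)) (at t)" for t x
  proof -
    have a: "((\<lambda>t. t *\<^sub>R v + x) has_derivative (\<lambda>s. s *\<^sub>R v)) (at t)"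
      by (auto intro!: derivative_eq_intros)
    have "linear (frechet_derivative F (at (t *\<^sub>R v + x)))"
      by (rule has_derivative_linear[OF smooth_has_derivative[OF F]])
    then have "(\<lambda>s. frechet_derivative F (at (t *\<^sub>R v + x)) (s *\<^sub>R v)) = (*) (?D (t *\<^sub>R v + x))"
      by (auto simp: linear_scale fun_eq_iff)
    then show ?thesis
      using has_derivative_compose[OF a smooth_has_derivative[OF F]]
      by (simp add: has_field_derivative_def)
  qed
  have "(\<lambda>n. \<integral>x. ?s n x \<partial>lborel) \<longlonglongrightarrow> (\<integral>x. ?D x \<partial>lborel)"
  proof (rule integral_dominated_convergence[where w = "\<lambda>x. indicator L x *\<^sub>R M"])
    show "integrable lborel (\<lambda>x. indicator L x *\<^sub>R M)"
      by (intro borel_integrable_compact L continuous_on_const)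
    show "AE x in lborel. (\<lambda>n. ?s n x) \<longlonglongrightarrow> ?D x"
    proof (rule AE_I2)
      fix x
      have "((\<lambda>t. (F ((0 + t) *\<^sub>R v + x) - F (0 *\<^sub>R v + x)) / t) \<longlongrightarrow> ?D (0 *\<^sub>R v + x)) (at 0)"
        using deriv[of x 0] unfolding DERIV_def .
      then have *: "((\<lambda>t. (F (t *\<^sub>R v + x) - F x) / t) \<longlongrightarrow> ?D x) (at 0)"
        by simp
      have "filterlim h (at 0) sequentially"
        unfolding h_def filterlim_at using LIMSEQ_inverse_real_of_nat by auto
      from filterlim_compose[OF * this] show "(\<lambda>n. ?s n x) \<longlonglongrightarrow> ?D x" .
    qed
    show "AE x in lborel. norm (?s n x) \<le> indicator L x *\<^sub>R M" for n
    proof (rule AE_I2)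
      fix x
      show "norm (?s n x) \<le> indicator L x *\<^sub>R M"
      proof (cases "x \<in> L")
        case True
        obtain t where t: "F (h n *\<^sub>R v + x) - F (0 *\<^sub>R v + x) = (h n - 0) * ?D (t *\<^sub>R v + x)"
          using MVT2[of 0 "h n" "\<lambda>t. F (t *\<^sub>R v + x)" "\<lambda>t. ?D (t *\<^sub>R v + x)"] deriv h(1)[of n] by blast
        then have "?s n x = ?D (t *\<^sub>R v + x)" using h(1)[of n] by simp
        then show ?thesis using True M(2) by simp
      next
        case False
        have "x \<notin> K"
          using False unfolding L_def by (force intro: image_eqI[of _ _ "(x, 0)"])
        moreover have "h n *\<^sub>R v + x \<notin> K"
        proof
          assume "h n *\<^sub>R v + x \<in> K"
          then have "x \<in> L" unfolding L_def
            using h[of n] by (intro image_eqI[of _ _ "(h n *\<^sub>R v + x, h n)"]) auto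
          with False show False ..
        qed
        ultimately show ?thesis using K(2) M(1) by simp
      qed
    qed
  qed simp_all
  then show ?thesis unfolding zero by (simp add: LIMSEQ_const_iff)
qed

text \<open>
  The classical derivative of a test function is its weak derivative: integrate the derivative of the
  product of two test functions.
\<close>

lemma test_has_weak_deriv:
  fixes \<phi> :: "'a::euclidean_space \<Rightarrow> real"
  assumes S: "open S" and \<phi>: "\<phi> \<in> test_functions S"
  shows "has_weak_deriv S v \<phi> (\<lambda>x. frechet_derivative \<phi> (at x) v)"
  unfolding has_weak_deriv_def
proof (intro conjI ballI)
  show "(\<lambda>x. frechet_derivative \<phi> (at x) v) \<in> L2 S"
    by (rule test_L2[OF test_deriv[OF \<phi>] S])
  fix \<psi> assume \<psi>: "\<psi> \<in> test_functions S"
  have p: "(\<lambda>x. \<phi> x * \<psi> x) \<in> test_functions S"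
    by (rule test_mult[OF \<phi> test_smooth[OF \<psi>]])
  obtain K where K: "smooth (\<lambda>x. \<phi> x * \<psi> x)" "compact K" "K \<subseteq> S" "\<And>x. x \<notin> K \<Longrightarrow> \<phi> x * \<psi> x = 0"
    by (rule test_functionsE[OF p]) (rule that)
  have "(LINT x|lebesgue_on S. frechet_derivative (\<lambda>x. \<phi> x * \<psi> x) (at x) v) =
      (LINT x|lborel. frechet_derivative (\<lambda>x. \<phi> x * \<psi> x) (at x) v)"
    using K by (intro integral_lebesgue_on_eq_lborel S smooth_borel smooth_deriv
        frechet_derivative_0_outside[OF compact_imp_closed[OF K(2)], where \<phi> = "\<lambda>x. \<phi> x * \<psi> x"]) auto
  also have "\<dots> = 0"
    by (rule integral_derivative_eq_0[OF K(1,2,4)])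
  also have "(\<lambda>x. frechet_derivative (\<lambda>x. \<phi> x * \<psi> x) (at x) v) =
      (\<lambda>x. \<phi> x * frechet_derivative \<psi> (at x) v + frechet_derivative \<phi> (at x) v * \<psi> x)"
    using test_smooth[OF \<phi>] test_smooth[OF \<psi>] by (simp add: frechet_derivative_mult)
  finally have "(LINT x|lebesgue_on S. \<phi> x * frechet_derivative \<psi> (at x) v + frechet_derivative \<phi> (at x) v * \<psi> x) = 0" .
  then show "(LINT x|lebesgue_on S. \<phi> x * frechet_derivative \<psi> (at x) v) =
      - (LINT x|lebesgue_on S. frechet_derivative \<phi> (at x) v * \<psi> x)"
    by (subst (asm) Bochner_Integration.integral_add)
      (auto intro!: L2_mult_integrable test_L2[OF \<phi> S] test_L2[OF \<psi> S] test_L2[OF test_deriv[OF \<phi>] S]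
        test_L2[OF test_deriv[OF \<psi>] S])
qed

text \<open>
  The definition of \<^const>\<open>wgrad\<close> picks some weak gradient; by uniqueness any known one computes the
  norm.
\<close>

lemma H1_norm_sq:
  fixes \<Omega> :: "(real^'d) set"
  assumes \<Omega>: "open \<Omega>" and f: "f \<in> L2 \<Omega>" and G: "\<And>i. has_weak_deriv \<Omega> (axis i 1) f (\<lambda>x. G x $ i)"
  shows "(H1_norm \<Omega> f)\<^sup>2 = (LINT x|lebesgue_on \<Omega>. (norm (f x, G x))\<^sup>2)"
    and "AE x in lebesgue_on \<Omega>. wgrad \<Omega> f x = G x" and "G \<in> L2 \<Omega>" and "wgrad \<Omega> f \<in> L2 \<Omega>"
proof -
  have Gi: "(\<lambda>x. G x $ i) \<in> L2 \<Omega>" for i using G by (simp add: has_weak_deriv_def)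
  show GL: "G \<in> L2 \<Omega>" using L2_vec[of "\<lambda>i x. G x $ i", OF Gi] by simp
  show WL: "wgrad \<Omega> f \<in> L2 \<Omega>"
    unfolding wgrad_def using weak_deriv_has_weak_deriv[OF G] by (intro L2_vec) (simp add: has_weak_deriv_def)
  have "AE x in lebesgue_on \<Omega>. \<forall>i. weak_deriv \<Omega> (axis i 1) f x = G x $ i"
    using weak_deriv_AE_eq[OF \<Omega> G] by (subst AE_all_countable) auto
  then show ae: "AE x in lebesgue_on \<Omega>. wgrad \<Omega> f x = G x"
    by eventually_elim (simp add: wgrad_def vec_eq_iff)
  have "(H1_norm \<Omega> f)\<^sup>2 = (LINT x|lebesgue_on \<Omega>. (norm (f x))\<^sup>2) + (LINT x|lebesgue_on \<Omega>. (norm (wgrad \<Omega> f x))\<^sup>2)"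
    by (simp add: H1_norm_def L2_norm_def)
  also have "(LINT x|lebesgue_on \<Omega>. (norm (wgrad \<Omega> f x))\<^sup>2) = (LINT x|lebesgue_on \<Omega>. (norm (G x))\<^sup>2)"
    by (rule integral_cong_AE) (use ae L2_integrable[OF GL] L2_integrable[OF WL] in \<open>auto elim: eventually_mono\<close>)
  also have "(LINT x|lebesgue_on \<Omega>. (norm (f x))\<^sup>2) + (LINT x|lebesgue_on \<Omega>. (norm (G x))\<^sup>2) =
      (LINT x|lebesgue_on \<Omega>. (norm (f x, G x))\<^sup>2)"
    using L2_integrable[OF GL] L2_integrable[OF f]
    by (simp add: norm_Pair)
  finally show "(H1_norm \<Omega> f)\<^sup>2 = (LINT x|lebesgue_on \<Omega>. (norm (f x, G x))\<^sup>2)" .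
qed

lemma H1_has_gradient:
  fixes \<Omega> :: "(real^'d) set"
  assumes "f \<in> H1 \<Omega>"
  shows "has_weak_deriv \<Omega> (axis i 1) f (\<lambda>x. wgrad \<Omega> f x $ i)"
  using assms by (auto simp: H1_def wgrad_def intro: weak_deriv_has_weak_deriv)

lemma H1_minus_test:
  fixes \<Omega> :: "(real^'d) set"
  assumes \<Omega>: "open \<Omega>" and f: "f \<in> L2 \<Omega>" and G: "\<And>i. has_weak_deriv \<Omega> (axis i 1) f (\<lambda>x. G x $ i)"
    and \<phi>: "\<phi> \<in> test_functions \<Omega>"
  shows "has_weak_deriv \<Omega> (axis i 1) (\<lambda>x. f x - \<phi> x) (\<lambda>x. (G x - snd (jet \<phi> x)) $ i)"
  using has_weak_deriv_diff[OF \<Omega> f test_L2[OF \<phi> \<Omega>] G test_has_weak_deriv[OF \<Omega> \<phi>]]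
  by (simp add: jet_def)

text \<open>
  For a test function in place of \<open>f\<close> this is the definition of the weak divergence. Both sides are
  continuous in the Sobolev norm, in which test functions approximate \<open>f\<close>.
\<close>

lemma H1_ring_integration_by_parts:
  fixes \<Omega> :: "(real^'d) set"
  assumes \<Omega>: "open \<Omega>" and f: "f \<in> H1_ring \<Omega>" and G: "\<And>i. has_weak_deriv \<Omega> (axis i 1) f (\<lambda>x. G x $ i)"
    and q: "has_div \<Omega> q g"
  shows "(LINT x|lebesgue_on \<Omega>. g x * f x + q x \<bullet> G x) = 0"
proof -
  have fL: "f \<in> L2 \<Omega>" using f by (simp add: H1_ring_def H1_def)
  let ?Q = "\<lambda>x. (g x, q x)" and ?F = "\<lambda>x. (f x, G x)"
  have Q: "?Q \<in> L2 \<Omega>" using q by (auto simp: has_div_def intro: L2_Pair)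
  have F: "?F \<in> L2 \<Omega>" by (intro L2_Pair fL H1_norm_sq(3)[OF \<Omega> fL G])
  define c where "c = (LINT x|lebesgue_on \<Omega>. (norm (?Q x))\<^sup>2)"
  have c: "c \<ge> 0" unfolding c_def by simp
  have bound: "\<bar>LINT x|lebesgue_on \<Omega>. ?Q x \<bullet> ?F x\<bar> \<le> 0 + \<eta>" if \<eta>: "\<eta> > 0" for \<eta>
  proof -
    \<comment> \<open>The weight \<open>r\<close> in the Young inequality makes the contribution of \<open>?Q\<close> at most \<open>\<eta> / 2\<close>; the test
      function is then so close to \<open>f\<close> that the other contribution is at most \<open>\<eta> / 2\<close> as well.\<close>
    define r where "r = \<eta> / (c + 1)"
    have r: "r > 0" "r * c \<le> \<eta>" using \<eta> c by (auto simp: r_def field_simps)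
    have "sqrt (r * \<eta>) > 0" using r \<eta> by simp
    then obtain \<phi> where \<phi>: "\<phi> \<in> test_functions \<Omega>" "H1_norm \<Omega> (\<lambda>x. f x - \<phi> x) < sqrt (r * \<eta>)"
      using f unfolding H1_ring_def by blast
    let ?J = "\<lambda>x. ?F x - jet \<phi> x"
    have J: "?J \<in> L2 \<Omega>" by (intro L2_diff F jet_L2[OF \<phi>(1) \<Omega>])
    have "(H1_norm \<Omega> (\<lambda>x. f x - \<phi> x))\<^sup>2 = (LINT x|lebesgue_on \<Omega>. (norm (?J x))\<^sup>2)"
      using H1_norm_sq(1)[OF \<Omega> L2_diff[OF fL test_L2[OF \<phi>(1) \<Omega>]] H1_minus_test[OF \<Omega> fL G \<phi>(1)]]
      by (simp add: jet_def)
    moreover have "(H1_norm \<Omega> (\<lambda>x. f x - \<phi> x))\<^sup>2 \<le> (sqrt (r * \<eta>))\<^sup>2"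
      using \<phi>(2) by (intro power_mono) (auto simp: H1_norm_def)
    ultimately have Jn: "(LINT x|lebesgue_on \<Omega>. (norm (?J x))\<^sup>2) \<le> r * \<eta>"
      using r \<eta> by simp
    have "(LINT x|lebesgue_on \<Omega>. ?Q x \<bullet> ?F x) = (LINT x|lebesgue_on \<Omega>. ?Q x \<bullet> ?J x)"
      unfolding inner_diff_right
      by (subst Bochner_Integration.integral_diff)
        (use q \<phi>(1) L2_inner_integrable[OF Q F] L2_inner_integrable[OF Q jet_L2[OF \<phi>(1) \<Omega>]]
          in \<open>auto simp: has_div_def\<close>)
    also have "\<bar>\<dots>\<bar> \<le> (LINT x|lebesgue_on \<Omega>. r / 2 * (norm (?Q x))\<^sup>2 + inverse (2 * r) * (norm (?J x))\<^sup>2)"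
    proof (rule order_trans[OF integral_abs_bound], rule integral_mono)
      show "integrable (lebesgue_on \<Omega>) (\<lambda>x. \<bar>?Q x \<bullet> ?J x\<bar>)"
        by (intro integrable_abs L2_inner_integrable Q J)
      show "integrable (lebesgue_on \<Omega>) (\<lambda>x. r / 2 * (norm (?Q x))\<^sup>2 + inverse (2 * r) * (norm (?J x))\<^sup>2)"
        by (intro Bochner_Integration.integrable_add integrable_mult_right L2_integrable Q J)
      fix x
      have young: "a * b \<le> r / 2 * a\<^sup>2 + inverse (2 * r) * b\<^sup>2" for a b :: real
      proof -
        have "0 \<le> (r * a - b)\<^sup>2 / (2 * r)" using r(1) by simp
        also have "\<dots> = r / 2 * a\<^sup>2 + inverse (2 * r) * b\<^sup>2 - a * b"
          using r(1) by (simp add: power2_eq_square field_simps)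
        finally show ?thesis by simp
      qed
      show "\<bar>?Q x \<bullet> ?J x\<bar> \<le> r / 2 * (norm (?Q x))\<^sup>2 + inverse (2 * r) * (norm (?J x))\<^sup>2"
        by (rule order_trans[OF Cauchy_Schwarz_ineq2 young])
    qed
    also have "\<dots> = r / 2 * c + inverse (2 * r) * (LINT x|lebesgue_on \<Omega>. (norm (?J x))\<^sup>2)"
      unfolding c_def
      by (subst Bochner_Integration.integral_add) (auto intro!: integrable_mult_right L2_integrable Q J)
    also have "\<dots> \<le> r / 2 * c + inverse (2 * r) * (r * \<eta>)"
      using r(1) by (intro add_left_mono mult_left_mono Jn) auto
    also have "\<dots> \<le> 0 + \<eta>" using r by (simp add: field_simps)
    finally show ?thesis .
  qed
  have "\<bar>LINT x|lebesgue_on \<Omega>. ?Q x \<bullet> ?F x\<bar> \<le> 0"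
    by (rule field_le_epsilon) (rule bound)
  then show ?thesis by simp
qed

lemma H1_ring_diff:
  fixes \<Omega> :: "(real^'d) set"
  assumes \<Omega>: "open \<Omega>" and f: "f \<in> H1_ring \<Omega>" and g: "g \<in> H1_ring \<Omega>"
  shows "(\<lambda>x. f x - g x) \<in> H1_ring \<Omega>"
proof -
  have H: "f \<in> H1 \<Omega>" "g \<in> H1 \<Omega>" using f g by (auto simp: H1_ring_def)
  then have L: "f \<in> L2 \<Omega>" "g \<in> L2 \<Omega>" by (auto simp: H1_def)
  note D = H1_has_gradient[OF H(1)] H1_has_gradient[OF H(2)]
  note DD = has_weak_deriv_diff[OF \<Omega> L D]
  have "(\<lambda>x. f x - g x) \<in> H1 \<Omega>"
    using L2_diff[OF L] DD by (auto simp: H1_def)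
  moreover have "\<exists>\<theta>\<in>test_functions \<Omega>. H1_norm \<Omega> (\<lambda>x. f x - g x - \<theta> x) < \<epsilon>" if \<epsilon>: "\<epsilon> > 0" for \<epsilon>
  proof -
    obtain \<phi> where \<phi>: "\<phi> \<in> test_functions \<Omega>" "H1_norm \<Omega> (\<lambda>x. f x - \<phi> x) < \<epsilon> / 2"
      using f \<epsilon> unfolding H1_ring_def by (auto dest: spec[of _ "\<epsilon> / 2"])
    obtain \<psi> where \<psi>: "\<psi> \<in> test_functions \<Omega>" "H1_norm \<Omega> (\<lambda>x. g x - \<psi> x) < \<epsilon> / 2"
      using g \<epsilon> unfolding H1_ring_def by (auto dest: spec[of _ "\<epsilon> / 2"])
    note L1 = L2_diff[OF L(1) test_L2[OF \<phi>(1) \<Omega>]] and M1 = H1_minus_test[OF \<Omega> L(1) D(1) \<phi>(1)]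
    note L2 = L2_diff[OF L(2) test_L2[OF \<psi>(1) \<Omega>]] and M2 = H1_minus_test[OF \<Omega> L(2) D(2) \<psi>(1)]
    let ?A = "\<lambda>x. (f x - \<phi> x, wgrad \<Omega> f x - snd (jet \<phi> x))"
    let ?B = "\<lambda>x. (g x - \<psi> x, wgrad \<Omega> g x - snd (jet \<psi> x))"
    have A: "?A \<in> L2 \<Omega>" by (intro L2_Pair L1 H1_norm_sq(3)[OF \<Omega> L1 M1])
    have B: "?B \<in> L2 \<Omega>" by (intro L2_Pair L2 H1_norm_sq(3)[OF \<Omega> L2 M2])
    let ?\<theta> = "\<lambda>x. \<phi> x - \<psi> x"
    have "(H1_norm \<Omega> (\<lambda>x. f x - g x - ?\<theta> x))\<^sup>2 = (LINT x|lebesgue_on \<Omega>. (norm (?A x - ?B x))\<^sup>2)"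
    proof -
      have "(H1_norm \<Omega> (\<lambda>x. (f x - \<phi> x) - (g x - \<psi> x)))\<^sup>2 =
          (LINT x|lebesgue_on \<Omega>. (norm ((f x - \<phi> x) - (g x - \<psi> x),
            (wgrad \<Omega> f x - snd (jet \<phi> x)) - (wgrad \<Omega> g x - snd (jet \<psi> x))))\<^sup>2)"
        using has_weak_deriv_diff[OF \<Omega> L1 L2 M1 M2] by (intro H1_norm_sq(1)[OF \<Omega> L2_diff[OF L1 L2]]) simp
      moreover have "(\<lambda>x. f x - g x - ?\<theta> x) = (\<lambda>x. (f x - \<phi> x) - (g x - \<psi> x))"
        by (simp add: algebra_simps)
      ultimately show ?thesis by simp
    qed
    also have "\<dots> \<le> (LINT x|lebesgue_on \<Omega>. 2 * (norm (?A x))\<^sup>2 + 2 * (norm (?B x))\<^sup>2)"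
    proof (rule integral_mono)
      show "integrable (lebesgue_on \<Omega>) (\<lambda>x. (norm (?A x - ?B x))\<^sup>2)"
        by (intro L2_integrable L2_diff A B)
      show "integrable (lebesgue_on \<Omega>) (\<lambda>x. 2 * (norm (?A x))\<^sup>2 + 2 * (norm (?B x))\<^sup>2)"
        by (intro Bochner_Integration.integrable_add integrable_mult_right L2_integrable A B)
      fix x show "(norm (?A x - ?B x))\<^sup>2 \<le> 2 * (norm (?A x))\<^sup>2 + 2 * (norm (?B x))\<^sup>2"
        using norm_add_sq_le[of "?A x" "- ?B x"] by (simp only: norm_minus_cancel add_uminus_conv_diff)
    qed
    also have "\<dots> = 2 * (H1_norm \<Omega> (\<lambda>x. f x - \<phi> x))\<^sup>2 + 2 * (H1_norm \<Omega> (\<lambda>x. g x - \<psi> x))\<^sup>2"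
      unfolding H1_norm_sq(1)[OF \<Omega> L1 M1] H1_norm_sq(1)[OF \<Omega> L2 M2]
      by (subst Bochner_Integration.integral_add)
        (auto intro!: integrable_mult_right L2_integrable A B)
    also have "\<dots> < 2 * (\<epsilon> / 2)\<^sup>2 + 2 * (\<epsilon> / 2)\<^sup>2"
      using \<phi>(2) \<psi>(2) by (intro add_strict_mono mult_strict_left_mono power_strict_mono) (auto simp: H1_norm_def)
    also have "\<dots> = \<epsilon>\<^sup>2" by (simp add: power2_eq_square)
    finally have "H1_norm \<Omega> (\<lambda>x. f x - g x - ?\<theta> x) < \<epsilon>"
      using \<epsilon> by (simp add: power_less_imp_less_base)
    then show ?thesis by (rule bexI[of _ ?\<theta>, OF _ test_diff[OF \<phi>(1) \<psi>(1)]])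
  qed
  ultimately show ?thesis unfolding H1_ring_def by blast
qed

section \<open>Integrals of one variable\<close>

lemma integrable_mult_of_squares:
  fixes f g :: "'a \<Rightarrow> real"
  assumes [measurable]: "f \<in> borel_measurable M" "g \<in> borel_measurable M"
    and "integrable M (\<lambda>x. (f x)\<^sup>2)" "integrable M (\<lambda>x. (g x)\<^sup>2)"
  shows "integrable M (\<lambda>x. f x * g x)"
proof (rule Bochner_Integration.integrable_bound[OF Bochner_Integration.integrable_add[OF assms(3,4)]])
  have "\<bar>a * b\<bar> \<le> a\<^sup>2 + b\<^sup>2" for a b :: real
    using sum_squares_bound[of "\<bar>a\<bar>" "\<bar>b\<bar>"] mult_nonneg_nonneg[of "\<bar>a\<bar>" "\<bar>b\<bar>"]
    by (simp add: abs_mult del: mult_nonneg_nonneg)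
  then show "AE x in M. norm (f x * g x) \<le> norm ((f x)\<^sup>2 + (g x)\<^sup>2)" by simp
qed simp

text \<open>
  The quadratic polynomial in \<open>r\<close> given by the integral of \<open>(f - r g)\<^sup>2\<close> is nonnegative.
\<close>

lemma integral_Cauchy_Schwarz:
  fixes f g :: "'a \<Rightarrow> real"
  assumes "f \<in> borel_measurable M" "g \<in> borel_measurable M"
    and "integrable M (\<lambda>x. (f x)\<^sup>2)" "integrable M (\<lambda>x. (g x)\<^sup>2)"
  shows "(LINT x|M. f x * g x)\<^sup>2 \<le> (LINT x|M. (f x)\<^sup>2) * (LINT x|M. (g x)\<^sup>2)"
proof -
  let ?A = "LINT x|M. (f x)\<^sup>2" and ?B = "LINT x|M. f x * g x" and ?C = "LINT x|M. (g x)\<^sup>2"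
  have B: "integrable M (\<lambda>x. f x * g x)" by (rule integrable_mult_of_squares) fact+
  have q: "0 \<le> ?A - 2 * r * ?B + r\<^sup>2 * ?C" for r
  proof -
    have "0 \<le> (LINT x|M. (f x - r * g x)\<^sup>2)" by simp
    also have "(\<lambda>x. (f x - r * g x)\<^sup>2) = (\<lambda>x. (f x)\<^sup>2 - 2 * r * (f x * g x) + r\<^sup>2 * (g x)\<^sup>2)"
      by (simp add: power2_eq_square algebra_simps)
    also have "(LINT x|M. (f x)\<^sup>2 - 2 * r * (f x * g x) + r\<^sup>2 * (g x)\<^sup>2) = ?A - 2 * r * ?B + r\<^sup>2 * ?C"
      using assms(3,4) B by simp
    finally show ?thesis .
  qed
  have C: "?C \<ge> 0" by simp
  show ?thesis
  proof (cases "?C = 0")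
    case True
    have "?B = 0"
    proof (rule ccontr)
      assume "?B \<noteq> 0"
      \<comment> \<open>A nonconstant affine function of \<open>r\<close> cannot stay nonnegative.\<close>
      then show False using q[of "(?A + 1) / (2 * ?B)"] unfolding True by simp
    qed
    then show ?thesis using True by simp
  next
    case False
    then have "0 \<le> (?A - 2 * (?B / ?C) * ?B + (?B / ?C)\<^sup>2 * ?C) * ?C"
      using q[of "?B / ?C"] C by (intro mult_nonneg_nonneg)
    also have "\<dots> = ?A * ?C - ?B\<^sup>2"
      using False by (simp add: power2_eq_square field_simps)
    finally show ?thesis by simp
  qed
qed

lemma integrable_tensor:
  fixes f :: "'a::euclidean_space \<Rightarrow> real" and g :: "'b::euclidean_space \<Rightarrow> real"
  assumes f: "integrable lborel f" and g: "integrable lborel g"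
  shows "integrable (lborel \<Otimes>\<^sub>M lborel) (\<lambda>z. f (fst z) * g (snd z))"
proof (rule lborel_pair.Fubini_integrable)
  note [measurable] = borel_measurable_integrable[OF f] borel_measurable_integrable[OF g]
  show "(\<lambda>z. f (fst z) * g (snd z)) \<in> borel_measurable (lborel \<Otimes>\<^sub>M lborel)"
    by measurable
  show "integrable lborel (\<lambda>x. LINT y|lborel. norm (f (fst (x, y)) * g (snd (x, y))))"
    using f by (simp add: abs_mult)
  show "AE x in lborel. integrable lborel (\<lambda>y. f (fst (x, y)) * g (snd (x, y)))"
    using g by simp
qed

text \<open>
  For an integrand that vanishes for negative times, this is its integral from \<open>0\<close> to \<open>t\<close>. An
  unbounded lower limit keeps the later computations free of case distinctions.
\<close>

definition primitive :: "(real \<Rightarrow> real) \<Rightarrow> real \<Rightarrow> real" where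
  "primitive g t = (\<integral>s. (if s \<le> t then g s else 0) \<partial>lborel)"

lemma integrable_if_le:
  fixes g :: "real \<Rightarrow> real"
  assumes "integrable lborel g"
  shows "integrable lborel (\<lambda>s. if s \<le> t then g s else 0)" "integrable lborel (\<lambda>s. if t \<le> s then g s else 0)"
proof -
  have "integrable lborel (\<lambda>s. indicator {..t} s *\<^sub>R g s)" "integrable lborel (\<lambda>s. indicator {t..} s *\<^sub>R g s)"
    using assms by (intro integrable_mult_indicator; simp)+
  moreover have "(\<lambda>s. indicator {..t} s *\<^sub>R g s) = (\<lambda>s. if s \<le> t then g s else 0)"
    "(\<lambda>s. indicator {t..} s *\<^sub>R g s) = (\<lambda>s. if t \<le> s then g s else 0)"
    by auto
  ultimately show "integrable lborel (\<lambda>s. if s \<le> t then g s else 0)" "integrable lborel (\<lambda>s. if t \<le> s then g s else 0)"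
    by simp_all
qed

lemma primitive_Fubini:
  fixes f g :: "real \<Rightarrow> real"
  assumes f: "integrable lborel f" and g: "integrable lborel g"
  shows "(\<integral>t. primitive g t * f t \<partial>lborel) = (\<integral>s. g s * (\<integral>t. (if s \<le> t then f t else 0) \<partial>lborel) \<partial>lborel)"
proof -
  note [measurable] = borel_measurable_integrable[OF f] borel_measurable_integrable[OF g]
  let ?F = "\<lambda>s t. if s \<le> t then g s * f t else 0"
  have F: "integrable (lborel \<Otimes>\<^sub>M lborel) (case_prod ?F)"
  proof (rule Bochner_Integration.integrable_bound[OF integrable_tensor[OF g f]])
    show "case_prod ?F \<in> borel_measurable (lborel \<Otimes>\<^sub>M lborel)"
      by measurable
  qed auto
  have "(\<integral>t. primitive g t * f t \<partial>lborel) = (\<integral>t. (\<integral>s. ?F s t \<partial>lborel) \<partial>lborel)"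
    unfolding primitive_def
    by (intro Bochner_Integration.integral_cong refl)
      (simp add: integral_mult_left_zero[symmetric] if_distrib[of "\<lambda>x. x * _"] cong: if_cong)
  also have "\<dots> = (\<integral>s. (\<integral>t. ?F s t \<partial>lborel) \<partial>lborel)"
    by (rule lborel_pair.Fubini_integral[OF F])
  also have "\<dots> = (\<integral>s. g s * (\<integral>t. (if s \<le> t then f t else 0) \<partial>lborel) \<partial>lborel)"
    by (intro Bochner_Integration.integral_cong refl)
      (simp add: integral_mult_right_zero[symmetric] if_distrib[of "\<lambda>x. _ * x"] cong: if_cong)
  finally show ?thesis .
qed

text \<open>
  The integral of \<open>g s * g t\<close> over the plane is twice the integral over the half-plane \<open>s \<le> t\<close>: this is
  the fundamental theorem of calculus for the square of an absolutely continuous function, in a form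
  that needs Fubini's theorem only.
\<close>

lemma primitive_energy:
  fixes g :: "real \<Rightarrow> real"
  assumes g: "integrable lborel g"
  shows "(\<integral>s. g s \<partial>lborel)\<^sup>2 = 2 * (\<integral>t. g t * primitive g t \<partial>lborel)"
proof -
  note [measurable] = borel_measurable_integrable[OF g]
  let ?m = "\<integral>s. g s \<partial>lborel"
  let ?N = "\<lambda>s. \<integral>t. (if s \<le> t then g t else 0) \<partial>lborel"
  have split: "?N s = ?m - primitive g s" for s
  proof -
    have "?N s + primitive g s = (\<integral>t. (if s \<le> t then g t else 0) + (if t \<le> s then g t else 0) \<partial>lborel)"
      unfolding primitive_def using integrable_if_le[OF g] by (subst Bochner_Integration.integral_add) auto
    also have "\<dots> = ?m"
      using AE_lborel_singleton[of s] by (intro integral_cong_AE) (auto elim!: eventually_mono)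
    finally show ?thesis by simp
  qed
  have bd: "\<bar>primitive g t\<bar> \<le> (\<integral>s. \<bar>g s\<bar> \<partial>lborel)" for t
    unfolding primitive_def using g integrable_if_le[OF g]
    by (intro order_trans[OF integral_abs_bound] integral_mono) auto
  have m: "primitive g \<in> borel_measurable borel"
    unfolding primitive_def[abs_def] by measurable
  have i: "integrable lborel (\<lambda>t. g t * primitive g t)"
  proof (rule Bochner_Integration.integrable_bound)
    show "integrable lborel (\<lambda>t. (\<integral>s. \<bar>g s\<bar> \<partial>lborel) * g t)" using g by simp
    show "AE t in lborel. norm (g t * primitive g t) \<le> norm ((\<integral>s. \<bar>g s\<bar> \<partial>lborel) * g t)"
    proof (rule AE_I2)
      fix t
      have "\<bar>g t\<bar> * \<bar>primitive g t\<bar> \<le> \<bar>g t\<bar> * (\<integral>s. \<bar>g s\<bar> \<partial>lborel)"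
        by (rule mult_left_mono[OF bd abs_ge_zero])
      then show "norm (g t * primitive g t) \<le> norm ((\<integral>s. \<bar>g s\<bar> \<partial>lborel) * g t)"
        by (simp add: abs_mult mult.commute)
    qed
  qed (use m in measurable)
  have "(\<integral>t. g t * primitive g t \<partial>lborel) = (\<integral>s. g s * ?N s \<partial>lborel)"
    using primitive_Fubini[OF g g] by (simp add: mult.commute)
  also have "\<dots> = (\<integral>s. ?m * g s - g s * primitive g s \<partial>lborel)"
    unfolding split by (intro Bochner_Integration.integral_cong) (auto simp: algebra_simps)
  also have "\<dots> = ?m * ?m - (\<integral>t. g t * primitive g t \<partial>lborel)"
    using g i by (subst Bochner_Integration.integral_diff) auto
  finally show ?thesis by (simp add: power2_eq_square)
qed

text \<open>
  Exchange the integrations and apply the fundamental theorem of calculus to the smooth function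
  \<open>\<psi>\<close>, whose integral of the derivative over \<open>[s, \<infinity>)\<close> is \<open>- \<psi> s\<close>.
\<close>

lemma primitive_weak_derivative:
  fixes g \<psi> :: "real \<Rightarrow> real"
  assumes g: "integrable lborel g" and \<psi>: "\<psi> \<in> test_functions S"
  shows "(\<integral>t. primitive g t * frechet_derivative \<psi> (at t) 1 \<partial>lborel) = - (\<integral>s. g s * \<psi> s \<partial>lborel)"
proof -
  let ?D = "\<lambda>t. frechet_derivative \<psi> (at t) 1"
  obtain K where K: "smooth \<psi>" "compact K" "K \<subseteq> S" "\<And>x. x \<notin> K \<Longrightarrow> \<psi> x = 0"
    by (rule test_functionsE[OF \<psi>]) (rule that)
  have D0: "?D t = 0" if "t \<notin> K" for t
    using K(4) that by (intro frechet_derivative_0_outside[OF compact_imp_closed[OF K(2)]])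
  have cD: "continuous_on UNIV ?D"
    by (rule smooth_continuous[OF smooth_deriv[OF K(1)]])
  obtain B where B: "\<And>x. x \<in> K \<Longrightarrow> \<bar>x\<bar> \<le> B"
    using compact_imp_bounded[OF K(2)] by (auto simp: bounded_iff)
  have "integrable lborel (\<lambda>t. indicator K t *\<^sub>R ?D t)"
    by (intro borel_integrable_compact K(2) continuous_on_subset[OF cD]) auto
  also have "(\<lambda>t. indicator K t *\<^sub>R ?D t) = ?D"
    using D0 by (auto simp: indicator_def fun_eq_iff)
  finally have iD: "integrable lborel ?D" .
  have "(\<integral>t. (if s \<le> t then ?D t else 0) \<partial>lborel) = - \<psi> s" for s
  proof -
    \<comment> \<open>A point beyond the support of \<open>\<psi>\<close>.\<close>
    define b where "b = max s (B + 1)"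
    have b: "s \<le> b" "B < b" by (auto simp: b_def)
    have "b \<notin> K" using B[of b] b by auto
    have "(\<integral>t. ?D t * indicator {s..b} t \<partial>lborel) = \<psi> b - \<psi> s"
      using smooth_real_derivative[OF K(1)] cD b(1)
      by (intro integral_FTC_Icc_real) (auto simp: continuous_on_eq_continuous_at)
    moreover have "(if s \<le> t then ?D t else 0) = ?D t * indicator {s..b} t" for t
    proof (cases "t \<le> b")
      case False
      then have "t \<notin> K" using B[of t] b by auto
      then show ?thesis using D0 by (simp add: indicator_def)
    qed (simp add: indicator_def)
    ultimately show ?thesis using K(4)[OF \<open>b \<notin> K\<close>] by simp
  qed
  then show ?thesis using primitive_Fubini[OF iD g] by simp
qed

text \<open>
  The Cauchy-Schwarz inequality on the interval between \<open>s\<close> and \<open>t\<close>. It is the source of the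
  continuity in time.
\<close>

lemma primitive_diff_bound:
  fixes g :: "real \<Rightarrow> real"
  assumes [measurable]: "g \<in> borel_measurable borel" and g: "integrable lborel g" and g2: "integrable lborel (\<lambda>t. (g t)\<^sup>2)"
  shows "(primitive g t - primitive g s)\<^sup>2 \<le> \<bar>t - s\<bar> * (\<integral>t. (g t)\<^sup>2 \<partial>lborel)"
proof -
  have *: "(primitive g t - primitive g s)\<^sup>2 \<le> (t - s) * (\<integral>t. (g t)\<^sup>2 \<partial>lborel)" if st: "s \<le> t" for s t
  proof -
    have isq: "(\<lambda>r. (indicator {s<..t} r :: real)\<^sup>2) = indicator {s<..t}"
      by (auto simp: indicator_def)
    have "primitive g t - primitive g s = (\<integral>r. (if r \<le> t then g r else 0) - (if r \<le> s then g r else 0) \<partial>lborel)"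
      unfolding primitive_def using integrable_if_le[OF g] by (subst Bochner_Integration.integral_diff) auto
    also have "\<dots> = (\<integral>r. indicator {s<..t} r * g r \<partial>lborel)"
      using st by (intro Bochner_Integration.integral_cong) (auto simp: indicator_def)
    finally have "(primitive g t - primitive g s)\<^sup>2 = (\<integral>r. indicator {s<..t} r * g r \<partial>lborel)\<^sup>2" by simp
    also have "\<dots> \<le> (\<integral>r. (indicator {s<..t} r)\<^sup>2 \<partial>lborel) * (\<integral>t. (g t)\<^sup>2 \<partial>lborel)"
      using st by (intro integral_Cauchy_Schwarz g2) (auto simp: isq)
    also have "(\<integral>r. (indicator {s<..t} r :: real)\<^sup>2 \<partial>lborel) = t - s"
      using st by (simp add: isq)
    finally show ?thesis .
  qed
  show ?thesis
    using *[of s t] *[of t s] by (cases "s \<le> t") (auto simp: power2_commute)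
qed

text \<open>
  A test function in one variable is the derivative of a test function exactly if its integral
  vanishes; this is the nontrivial direction.
\<close>

lemma test_primitive:
  fixes \<theta> :: "real \<Rightarrow> real"
  assumes \<theta>: "smooth \<theta>" and ab: "0 < a" "a \<le> b" "b < T" and z: "\<And>t. t \<notin> {a..b} \<Longrightarrow> \<theta> t = 0"
    and int: "(\<integral>t. \<theta> t \<partial>lborel) = 0"
  obtains \<eta> where "\<eta> \<in> test_functions {0<..<T}" "\<And>t. (\<eta> has_real_derivative \<theta> t) (at t)"
proof -
  have c: "continuous_on A \<theta>" for A
    by (rule continuous_on_subset[OF smooth_continuous[OF \<theta>]]) simp
  define \<eta> where "\<eta> t = (LBINT s=ereal 0..ereal t. \<theta> s)" for t
  have D: "(\<eta> has_real_derivative \<theta> t) (at t)" for t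
  proof -
    let ?l = "min 0 t - 1" and ?r = "max 0 t + 1"
    have "(\<eta> has_vector_derivative \<theta> t) (at t within {?l..?r})"
      unfolding \<eta>_def[abs_def] by (rule interval_integral_FTC2) (auto intro: c)
    moreover have "at t within {?l..?r} = at t"
      by (rule at_within_Icc_at) auto
    ultimately show ?thesis by (simp add: has_real_derivative_iff_has_vector_derivative)
  qed
  have ftc: "(\<integral>s. \<theta> s * indicator {l..r} s \<partial>lborel) = \<eta> r - \<eta> l" if "l \<le> r" for l r
    using that D c[of UNIV] by (intro integral_FTC_Icc_real) (auto simp: continuous_on_eq_continuous_at)
  have "\<eta> 0 = 0" by (simp add: \<eta>_def)
  have z': "a \<le> t \<and> t \<le> b" if "\<theta> t \<noteq> 0" for t using z[of t] that by auto
  have "\<eta> t = 0" if "t \<notin> {a..b}" for t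
  proof -
    from that have "t < a \<or> t > b" by auto
    then consider "t < a" | "t > b" by blast
    then show ?thesis
    proof cases
      case 1
      have "(\<lambda>s. \<theta> s * indicator {min 0 t..max 0 t} s) = (\<lambda>s. 0)"
        using 1 ab z' by (fastforce simp: indicator_def fun_eq_iff)
      then have "\<eta> (max 0 t) = \<eta> (min 0 t)"
        using ftc[of "min 0 t" "max 0 t"] by simp
      then show ?thesis using \<open>\<eta> 0 = 0\<close> by (cases "t \<le> 0") (simp_all add: min_absorb2 max_absorb1 min_absorb1 max_absorb2)
    next
      case 2
      have "(\<lambda>s. \<theta> s * indicator {0..t} s) = \<theta>"
        using 2 ab z' by (fastforce simp: indicator_def fun_eq_iff)
      then have "\<eta> t = \<eta> 0"
        using ftc[of 0 t] 2 ab int by simp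
      then show ?thesis using \<open>\<eta> 0 = 0\<close> by simp
    qed
  qed
  moreover have "smooth \<eta>" by (rule smooth_realI[OF D \<theta>])
  ultimately have "\<eta> \<in> test_functions {0<..<T}"
    using ab by (intro test_functionsI[of _ "{a..b}"]) auto
  then show ?thesis using D by (rule that)
qed

text \<open>
  Needed to normalise a bump to integral \<open>1\<close>.
\<close>

lemma box_bump_integral_pos:
  fixes a b :: real
  assumes "a < b"
  shows "(\<integral>t. box_bump 1 a b t \<partial>lborel) > 0"
proof -
  have i: "integrable lborel (box_bump 1 a b)"
  proof -
    have "integrable lborel (\<lambda>t. indicator (cbox a b) t *\<^sub>R box_bump 1 a b t)"
      by (intro borel_integrable_compact compact_cbox continuous_on_subset[OF smooth_continuous[OF smooth_box_bump]]) auto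
    also have "(\<lambda>t. indicator (cbox a b) t *\<^sub>R box_bump 1 a b t) = box_bump 1 a b"
      using box_bump_eq_0[of _ a b 1] box_subset_cbox[of a b] by (fastforce simp: indicator_def fun_eq_iff)
    finally show ?thesis .
  qed
  have "(\<integral>t. box_bump 1 a b t \<partial>lborel) \<noteq> 0"
  proof
    assume "(\<integral>t. box_bump 1 a b t \<partial>lborel) = 0"
    then have "AE t in lborel. box_bump 1 a b t = 0"
      using integral_nonneg_eq_0_iff_AE[OF i] by (simp add: box_bump_nonneg)
    then have "AE t in lborel. t \<notin> box a b"
      by eventually_elim (use box_bump_pos[of _ a b 1] in force)
    then have "box a b \<in> null_sets lborel"
      by (subst AE_iff_null_sets) auto
    then have "emeasure lborel (box a b) = 0" by (rule null_setsD1)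
    then show False using assms by simp
  qed
  moreover have "(\<integral>t. box_bump 1 a b t \<partial>lborel) \<ge> 0"
    by (simp add: box_bump_nonneg)
  ultimately show ?thesis by simp
qed

section \<open>Functions with a weak time derivative\<close>

lemma test_integrable_lborel:
  assumes "\<phi> \<in> test_functions S"
  shows "integrable lborel \<phi>" "integrable lborel (\<lambda>x. (\<phi> x)\<^sup>2)"
proof -
  obtain K where K: "smooth \<phi>" "compact K" "K \<subseteq> S" "\<And>x. x \<notin> K \<Longrightarrow> \<phi> x = 0"
    by (rule test_functionsE[OF assms]) (rule that)
  have c: "continuous_on K \<phi>"
    by (rule continuous_on_subset[OF smooth_continuous[OF K(1)]]) simp
  have "integrable lborel (\<lambda>x. indicator K x *\<^sub>R \<phi> x)" "integrable lborel (\<lambda>x. indicator K x *\<^sub>R (\<phi> x)\<^sup>2)"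
    by (intro borel_integrable_compact K(2) c continuous_intros)+
  moreover have "(\<lambda>x. indicator K x *\<^sub>R \<phi> x) = \<phi>" "(\<lambda>x. indicator K x *\<^sub>R (\<phi> x)\<^sup>2) = (\<lambda>x. (\<phi> x)\<^sup>2)"
    using K(4) by (auto simp: indicator_def fun_eq_iff)
  ultimately show "integrable lborel \<phi>" "integrable lborel (\<lambda>x. (\<phi> x)\<^sup>2)" by simp_all
qed

text \<open>
  Fubini's theorem with the time integral inside: in the time direction, the argument works with one
  fixed point \<open>x\<close> of \<open>\<Omega>\<close> at a time.
\<close>

lemma
  fixes F :: "'a::euclidean_space \<times> 'b::euclidean_space \<Rightarrow> real"
  assumes F: "integrable lborel F"
  shows AE_integrable_lborel_snd: "AE y in lborel. integrable lborel (\<lambda>x. F (x, y))"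
    and integrable_lborel_snd: "integrable lborel (\<lambda>y. \<integral>x. F (x, y) \<partial>lborel)"
    and integral_lborel_snd: "(\<integral>y. (\<integral>x. F (x, y) \<partial>lborel) \<partial>lborel) = (\<integral>z. F z \<partial>lborel)"
proof -
  have "integrable (lborel \<Otimes>\<^sub>M lborel) (case_prod (\<lambda>x y. F (x, y)))"
    using F by (simp add: lborel_prod)
  note * = lborel_pair.AE_integrable_snd[OF this] lborel_pair.integrable_snd[OF this] lborel_pair.integral_snd[OF this]
  show "AE y in lborel. integrable lborel (\<lambda>x. F (x, y))"
    "integrable lborel (\<lambda>y. \<integral>x. F (x, y) \<partial>lborel)"
    "(\<integral>y. (\<integral>x. F (x, y) \<partial>lborel) \<partial>lborel) = (\<integral>z. F z \<partial>lborel)"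
    using * by (simp_all add: lborel_prod)
qed

lemma AE_lborel_snd:
  assumes "AE y in (lborel :: 'b::euclidean_space measure). P y"
  shows "AE z in (lborel :: ('a::euclidean_space \<times> 'b) measure). P (snd z)"
proof -
  obtain N where N: "\<And>y. y \<in> space lborel - N \<Longrightarrow> P y" "N \<in> null_sets (lborel :: 'b measure)"
    by (rule AE_E3[OF assms]) (rule that)
  have N': "N \<in> sets borel" using null_setsD2[OF N(2)] by simp
  have "AE z in (lborel :: 'a measure) \<Otimes>\<^sub>M (lborel :: 'b measure). snd z \<notin> N"
  proof (rule lborel_pair.AE_pair_measure)
    show "{z \<in> space (lborel \<Otimes>\<^sub>M lborel). snd z \<notin> N} \<in> sets ((lborel :: 'a measure) \<Otimes>\<^sub>M (lborel :: 'b measure))"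
      using N' by measurable
    show "AE x in (lborel :: 'a measure). AE y in lborel. snd (x, y) \<notin> N"
      using AE_not_in[OF N(2)] by simp
  qed
  then have "AE z in (lborel :: ('a \<times> 'b) measure). snd z \<notin> N"
    by (simp only: lborel_prod)
  then show ?thesis by eventually_elim (simp add: N(1))
qed

lemma integrable_if_square_integrable:
  fixes g :: "real \<Rightarrow> real"
  assumes "g \<in> borel_measurable borel" "integrable lborel (\<lambda>t. (g t)\<^sup>2)" "\<And>t. t \<notin> {0<..<T} \<Longrightarrow> g t = 0"
  shows "integrable lborel g"
proof -
  have isq: "(\<lambda>r. (indicator {0<..<T} r :: real)\<^sup>2) = indicator {0<..<T}"
    by (auto simp: indicator_def)
  have "integrable lborel (\<lambda>t. indicator {0<..<T} t * g t)"
  proof (rule integrable_mult_of_squares)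
    have "emeasure lborel {0<..<T} < \<infinity>" by (cases "0 \<le> T") auto
    then show "integrable lborel (\<lambda>r. (indicator {0<..<T} r :: real)\<^sup>2)"
      unfolding isq by simp
  qed (use assms(1,2) in auto)
  also have "(\<lambda>t. indicator {0<..<T} t * g t) = g"
    using assms(3) by (auto simp: indicator_def fun_eq_iff)
  finally show ?thesis .
qed

lemma test_zero_outside:
  fixes \<psi> :: "real \<Rightarrow> real"
  assumes "\<psi> \<in> test_functions S" "t \<notin> S"
  shows "\<psi> t = 0" "frechet_derivative \<psi> (at t) v = 0"
proof -
  obtain K where K: "smooth \<psi>" "compact K" "K \<subseteq> S" "\<And>x. x \<notin> K \<Longrightarrow> \<psi> x = 0"
    by (rule test_functionsE[OF assms(1)]) (rule that)
  have "t \<notin> K" using K(3) assms(2) by blast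
  then show "\<psi> t = 0" "frechet_derivative \<psi> (at t) v = 0"
    using K(4) frechet_derivative_0_outside[OF compact_imp_closed[OF K(2)]] by blast+
qed

text \<open>
  Borel functions on the whole space-time that vanish outside the cylinder, such that \<open>h\<close> is the weak
  time derivative of \<open>e\<close>. Testing with products suffices for everything below.
\<close>

locale weak_time_derivative =
  fixes \<Omega> :: "(real^'d) set" and T :: real and e h :: "real \<times> (real^'d) \<Rightarrow> real"
  assumes open_\<Omega>: "open \<Omega>" and T: "T > 0"
    and e_borel [measurable]: "e \<in> borel_measurable borel"
    and h_borel [measurable]: "h \<in> borel_measurable borel"
    and e_outside: "\<And>z. z \<notin> {0<..<T} \<times> \<Omega> \<Longrightarrow> e z = 0"
    and h_outside: "\<And>z. z \<notin> {0<..<T} \<times> \<Omega> \<Longrightarrow> h z = 0"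
    and e_sq: "integrable lborel (\<lambda>z. (e z)\<^sup>2)" and h_sq: "integrable lborel (\<lambda>z. (h z)\<^sup>2)"
    and weak: "\<And>\<psi> \<eta>. \<psi> \<in> test_functions {0<..<T} \<Longrightarrow> \<eta> \<in> test_functions \<Omega> \<Longrightarrow>
      (\<integral>z. e z * (frechet_derivative \<psi> (at (fst z)) 1 * \<eta> (snd z)) \<partial>lborel) =
      - (\<integral>z. h z * (\<psi> (fst z) * \<eta> (snd z)) \<partial>lborel)"
begin

text \<open>
  The primitive of \<open>h\<close> in time; it equals \<open>e\<close> up to a function of \<open>x\<close> alone, see
  \<open>AE_e_eq_c_plus_W\<close>.
\<close>

definition W :: "real \<times> (real^'d) \<Rightarrow> real" where
  "W z = primitive (\<lambda>s. h (s, snd z)) (fst z)"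

text \<open>
  The factor of \<open>\<bar>t - s\<bar>\<close> in the bound for the squared increments of \<open>W\<close> in time.
\<close>

definition H :: "real^'d \<Rightarrow> real" where
  "H x = (\<integral>s. (h (s, x))\<^sup>2 \<partial>lborel)"

lemma slice_borel [measurable]: "g \<in> borel_measurable borel \<Longrightarrow> (\<lambda>s. g (s, x)) \<in> borel_measurable borel"
  for g :: "real \<times> (real^'d) \<Rightarrow> real"
  by (rule measurable_compose[of "\<lambda>s. (s, x)" borel borel]) (auto simp flip: borel_prod)

lemma W_borel [measurable]: "W \<in> borel_measurable borel"
proof -
  have [measurable]: "h \<in> borel_measurable (borel \<Otimes>\<^sub>M borel)" by (simp add: borel_prod)
  show ?thesis
    unfolding W_def[abs_def] primitive_def borel_prod[symmetric] by measurable
qed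

lemma H_integrable: "integrable lborel H"
  unfolding H_def[abs_def] by (rule integrable_lborel_snd[OF h_sq])

lemma H_borel [measurable]: "H \<in> borel_measurable borel"
  using borel_measurable_integrable[OF H_integrable] by simp

lemma AE_h_slice: "AE x in lborel. integrable lborel (\<lambda>s. (h (s, x))\<^sup>2) \<and> integrable lborel (\<lambda>s. h (s, x))"
  using AE_integrable_lborel_snd[OF h_sq]
  by eventually_elim (auto intro: integrable_if_square_integrable[where T = T] slice_borel h_borel h_outside)

lemma W_eq_0: "t \<le> 0 \<Longrightarrow> W (t, x) = 0"
proof -
  assume t: "t \<le> 0"
  have "(\<lambda>s. if s \<le> t then h (s, x) else 0) = (\<lambda>s. 0)"
    using t h_outside by (auto simp: fun_eq_iff)
  then show ?thesis by (simp add: W_def primitive_def)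
qed

lemma W_outside: "x \<notin> \<Omega> \<Longrightarrow> W (t, x) = 0"
  using h_outside by (simp add: W_def primitive_def)

lemma AE_W_diff: "AE x in lborel. \<forall>t s. (W (t, x) - W (s, x))\<^sup>2 \<le> \<bar>t - s\<bar> * H x"
  using AE_h_slice unfolding W_def H_def
  by eventually_elim (use h_borel in \<open>auto intro!: primitive_diff_bound slice_borel\<close>)

lemma indicator_integrable: "integrable lborel (indicator {0<..<T} :: real \<Rightarrow> real)"
  using T by (subst integrable_indicator_iff) auto

text \<open>
  After time \<open>T\<close> the function \<open>W\<close> is constant in time, hence not square integrable over the whole
  space-time; so it is cut off.
\<close>

definition W1 :: "real \<times> (real^'d) \<Rightarrow> real" where
  "W1 z = indicator {0<..<T} (fst z) * W z"

lemma W1_borel [measurable]: "W1 \<in> borel_measurable borel"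
  unfolding W1_def[abs_def] borel_prod[symmetric]
  using W_borel[folded borel_prod] by measurable

lemma W1_sq: "integrable lborel (\<lambda>z. (W1 z)\<^sup>2)"
proof (rule Bochner_Integration.integrable_bound)
  have "integrable (lborel \<Otimes>\<^sub>M lborel) (\<lambda>z. (T * indicator {0<..<T} (fst z)) * H (snd z))"
    by (rule integrable_tensor[where f = "\<lambda>t. T * indicator {0<..<T} t"])
      (auto intro: H_integrable indicator_integrable)
  then show "integrable lborel (\<lambda>z::real \<times> (real^'d). (T * indicator {0<..<T} (fst z)) * H (snd z))"
    by (simp only: lborel_prod)
  show "AE z in lborel. norm ((W1 z)\<^sup>2) \<le> norm (T * indicator {0<..<T} (fst z) * H (snd z))"
    using AE_lborel_snd[OF AE_W_diff]
  proof eventually_elim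
    fix z :: "real \<times> (real^'d)" assume *: "\<forall>t s. (W (t, snd z) - W (s, snd z))\<^sup>2 \<le> \<bar>t - s\<bar> * H (snd z)"
    have H0: "H (snd z) \<ge> 0" by (simp add: H_def)
    show "norm ((W1 z)\<^sup>2) \<le> norm (T * indicator {0<..<T} (fst z) * H (snd z))"
    proof (cases "fst z \<in> {0<..<T}")
      case True
      have "(W z)\<^sup>2 \<le> \<bar>fst z\<bar> * H (snd z)"
        using *[rule_format, of "fst z" 0] by (simp add: W_eq_0)
      also have "\<dots> \<le> T * H (snd z)"
        using True H0 by (intro mult_right_mono) auto
      finally show ?thesis using True H0 T by (simp add: W1_def)
    qed (simp add: W1_def)
  qed
qed measurable

text \<open>
  This difference has vanishing weak time derivative in the cylinder.
\<close>

definition v :: "real \<times> (real^'d) \<Rightarrow> real" where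
  "v z = e z - W1 z"

lemma v_borel [measurable]: "v \<in> borel_measurable borel"
  unfolding v_def[abs_def] by measurable

lemma v_sq: "integrable lborel (\<lambda>z. (v z)\<^sup>2)"
proof (rule Bochner_Integration.integrable_bound)
  show "integrable lborel (\<lambda>z. 2 * (e z)\<^sup>2 + 2 * (W1 z)\<^sup>2)"
    by (intro Bochner_Integration.integrable_add integrable_mult_right e_sq W1_sq)
  show "AE z in lborel. norm ((v z)\<^sup>2) \<le> norm (2 * (e z)\<^sup>2 + 2 * (W1 z)\<^sup>2)"
    using norm_add_sq_le[of "e z" "- W1 z" for z] by (auto simp: v_def)
qed measurable

lemma v_outside: "z \<notin> {0<..<T} \<times> \<Omega> \<Longrightarrow> v z = 0"
  using e_outside[of z] W_outside[of "snd z" "fst z"] by (cases z) (auto simp: v_def W1_def)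

lemma tensor_sq:
  assumes "\<psi> \<in> test_functions {0<..<T}" "\<eta> \<in> test_functions \<Omega>"
  shows "(\<lambda>z. \<psi> (fst z) * \<eta> (snd z)) \<in> borel_measurable borel"
    "integrable lborel (\<lambda>z. (\<psi> (fst z) * \<eta> (snd z))\<^sup>2)"
  using test_integrable_lborel[OF test_tensor[OF assms]] smooth_borel[OF test_smooth[OF test_tensor[OF assms]]]
  by auto

lemma mult_tensor_integrable:
  assumes "g \<in> borel_measurable borel" "integrable lborel (\<lambda>z. (g z)\<^sup>2)"
    and "\<psi> \<in> test_functions {0<..<T}" "\<eta> \<in> test_functions \<Omega>"
  shows "integrable lborel (\<lambda>z. g z * (\<psi> (fst z) * \<eta> (snd z)))"
  by (rule integrable_mult_of_squares) (use assms tensor_sq[OF assms(3,4)] in simp_all)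

text \<open>
  For almost every \<open>x\<close>, integration by parts in time replaces \<open>W\<close> against the derivative of \<open>\<psi>\<close> by
  \<open>- h\<close> against \<open>\<psi>\<close>; the same replacement for \<open>e\<close> is the hypothesis on weak derivatives.
\<close>

lemma v_orthogonal_derivative:
  assumes \<psi>: "\<psi> \<in> test_functions {0<..<T}" and \<eta>: "\<eta> \<in> test_functions \<Omega>"
  shows "(\<integral>z. v z * (frechet_derivative \<psi> (at (fst z)) 1 * \<eta> (snd z)) \<partial>lborel) = 0"
proof -
  let ?D = "\<lambda>t. frechet_derivative \<psi> (at t) 1"
  have D: "?D \<in> test_functions {0<..<T}" by (rule test_deriv[OF \<psi>])
  have WD: "W1 (t, x) * (?D t * a) = primitive (\<lambda>s. h (s, x)) t * ?D t * a" for t x a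
    using test_zero_outside(2)[OF \<psi>, of t 1]
    by (cases "t \<in> {0<..<T}") (auto simp: W1_def W_def)
  have "(\<integral>z. W1 z * (?D (fst z) * \<eta> (snd z)) \<partial>lborel) =
      (\<integral>x. (\<integral>t. W1 (t, x) * (?D t * \<eta> x) \<partial>lborel) \<partial>lborel)"
    using integral_lborel_snd[OF mult_tensor_integrable[OF W1_borel W1_sq D \<eta>]] by simp
  also have "\<dots> = (\<integral>x. (\<integral>t. - (h (t, x) * (\<psi> t * \<eta> x)) \<partial>lborel) \<partial>lborel)"
  proof (rule integral_cong_AE)
    show "(\<lambda>x. \<integral>t. W1 (t, x) * (?D t * \<eta> x) \<partial>lborel) \<in> borel_measurable lborel"
      using integrable_lborel_snd[OF mult_tensor_integrable[OF W1_borel W1_sq D \<eta>]] by simp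
    show "(\<lambda>x. \<integral>t. - (h (t, x) * (\<psi> t * \<eta> x)) \<partial>lborel) \<in> borel_measurable lborel"
      using integrable_lborel_snd[OF mult_tensor_integrable[OF h_borel h_sq \<psi> \<eta>]] by simp
    show "AE x in lborel. (\<integral>t. W1 (t, x) * (?D t * \<eta> x) \<partial>lborel) = (\<integral>t. - (h (t, x) * (\<psi> t * \<eta> x)) \<partial>lborel)"
      using AE_h_slice
    proof eventually_elim
      fix x assume "integrable lborel (\<lambda>s. (h (s, x))\<^sup>2) \<and> integrable lborel (\<lambda>s. h (s, x))"
      then have "(\<integral>t. primitive (\<lambda>s. h (s, x)) t * ?D t \<partial>lborel) * \<eta> x = - (\<integral>s. h (s, x) * \<psi> s \<partial>lborel) * \<eta> x"
        using primitive_weak_derivative[OF _ \<psi>] by simp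
      then show "(\<integral>t. W1 (t, x) * (?D t * \<eta> x) \<partial>lborel) = (\<integral>t. - (h (t, x) * (\<psi> t * \<eta> x)) \<partial>lborel)"
        unfolding WD by (simp only: mult.assoc[symmetric] integral_mult_left_zero integral_minus mult_minus_left)
    qed
  qed
  also have "\<dots> = - (\<integral>z. h z * (\<psi> (fst z) * \<eta> (snd z)) \<partial>lborel)"
    using integral_lborel_snd[OF mult_tensor_integrable[OF h_borel h_sq \<psi> \<eta>]] by simp
  finally have W: "(\<integral>z. W1 z * (?D (fst z) * \<eta> (snd z)) \<partial>lborel) = - (\<integral>z. h z * (\<psi> (fst z) * \<eta> (snd z)) \<partial>lborel)" .
  have "(\<integral>z. v z * (?D (fst z) * \<eta> (snd z)) \<partial>lborel) =
      (\<integral>z. e z * (?D (fst z) * \<eta> (snd z)) \<partial>lborel) - (\<integral>z. W1 z * (?D (fst z) * \<eta> (snd z)) \<partial>lborel)"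
    unfolding v_def left_diff_distrib
    by (rule Bochner_Integration.integral_diff[OF mult_tensor_integrable[OF e_borel e_sq D \<eta>]
          mult_tensor_integrable[OF W1_borel W1_sq D \<eta>]])
  also have "\<dots> = 0" unfolding W weak[OF \<psi> \<eta>] by simp
  finally show ?thesis .
qed

text \<open>
  A fixed bump in time. The function \<open>c\<close> below is the time average of \<open>v\<close> with the normalised weight
  \<open>\<beta> / m\<close>. The weight must be a test function, so that \<open>\<beta>\<close> may be subtracted from other test functions.
\<close>

definition \<beta> :: "real \<Rightarrow> real" where
  "\<beta> = box_bump 1 (T / 3) (2 * T / 3)"

definition m where "m = (\<integral>t. \<beta> t \<partial>lborel)"

definition c :: "real^'d \<Rightarrow> real" where
  "c x = (\<integral>t. v (t, x) * \<beta> t \<partial>lborel) / m"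

lemma m_pos: "m > 0"
  unfolding m_def \<beta>_def using T by (intro box_bump_integral_pos) auto

lemma \<beta>_test: "\<beta> \<in> test_functions {0<..<T}"
  unfolding \<beta>_def using T by (intro box_bump_test) auto

lemma \<beta>_borel [measurable]: "\<beta> \<in> borel_measurable borel"
  by (rule smooth_borel[OF test_smooth[OF \<beta>_test]])

lemma c_borel [measurable]: "c \<in> borel_measurable borel"
  unfolding c_def[abs_def]
proof -
  have [measurable]: "v \<in> borel_measurable (borel \<Otimes>\<^sub>M borel)" by (simp add: borel_prod)
  show "(\<lambda>x. (\<integral>t. v (t, x) * \<beta> t \<partial>lborel) / m) \<in> borel_measurable borel" by measurable
qed

lemma c_outside: "x \<notin> \<Omega> \<Longrightarrow> c x = 0"
  by (simp add: c_def v_outside)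

lemma c_sq: "integrable lborel (\<lambda>x. (c x)\<^sup>2)"
proof (rule Bochner_Integration.integrable_bound)
  let ?V = "\<lambda>x. \<integral>t. (v (t, x))\<^sup>2 \<partial>lborel" and ?b = "\<integral>t. (\<beta> t)\<^sup>2 \<partial>lborel"
  show "integrable lborel (\<lambda>x. ?V x * (?b / m\<^sup>2))"
    by (intro integrable_mult_left integrable_lborel_snd[OF v_sq])
  show "AE x in lborel. norm ((c x)\<^sup>2) \<le> norm (?V x * (?b / m\<^sup>2))"
    using AE_integrable_lborel_snd[OF v_sq]
  proof eventually_elim
    fix x assume x: "integrable lborel (\<lambda>t. (v (t, x))\<^sup>2)"
    have "(\<integral>t. v (t, x) * \<beta> t \<partial>lborel)\<^sup>2 \<le> ?V x * ?b"
      by (rule integral_Cauchy_Schwarz) (use x test_integrable_lborel[OF \<beta>_test] slice_borel[OF v_borel] in auto)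
    then have "(c x)\<^sup>2 \<le> ?V x * (?b / m\<^sup>2)"
      unfolding c_def power_divide using m_pos by (simp add: divide_right_mono)
    then show "norm ((c x)\<^sup>2) \<le> norm (?V x * (?b / m\<^sup>2))" by simp
  qed
qed measurable

text \<open>
  The function \<open>c\<close> as a function on the cylinder, cut off in time for the same reason as \<open>W\<close>.
\<close>

definition c1 :: "real \<times> (real^'d) \<Rightarrow> real" where
  "c1 z = indicator {0<..<T} (fst z) * c (snd z)"

lemma c1_borel [measurable]: "c1 \<in> borel_measurable borel"
  unfolding c1_def[abs_def] borel_prod[symmetric] by measurable

lemma c1_sq: "integrable lborel (\<lambda>z. (c1 z)\<^sup>2)"
proof -
  have "integrable (lborel \<Otimes>\<^sub>M lborel) (\<lambda>z. indicator {0<..<T} (fst z) * (c (snd z))\<^sup>2)"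
    by (rule integrable_tensor[OF indicator_integrable c_sq])
  moreover have "(\<lambda>z. (c1 z)\<^sup>2) = (\<lambda>z. indicator {0<..<T} (fst z) * (c (snd z))\<^sup>2)"
    by (auto simp: c1_def indicator_def fun_eq_iff)
  ultimately show ?thesis by (simp add: lborel_prod)
qed

text \<open>
  Subtracting the right multiple of \<open>\<beta>\<close> from a bump in time gives a function \<open>?\<theta>\<close> with integral \<open>0\<close>,
  hence the derivative of a test function, to which \<open>v\<close> is orthogonal. The subtracted part is the pairing
  of \<open>c1\<close> with the bump, because \<open>c\<close> is the average of \<open>v\<close> with weight \<open>\<beta>\<close>.
\<close>

lemma v_eq_c_orthogonal:
  assumes ab: "0 < a" "a \<le> b" "b < T" and \<eta>: "\<eta> \<in> test_functions \<Omega>"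
  shows "(\<integral>z. (v z - c1 z) * (box_bump n a b (fst z) * \<eta> (snd z)) \<partial>lborel) = 0"
proof -
  let ?\<psi> = "box_bump n a b"
  have \<psi>: "?\<psi> \<in> test_functions {0<..<T}" using ab by (intro box_bump_test) auto
  let ?r = "(\<integral>t. ?\<psi> t \<partial>lborel) / m"
  let ?\<theta> = "\<lambda>t. ?\<psi> t - ?r * \<beta> t"
  have int0: "(\<integral>t. ?\<theta> t \<partial>lborel) = 0"
    using test_integrable_lborel(1)[OF \<psi>] test_integrable_lborel(1)[OF \<beta>_test] m_pos
    by (simp add: m_def[symmetric])
  have sm: "smooth ?\<theta>"
    by (intro smooth_diff smooth_mult smooth_const test_smooth[OF \<psi>] test_smooth[OF \<beta>_test])
  have supp: "?\<theta> t = 0" if "t \<notin> {min a (T / 3)..max b (2 * T / 3)}" for t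
  proof -
    have t: "t \<notin> box a b" "t \<notin> box (T / 3) (2 * T / 3)" using that by auto
    show ?thesis by (simp add: \<beta>_def box_bump_eq_0[OF t(1)] box_bump_eq_0[OF t(2)] del: One_nat_def)
  qed
  have bds: "0 < min a (T / 3)" "min a (T / 3) \<le> max b (2 * T / 3)" "max b (2 * T / 3) < T"
    using ab T by auto
  obtain \<kappa> where \<kappa>: "\<kappa> \<in> test_functions {0<..<T}" "\<And>t. (\<kappa> has_real_derivative ?\<theta> t) (at t)"
    by (rule test_primitive[OF sm bds supp int0]) (assumption, rule that)
  have "frechet_derivative \<kappa> (at t) 1 = ?\<theta> t" for t
    using frechet_derivative_real[OF \<kappa>(2)] by simp
  then have orth: "(\<integral>z. v z * (?\<theta> (fst z) * \<eta> (snd z)) \<partial>lborel) = 0"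
    using v_orthogonal_derivative[OF \<kappa>(1) \<eta>] by simp
  note Iv = mult_tensor_integrable[OF v_borel v_sq \<psi> \<eta>] mult_tensor_integrable[OF v_borel v_sq \<beta>_test \<eta>]
    and Ic = mult_tensor_integrable[OF c1_borel c1_sq \<psi> \<eta>]
  have c1eq: "c1 (t, x) * (?\<psi> t * \<eta> x) = c x * \<eta> x * ?\<psi> t" for t x
    using test_zero_outside(1)[OF \<psi>, of t] by (cases "t \<in> {0<..<T}") (auto simp: c1_def)
  have "(\<integral>z. c1 z * (?\<psi> (fst z) * \<eta> (snd z)) \<partial>lborel) = (\<integral>x. c x * \<eta> x * (\<integral>t. ?\<psi> t \<partial>lborel) \<partial>lborel)"
    using integral_lborel_snd[OF Ic] unfolding fst_conv snd_conv c1eq integral_mult_right_zero by simp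
  also have "\<dots> = (\<integral>x. ?r * (\<integral>t. v (t, x) * (\<beta> t * \<eta> x) \<partial>lborel) \<partial>lborel)"
    by (intro Bochner_Integration.integral_cong refl)
      (simp add: c_def mult.assoc[symmetric] integral_mult_left_zero)
  also have "\<dots> = ?r * (\<integral>z. v z * (\<beta> (fst z) * \<eta> (snd z)) \<partial>lborel)"
    using integral_lborel_snd[OF Iv(2)] by simp
  finally have C: "(\<integral>z. c1 z * (?\<psi> (fst z) * \<eta> (snd z)) \<partial>lborel) = ?r * (\<integral>z. v z * (\<beta> (fst z) * \<eta> (snd z)) \<partial>lborel)" .
  have "(\<integral>z. v z * (?\<theta> (fst z) * \<eta> (snd z)) \<partial>lborel) =
      (\<integral>z. v z * (?\<psi> (fst z) * \<eta> (snd z)) - ?r * (v z * (\<beta> (fst z) * \<eta> (snd z))) \<partial>lborel)"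
    by (intro Bochner_Integration.integral_cong refl) (simp add: algebra_simps)
  also have "\<dots> = (\<integral>z. v z * (?\<psi> (fst z) * \<eta> (snd z)) \<partial>lborel) - (\<integral>z. c1 z * (?\<psi> (fst z) * \<eta> (snd z)) \<partial>lborel)"
    unfolding C using Iv by (subst Bochner_Integration.integral_diff) auto
  also have "\<dots> = (\<integral>z. (v z - c1 z) * (?\<psi> (fst z) * \<eta> (snd z)) \<partial>lborel)"
    unfolding left_diff_distrib by (rule Bochner_Integration.integral_diff[OF Iv(1) Ic, symmetric])
  finally show ?thesis using orth by simp
qed

lemma AE_e_eq_c_plus_W: "AE z in lborel. z \<in> {0<..<T} \<times> \<Omega> \<longrightarrow> e z = c (snd z) + W z"
proof -
  have "AE z in lborel. z \<in> {0<..<T} \<times> \<Omega> \<longrightarrow> v z - c1 z = 0"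
  proof (rule AE_0_if_box_bump_integrals_0)
    show "open ({0<..<T} \<times> \<Omega>)" by (intro open_Times open_\<Omega>) auto
    show "(\<lambda>z. v z - c1 z) \<in> borel_measurable borel" by measurable
    fix A B :: "real \<times> (real^'d)" and n assume AB: "cbox A B \<subseteq> {0<..<T} \<times> \<Omega>"
    have sq: "integrable lborel (\<lambda>z. (v z - c1 z)\<^sup>2)"
    proof (rule Bochner_Integration.integrable_bound)
      show "integrable lborel (\<lambda>z. 2 * (v z)\<^sup>2 + 2 * (c1 z)\<^sup>2)"
        by (intro Bochner_Integration.integrable_add integrable_mult_right v_sq c1_sq)
      show "AE z in lborel. norm ((v z - c1 z)\<^sup>2) \<le> norm (2 * (v z)\<^sup>2 + 2 * (c1 z)\<^sup>2)"
        using norm_add_sq_le[of "v z" "- c1 z" for z] by auto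
    qed measurable
    have isq: "(\<lambda>z. (indicator (cbox A B) z :: real)\<^sup>2) = indicator (cbox A B)"
      by (auto simp: indicator_def)
    show "integrable lborel (\<lambda>z. indicator (cbox A B) z * (v z - c1 z))"
    proof (rule integrable_mult_of_squares[OF _ _ _ sq])
      show "integrable lborel (\<lambda>z. (indicator (cbox A B) z :: real)\<^sup>2)"
        unfolding isq using emeasure_lborel_cbox_finite[of A B] by auto
    qed measurable
    obtain a0 a b0 b where ab: "A = (a0, a)" "B = (b0, b)" by (cases A; cases B)
    show "(\<integral>z. (v z - c1 z) * box_bump n A B z \<partial>lborel) = 0"
    proof (cases "cbox A B = {}")
      case True
      then have "box A B = {}" using box_subset_cbox[of A B] by blast
      then show ?thesis by (simp add: box_bump_eq_0)
    next
      case False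
      have p: "cbox A B = cbox a0 b0 \<times> cbox a b" unfolding ab by (simp add: cbox_prod)
      have ne: "cbox a0 b0 \<noteq> {}" "cbox a b \<noteq> {}" using False unfolding p by auto
      have sub: "cbox a0 b0 \<subseteq> {0<..<T}" "cbox a b \<subseteq> \<Omega>"
        using AB ne unfolding p by (auto simp: subset_iff)
      have "0 < a0" "a0 \<le> b0" "b0 < T" using sub(1) ne(1) by auto
      from v_eq_c_orthogonal[OF this box_bump_test[OF sub(2)], of n n] show ?thesis
        unfolding ab by (simp add: box_bump_Pair[symmetric])
    qed
  qed
  then show ?thesis
    by eventually_elim (auto simp: v_def c1_def W1_def)
qed

end

section \<open>Values at a fixed time\<close>

lemma L2_norm_nonneg: "L2_norm S f \<ge> 0" for f :: "'a::euclidean_space \<Rightarrow> 'b::euclidean_space"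
  by (simp add: L2_norm_def)

context weak_time_derivative
begin

text \<open>
  The representative of \<open>e\<close> that is continuous in time, defined for all times.
\<close>

definition w :: "real \<Rightarrow> real^'d \<Rightarrow> real" where
  "w t x = c x + W (t, x)"

lemma w_borel [measurable]: "w t \<in> borel_measurable borel"
proof -
  have "(\<lambda>x. W (t, x)) \<in> borel_measurable borel"
    by (rule measurable_compose[OF _ W_borel]) (simp flip: borel_prod)
  then show ?thesis unfolding w_def[abs_def] by measurable
qed

lemma w_outside: "x \<notin> \<Omega> \<Longrightarrow> w t x = 0"
  by (simp add: w_def c_outside W_outside)

lemma w_0: "w 0 x = c x"
  by (simp add: w_def W_eq_0)

lemma w_diff_sq:
  shows "integrable lborel (\<lambda>x. (w t x - w s x)\<^sup>2)"
    "(\<integral>x. (w t x - w s x)\<^sup>2 \<partial>lborel) \<le> \<bar>t - s\<bar> * (\<integral>x. H x \<partial>lborel)"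
proof -
  have b: "AE x in lborel. (w t x - w s x)\<^sup>2 \<le> \<bar>t - s\<bar> * H x"
    using AE_W_diff by eventually_elim (simp add: w_def)
  have i: "integrable lborel (\<lambda>x. \<bar>t - s\<bar> * H x)"
    using H_integrable by simp
  show 1: "integrable lborel (\<lambda>x. (w t x - w s x)\<^sup>2)"
    by (rule Bochner_Integration.integrable_bound[OF i]) (use b in \<open>auto elim!: eventually_mono\<close>)
  have "(\<integral>x. (w t x - w s x)\<^sup>2 \<partial>lborel) \<le> (\<integral>x. \<bar>t - s\<bar> * H x \<partial>lborel)"
    by (rule integral_mono_AE[OF 1 i b])
  then show "(\<integral>x. (w t x - w s x)\<^sup>2 \<partial>lborel) \<le> \<bar>t - s\<bar> * (\<integral>x. H x \<partial>lborel)"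
    by simp
qed

lemma w_sq: "integrable lborel (\<lambda>x. (w t x)\<^sup>2)"
proof (rule Bochner_Integration.integrable_bound)
  show "integrable lborel (\<lambda>x. 2 * (w t x - w 0 x)\<^sup>2 + 2 * (c x)\<^sup>2)"
    by (intro Bochner_Integration.integrable_add integrable_mult_right w_diff_sq(1) c_sq)
  show "AE x in lborel. norm ((w t x)\<^sup>2) \<le> norm (2 * (w t x - w 0 x)\<^sup>2 + 2 * (c x)\<^sup>2)"
    using norm_add_sq_le[of "w t x - w 0 x" "c x" for x] by (auto simp: w_0)
qed measurable

lemma W_T: "W (T, x) = (\<integral>s. h (s, x) \<partial>lborel)"
  unfolding W_def primitive_def
  using h_outside by (auto intro!: Bochner_Integration.integral_cong)

text \<open>
  For fixed \<open>x\<close> the increment of the square of \<open>c + W\<close> is \<open>2 c W + W\<^sup>2\<close> at time \<open>T\<close>, and both terms are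
  integrals against \<open>h\<close>; the second one by \<open>primitive_energy\<close>.
\<close>

lemma energy: "(\<integral>x. (w T x)\<^sup>2 \<partial>lborel) - (\<integral>x. (w 0 x)\<^sup>2 \<partial>lborel) = 2 * (\<integral>z. e z * h z \<partial>lborel)"
proof -
  let ?g = "\<lambda>z. (c1 z + W1 z) * h z"
  have I1: "integrable lborel (\<lambda>z. c1 z * h z)" and I2: "integrable lborel (\<lambda>z. W1 z * h z)"
    by (intro integrable_mult_of_squares c1_sq W1_sq h_sq; measurable)+
  have I: "integrable lborel ?g"
    unfolding distrib_right by (intro Bochner_Integration.integrable_add I1 I2)
  have "(\<integral>z. e z * h z \<partial>lborel) = (\<integral>z. ?g z \<partial>lborel)"
  proof (rule integral_cong_AE)
    show "AE z in lborel. e z * h z = ?g z"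
      using AE_e_eq_c_plus_W
    proof eventually_elim
      fix z assume "z \<in> {0<..<T} \<times> \<Omega> \<longrightarrow> e z = c (snd z) + W z"
      then show "e z * h z = ?g z"
        using h_outside[of z] by (cases "z \<in> {0<..<T} \<times> \<Omega>") (auto simp: c1_def W1_def)
    qed
  qed measurable
  also have "\<dots> = (\<integral>x. (\<integral>t. ?g (t, x) \<partial>lborel) \<partial>lborel)"
    by (rule integral_lborel_snd[OF I, symmetric])
  finally have "2 * (\<integral>z. e z * h z \<partial>lborel) = (\<integral>x. 2 * (\<integral>t. ?g (t, x) \<partial>lborel) \<partial>lborel)"
    by simp
  also have "\<dots> = (\<integral>x. (w T x)\<^sup>2 - (w 0 x)\<^sup>2 \<partial>lborel)"
  proof (rule integral_cong_AE)
    show "(\<lambda>x. 2 * (\<integral>t. ?g (t, x) \<partial>lborel)) \<in> borel_measurable lborel"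
      using integrable_lborel_snd[OF I] by (intro borel_measurable_times borel_measurable_integrable) auto
    show "AE x in lborel. 2 * (\<integral>t. ?g (t, x) \<partial>lborel) = (w T x)\<^sup>2 - (w 0 x)\<^sup>2"
      using AE_h_slice AE_integrable_lborel_snd[OF I1] AE_integrable_lborel_snd[OF I2]
    proof eventually_elim
      fix x assume x: "integrable lborel (\<lambda>s. (h (s, x))\<^sup>2) \<and> integrable lborel (\<lambda>s. h (s, x))"
        and i: "integrable lborel (\<lambda>t. c1 (t, x) * h (t, x))" "integrable lborel (\<lambda>t. W1 (t, x) * h (t, x))"
      have c: "c1 (t, x) * h (t, x) = c x * h (t, x)" for t
        using h_outside[of "(t, x)"] by (cases "t \<in> {0<..<T}") (auto simp: c1_def)
      have W: "W1 (t, x) * h (t, x) = h (t, x) * primitive (\<lambda>s. h (s, x)) t" for t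
        using h_outside[of "(t, x)"] by (cases "t \<in> {0<..<T}") (auto simp: W1_def W_def)
      have "2 * (\<integral>t. ?g (t, x) \<partial>lborel) = 2 * (\<integral>t. c1 (t, x) * h (t, x) \<partial>lborel) + 2 * (\<integral>t. W1 (t, x) * h (t, x) \<partial>lborel)"
        unfolding distrib_right by (subst Bochner_Integration.integral_add[OF i]) simp
      also have "\<dots> = 2 * (c x * W (T, x)) + (W (T, x))\<^sup>2"
        unfolding c W W_T using primitive_energy[of "\<lambda>s. h (s, x)"] x by simp
      also have "\<dots> = (w T x)\<^sup>2 - (w 0 x)\<^sup>2"
        unfolding w_0 by (simp add: w_def power2_sum)
      finally show "2 * (\<integral>t. ?g (t, x) \<partial>lborel) = (w T x)\<^sup>2 - (w 0 x)\<^sup>2" .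
    qed
  qed measurable
  also have "\<dots> = (\<integral>x. (w T x)\<^sup>2 \<partial>lborel) - (\<integral>x. (w 0 x)\<^sup>2 \<partial>lborel)"
    by (rule Bochner_Integration.integral_diff[OF w_sq w_sq])
  finally show ?thesis by simp
qed

lemma L2_norm_eq_lborel:
  assumes "g \<in> borel_measurable borel" "\<And>x. x \<notin> \<Omega> \<Longrightarrow> g x = (0::real)"
  shows "(L2_norm \<Omega> g)\<^sup>2 = (\<integral>x. (g x)\<^sup>2 \<partial>lborel)"
  unfolding L2_norm_sq real_norm_def power2_abs
  using assms by (intro integral_lebesgue_on_eq_lborel open_\<Omega>) auto

lemma w_continuous_rep:
  assumes "AE z in lebesgue_on ({0<..<T} \<times> \<Omega>). e0 z = e z"
  shows "continuous_rep T \<Omega> e0 w"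
  unfolding continuous_rep_def
proof (intro conjI ballI)
  fix t assume "t \<in> {0..T}"
  show "w t \<in> L2 \<Omega>"
    using w_sq[of t] integrable_lebesgue_on_iff_lborel[OF open_\<Omega>, of "\<lambda>x. (w t x)\<^sup>2"] w_outside
    by (auto simp: L2_def intro: borel_measurable_lebesgue_on)
  have le: "L2_norm \<Omega> (\<lambda>x. w s x - w t x) \<le> sqrt (\<bar>s - t\<bar> * (\<integral>x. H x \<partial>lborel))" for s
    using w_diff_sq(2)[of s t] L2_norm_eq_lborel[of "\<lambda>x. w s x - w t x"] w_outside
    by (intro real_le_rsqrt) auto
  have "((\<lambda>s. sqrt (\<bar>s - t\<bar> * (\<integral>x. H x \<partial>lborel))) \<longlongrightarrow> sqrt (\<bar>t - t\<bar> * (\<integral>x. H x \<partial>lborel))) (at t within {0..T})"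
    by (intro tendsto_intros)
  then have lim: "((\<lambda>s. sqrt (\<bar>s - t\<bar> * (\<integral>x. H x \<partial>lborel))) \<longlongrightarrow> 0) (at t within {0..T})"
    by simp
  show "((\<lambda>s. L2_norm \<Omega> (\<lambda>x. w s x - w t x)) \<longlongrightarrow> 0) (at t within {0..T})"
    by (rule tendsto_sandwich[OF _ _ tendsto_const lim]) (simp_all add: le L2_norm_nonneg)
next
  have "open ({0<..<T} \<times> \<Omega>)" by (intro open_Times open_\<Omega>) auto
  then have "AE z in lebesgue_on ({0<..<T} \<times> \<Omega>). e z = c (snd z) + W z"
    using AE_e_eq_c_plus_W by (simp add: AE_lebesgue_on_iff)
  with assms have "AE z in lebesgue_on ({0<..<T} \<times> \<Omega>). e0 z = w (fst z) (snd z)"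
    by eventually_elim (simp add: w_def)
  from AE_lebesgue_on_slices[OF _ open_\<Omega> this]
  show "AE t in lebesgue_on {0<..<T}. AE x in lebesgue_on \<Omega>. e0 (t, x) = w t x" by simp
qed

end

text \<open>
  Existence of the representative that is continuous in time, together with integration by parts in
  time for the pair \<open>e\<close>, \<open>e\<close>. Both hold for Borel representatives by the construction above.
\<close>

lemma continuous_rep_exists:
  fixes \<Omega> :: "(real^'d) set"
  assumes \<Omega>: "open \<Omega>" and T: "T > 0" and e: "e \<in> L2 ({0<..<T} \<times> \<Omega>)"
    and d: "has_weak_deriv ({0<..<T} \<times> \<Omega>) (1, 0) e h"
  obtains w where "continuous_rep T \<Omega> e w"
    "(L2_norm \<Omega> (w T))\<^sup>2 - (L2_norm \<Omega> (w 0))\<^sup>2 = 2 * (LINT z|lebesgue_on ({0<..<T} \<times> \<Omega>). e z * h z)"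
proof -
  let ?X = "{0<..<T} \<times> \<Omega>"
  have X: "open ?X" using \<Omega> by (intro open_Times) auto
  have h: "h \<in> L2 ?X" using d by (simp add: has_weak_deriv_def)
  obtain e' where e': "e' \<in> borel_measurable borel" "\<And>x. x \<notin> ?X \<Longrightarrow> e' x = 0"
    "AE x in lborel. x \<in> ?X \<longrightarrow> e x = e' x"
    by (rule borel_representative[OF X L2_measurable[OF e]]) (rule that)
  obtain h' where h': "h' \<in> borel_measurable borel" "\<And>x. x \<notin> ?X \<Longrightarrow> h' x = 0"
    "AE x in lborel. x \<in> ?X \<longrightarrow> h x = h' x"
    by (rule borel_representative[OF X L2_measurable[OF h]]) (rule that)
  have ae: "AE z in lebesgue_on ?X. e z = e' z" "AE z in lebesgue_on ?X. h z = h' z"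
    using e'(3) h'(3) X by (simp_all add: AE_lebesgue_on_iff)
  note [measurable] = L2_measurable[OF e] L2_measurable[OF h] borel_measurable_lebesgue_on[OF e'(1)]
    borel_measurable_lebesgue_on[OF h'(1)] e'(1) h'(1)
  have sq: "integrable lborel (\<lambda>z. (g' z)\<^sup>2)"
    if "g \<in> L2 ?X" "g' \<in> borel_measurable borel" "\<And>x. x \<notin> ?X \<Longrightarrow> g' x = 0" "AE z in lebesgue_on ?X. g z = g' z"
    for g g' :: "real \<times> (real^'d) \<Rightarrow> real"
  proof -
    have "integrable (lebesgue_on ?X) (\<lambda>z. (g' z)\<^sup>2)"
    proof (rule integrable_cong_AE_imp[OF L2_integrable[OF that(1)]])
      show "(\<lambda>z. (g' z)\<^sup>2) \<in> borel_measurable (lebesgue_on ?X)"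
        using borel_measurable_lebesgue_on[OF that(2)] by measurable
      show "AE z in lebesgue_on ?X. (norm (g z))\<^sup>2 = (g' z)\<^sup>2"
        using that(4) by eventually_elim simp
    qed
    then show ?thesis
      using that(2,3) by (subst (asm) integrable_lebesgue_on_iff_lborel[OF X]) auto
  qed
  have tr: "(\<integral>z. g' z * \<phi> z \<partial>lborel) = (LINT z|lebesgue_on ?X. g z * \<phi> z)"
    if "g \<in> L2 ?X" "g' \<in> borel_measurable borel" "\<And>x. x \<notin> ?X \<Longrightarrow> g' x = 0" "AE z in lebesgue_on ?X. g z = g' z"
      "\<phi> \<in> borel_measurable borel"
    for g g' \<phi> :: "real \<times> (real^'d) \<Rightarrow> real"
  proof -
    note [measurable] = that(2,5) borel_measurable_lebesgue_on[OF that(2)] borel_measurable_lebesgue_on[OF that(5)]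
      L2_measurable[OF that(1)]
    have "(\<integral>z. g' z * \<phi> z \<partial>lborel) = (LINT z|lebesgue_on ?X. g' z * \<phi> z)"
      using that(3) by (intro integral_lebesgue_on_eq_lborel[symmetric] X) auto
    also have "\<dots> = (LINT z|lebesgue_on ?X. g z * \<phi> z)"
      by (rule integral_cong_AE) (use that(4) in \<open>auto elim: eventually_mono\<close>)
    finally show ?thesis .
  qed
  interpret weak_time_derivative \<Omega> T e' h'
  proof
    fix \<psi> \<eta> assume \<psi>: "\<psi> \<in> test_functions {0<..<T}" and \<eta>: "\<eta> \<in> test_functions \<Omega>"
    have t: "(\<lambda>z. \<psi> (fst z) * \<eta> (snd z)) \<in> test_functions ?X" by (rule test_tensor[OF \<psi> \<eta>])
    have t': "(\<lambda>z. frechet_derivative \<psi> (at (fst z)) 1 * \<eta> (snd z)) \<in> test_functions ?X"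
      by (rule test_tensor[OF test_deriv[OF \<psi>] \<eta>])
    have "frechet_derivative \<eta> (at x) 0 = 0" for x
      by (rule linear_0[OF has_derivative_linear[OF smooth_has_derivative[OF test_smooth[OF \<eta>]]]])
    then have D: "frechet_derivative (\<lambda>z. \<psi> (fst z) * \<eta> (snd z)) (at z) (1, 0) =
        frechet_derivative \<psi> (at (fst z)) 1 * \<eta> (snd z)" for z
      by (simp add: frechet_derivative_tensor[OF test_smooth[OF \<psi>] test_smooth[OF \<eta>]])
    have "(LINT z|lebesgue_on ?X. e z * frechet_derivative (\<lambda>z. \<psi> (fst z) * \<eta> (snd z)) (at z) (1, 0)) =
        - (LINT z|lebesgue_on ?X. h z * (\<psi> (fst z) * \<eta> (snd z)))"
      using d t unfolding has_weak_deriv_def by blast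
    then show "(\<integral>z. e' z * (frechet_derivative \<psi> (at (fst z)) 1 * \<eta> (snd z)) \<partial>lborel) =
      - (\<integral>z. h' z * (\<psi> (fst z) * \<eta> (snd z)) \<partial>lborel)"
      using tr[OF e e'(1,2) ae(1) smooth_borel[OF test_smooth[OF t']]]
        tr[OF h h'(1,2) ae(2) smooth_borel[OF test_smooth[OF t]]] by (simp add: D)
  qed (use \<Omega> T e' h' sq[OF e e'(1,2) ae(1)] sq[OF h h'(1,2) ae(2)] in auto)
  have "(LINT z|lebesgue_on ?X. e z * h z) = (LINT z|lebesgue_on ?X. e' z * h' z)"
    by (rule integral_cong_AE) (use ae in \<open>auto elim: eventually_elim2\<close>)
  also have "\<dots> = (\<integral>z. e' z * h' z \<partial>lborel)"
    using e'(2) by (intro integral_lebesgue_on_eq_lborel X) auto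
  finally have "(L2_norm \<Omega> (w T))\<^sup>2 - (L2_norm \<Omega> (w 0))\<^sup>2 = 2 * (LINT z|lebesgue_on ?X. e z * h z)"
    using energy by (simp add: L2_norm_eq_lborel w_outside)
  with w_continuous_rep[OF ae(1)] show ?thesis by (rule that)
qed

lemma AE_lebesgue_on_Ioo_meets:
  fixes P :: "real \<Rightarrow> bool"
  assumes "AE s in lebesgue_on {0<..<T}. P s" "a < b" "{a<..<b} \<subseteq> {0<..<T}"
  obtains s where "s \<in> {a<..<b}" "P s"
proof (rule ccontr)
  assume "\<not> thesis"
  then have nP: "\<not> P s" if "s \<in> {a<..<b}" for s using that \<open>\<And>s. s \<in> {a<..<b} \<Longrightarrow> P s \<Longrightarrow> thesis\<close> by blast
  have "AE s in lborel. s \<in> {0<..<T} \<longrightarrow> P s"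
    using assms(1) by (simp add: AE_lebesgue_on_iff)
  then have "AE s in lborel. s \<notin> {a<..<b}"
  proof eventually_elim
    fix s assume "s \<in> {0<..<T} \<longrightarrow> P s"
    then show "s \<notin> {a<..<b}" using nP[of s] subsetD[OF assms(3), of s] by blast
  qed
  then have "{a<..<b} \<in> null_sets lborel"
    by (subst AE_iff_null_sets) auto
  then have "emeasure lborel {a<..<b} = 0" by (rule null_setsD1)
  then show False using assms(2) by simp
qed

lemma L2_norm_add_sq_le:
  fixes f g :: "'a::euclidean_space \<Rightarrow> 'b::euclidean_space"
  assumes "f \<in> L2 S" "g \<in> L2 S"
  shows "(L2_norm S (\<lambda>x. f x + g x))\<^sup>2 \<le> 2 * (L2_norm S f)\<^sup>2 + 2 * (L2_norm S g)\<^sup>2"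
proof -
  have "(L2_norm S (\<lambda>x. f x + g x))\<^sup>2 \<le> (LINT x|lebesgue_on S. 2 * (norm (f x))\<^sup>2 + 2 * (norm (g x))\<^sup>2)"
    unfolding L2_norm_sq
    by (intro integral_mono norm_add_sq_le L2_integrable L2_add assms Bochner_Integration.integrable_add integrable_mult_right)
  also have "\<dots> = 2 * (L2_norm S f)\<^sup>2 + 2 * (L2_norm S g)\<^sup>2"
    unfolding L2_norm_sq using L2_integrable[OF assms(1)] L2_integrable[OF assms(2)]
    by (subst Bochner_Integration.integral_add) auto
  finally show ?thesis .
qed

lemma L2_norm_minus_commute: "L2_norm S (\<lambda>x. f x - g x) = L2_norm S (\<lambda>x. g x - f x)"
  by (simp add: L2_norm_def norm_minus_commute)

lemma L2_norm_cong_AE: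
  assumes "f \<in> L2 S" "g \<in> L2 S" "AE x in lebesgue_on S. f x = g x"
  shows "L2_norm S f = L2_norm S g"
  unfolding L2_norm_def
  by (intro arg_cong[where f = sqrt] integral_cong_AE)
    (use assms(3) L2_integrable[OF assms(1)] L2_integrable[OF assms(2)] in \<open>auto elim!: eventually_mono\<close>)

text \<open>
  Two representatives agree at almost every time. Such times exist arbitrarily close to any \<open>t\<close>, and
  both representatives are continuous at \<open>t\<close>.
\<close>

lemma continuous_rep_unique:
  fixes \<Omega> :: "(real^'d) set"
  assumes T: "T > 0" and w: "continuous_rep T \<Omega> f w" and w': "continuous_rep T \<Omega> f w'"
    and t: "t \<in> {0..T}"
  shows "AE x in lebesgue_on \<Omega>. w t x = w' t x"
proof -
  have L: "w s \<in> L2 \<Omega>" "w' s \<in> L2 \<Omega>" if "s \<in> {0..T}" for s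
    using w w' that by (auto simp: continuous_rep_def)
  have AE: "AE s in lebesgue_on {0<..<T}. AE x in lebesgue_on \<Omega>. w s x = w' s x"
  proof -
    have "AE s in lebesgue_on {0<..<T}. AE x in lebesgue_on \<Omega>. f (s, x) = w s x"
      "AE s in lebesgue_on {0<..<T}. AE x in lebesgue_on \<Omega>. f (s, x) = w' s x"
      using w w' by (auto simp: continuous_rep_def)
    then show ?thesis
    proof eventually_elim
      fix s assume "AE x in lebesgue_on \<Omega>. f (s, x) = w s x" "AE x in lebesgue_on \<Omega>. f (s, x) = w' s x"
      then show "AE x in lebesgue_on \<Omega>. w s x = w' s x" by eventually_elim simp
    qed
  qed
  have D: "(\<lambda>x. w t x - w' t x) \<in> L2 \<Omega>" by (intro L2_diff L t)
  have small: "(L2_norm \<Omega> (\<lambda>x. w t x - w' t x))\<^sup>2 \<le> 0 + \<epsilon>" if \<epsilon>: "\<epsilon> > 0" for \<epsilon>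
  proof -
    define r where "r = sqrt (\<epsilon> / 4)"
    have r: "r > 0" "r\<^sup>2 = \<epsilon> / 4" using \<epsilon> by (auto simp: r_def)
    have "((\<lambda>s. L2_norm \<Omega> (\<lambda>x. w s x - w t x)) \<longlongrightarrow> 0) (at t within {0..T})"
      "((\<lambda>s. L2_norm \<Omega> (\<lambda>x. w' s x - w' t x)) \<longlongrightarrow> 0) (at t within {0..T})"
      using w w' t by (auto simp: continuous_rep_def)
    then have "\<forall>\<^sub>F s in at t within {0..T}. L2_norm \<Omega> (\<lambda>x. w s x - w t x) < r"
      "\<forall>\<^sub>F s in at t within {0..T}. L2_norm \<Omega> (\<lambda>x. w' s x - w' t x) < r"
      using r(1) by (auto intro: order_tendstoD(2))
    then have "\<forall>\<^sub>F s in at t within {0..T}. L2_norm \<Omega> (\<lambda>x. w s x - w t x) < r \<and> L2_norm \<Omega> (\<lambda>x. w' s x - w' t x) < r"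
      by (rule eventually_conj)
    then obtain d where d: "d > 0" "\<And>s. s \<in> {0..T} \<Longrightarrow> s \<noteq> t \<Longrightarrow> dist s t < d \<Longrightarrow>
        L2_norm \<Omega> (\<lambda>x. w s x - w t x) < r \<and> L2_norm \<Omega> (\<lambda>x. w' s x - w' t x) < r"
      unfolding eventually_at by blast
    \<comment> \<open>An open interval of length \<open>b\<close> next to \<open>t\<close>, on its right or on its left, fits into the time
      interval and into the \<open>d\<close>-neighbourhood of \<open>t\<close>.\<close>
    define b where "b = min d T / 2"
    have b: "0 < b" "b < d" "b \<le> T / 2" using d(1) T by (auto simp: b_def)
    obtain l where l: "{l<..<l + b} \<subseteq> {0<..<T}" "\<And>s. s \<in> {l<..<l + b} \<Longrightarrow> s \<noteq> t \<and> dist s t < d"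
    proof (cases "t \<le> T / 2")
      case True
      then show ?thesis using t b by (intro that[of t]) (auto simp: dist_real_def)
    next
      case False
      then show ?thesis using t b by (intro that[of "t - b"]) (auto simp: dist_real_def)
    qed
    have "l < l + b" using b(1) by simp
    then obtain s where s: "s \<in> {l<..<l + b}" "AE x in lebesgue_on \<Omega>. w s x = w' s x"
      by (rule AE_lebesgue_on_Ioo_meets[OF AE _ l(1)]) (rule that)
    have sI: "s \<in> {0..T}" using s(1) l(1) by (auto simp: subset_iff)
    have close: "L2_norm \<Omega> (\<lambda>x. w s x - w t x) < r" "L2_norm \<Omega> (\<lambda>x. w' s x - w' t x) < r"
      using d(2)[OF sI] l(2)[OF s(1)] by auto
    have "(L2_norm \<Omega> (\<lambda>x. w t x - w' t x))\<^sup>2 = (L2_norm \<Omega> (\<lambda>x. (w t x - w s x) + (w' s x - w' t x)))\<^sup>2"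
      by (rule arg_cong[where f = "\<lambda>a. a\<^sup>2"], rule L2_norm_cong_AE[OF D])
        (use s(2) in \<open>auto intro!: L2_add L2_diff L t sI elim!: eventually_mono\<close>)
    also have "\<dots> \<le> 2 * (L2_norm \<Omega> (\<lambda>x. w t x - w s x))\<^sup>2 + 2 * (L2_norm \<Omega> (\<lambda>x. w' s x - w' t x))\<^sup>2"
      by (intro L2_norm_add_sq_le L2_diff L t sI)
    also have "\<dots> \<le> 2 * r\<^sup>2 + 2 * r\<^sup>2"
      using close unfolding L2_norm_minus_commute[of \<Omega> "w t"]
      by (intro add_mono mult_left_mono power_mono) (auto simp: L2_norm_def)
    also have "\<dots> = 0 + \<epsilon>" by (simp add: r)
    finally show ?thesis .
  qed
  have "(L2_norm \<Omega> (\<lambda>x. w t x - w' t x))\<^sup>2 \<le> 0"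
    by (rule field_le_epsilon) (rule small)
  then have "(LINT x|lebesgue_on \<Omega>. (norm (w t x - w' t x))\<^sup>2) = 0"
    by (simp add: L2_norm_sq antisym)
  then have "AE x in lebesgue_on \<Omega>. (norm (w t x - w' t x))\<^sup>2 = 0"
    by (subst (asm) integral_nonneg_eq_0_iff_AE[OF L2_integrable[OF D]]) auto
  then show ?thesis by eventually_elim simp
qed

lemma continuous_rep_diff:
  fixes \<Omega> :: "(real^'d) set"
  assumes w: "continuous_rep T \<Omega> f w" and w': "continuous_rep T \<Omega> f' w'"
  shows "continuous_rep T \<Omega> (\<lambda>z. f z - f' z) (\<lambda>t x. w t x - w' t x)"
  unfolding continuous_rep_def
proof (intro conjI ballI)
  have L: "w s \<in> L2 \<Omega>" "w' s \<in> L2 \<Omega>" if "s \<in> {0..T}" for s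
    using w w' that by (auto simp: continuous_rep_def)
  fix t assume t: "t \<in> {0..T}"
  show "(\<lambda>x. w t x - w' t x) \<in> L2 \<Omega>" by (intro L2_diff L t)
  let ?A = "\<lambda>s. L2_norm \<Omega> (\<lambda>x. w s x - w t x)" and ?B = "\<lambda>s. L2_norm \<Omega> (\<lambda>x. w' s x - w' t x)"
  have lim: "(?A \<longlongrightarrow> 0) (at t within {0..T})" "(?B \<longlongrightarrow> 0) (at t within {0..T})"
    using w w' t by (auto simp: continuous_rep_def)
  have "((\<lambda>s. sqrt (2 * (?A s)\<^sup>2 + 2 * (?B s)\<^sup>2)) \<longlongrightarrow> sqrt (2 * 0\<^sup>2 + 2 * 0\<^sup>2)) (at t within {0..T})"
    by (intro tendsto_intros lim)
  then have lim': "((\<lambda>s. sqrt (2 * (?A s)\<^sup>2 + 2 * (?B s)\<^sup>2)) \<longlongrightarrow> 0) (at t within {0..T})" by simp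
  have le: "L2_norm \<Omega> (\<lambda>x. w s x - w' s x - (w t x - w' t x)) \<le> sqrt (2 * (?A s)\<^sup>2 + 2 * (?B s)\<^sup>2)"
    if s: "s \<in> {0..T}" for s
  proof (rule real_le_rsqrt)
    have "L2_norm \<Omega> (\<lambda>x. w s x - w' s x - (w t x - w' t x)) = L2_norm \<Omega> (\<lambda>x. (w s x - w t x) + (w' t x - w' s x))"
      by (rule arg_cong[where f = "L2_norm \<Omega>"]) (simp add: fun_eq_iff)
    then show "(L2_norm \<Omega> (\<lambda>x. w s x - w' s x - (w t x - w' t x)))\<^sup>2 \<le> 2 * (?A s)\<^sup>2 + 2 * (?B s)\<^sup>2"
      using L2_norm_add_sq_le[OF L2_diff[OF L(1)[OF s] L(1)[OF t]] L2_diff[OF L(2)[OF t] L(2)[OF s]]]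
      by (simp add: L2_norm_minus_commute[of \<Omega> "w' t"])
  qed
  show "((\<lambda>s. L2_norm \<Omega> (\<lambda>x. w s x - w' s x - (w t x - w' t x))) \<longlongrightarrow> 0) (at t within {0..T})"
  proof (rule tendsto_sandwich[OF _ _ tendsto_const lim'])
    show "\<forall>\<^sub>F s in at t within {0..T}. 0 \<le> L2_norm \<Omega> (\<lambda>x. w s x - w' s x - (w t x - w' t x))"
      by (simp add: L2_norm_def)
    show "\<forall>\<^sub>F s in at t within {0..T}. L2_norm \<Omega> (\<lambda>x. w s x - w' s x - (w t x - w' t x)) \<le> sqrt (2 * (?A s)\<^sup>2 + 2 * (?B s)\<^sup>2)"
      using le by (auto simp: eventually_at_filter)
  qed
next
  have "AE s in lebesgue_on {0<..<T}. AE x in lebesgue_on \<Omega>. f (s, x) = w s x"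
    "AE s in lebesgue_on {0<..<T}. AE x in lebesgue_on \<Omega>. f' (s, x) = w' s x"
    using w w' by (auto simp: continuous_rep_def)
  then show "AE t in lebesgue_on {0<..<T}. AE x in lebesgue_on \<Omega>. f (t, x) - f' (t, x) = w t x - w' t x"
  proof eventually_elim
    fix s assume "AE x in lebesgue_on \<Omega>. f (s, x) = w s x" "AE x in lebesgue_on \<Omega>. f' (s, x) = w' s x"
    then show "AE x in lebesgue_on \<Omega>. f (s, x) - f' (s, x) = w s x - w' s x" by eventually_elim simp
  qed
qed

lemma at_time_continuous_rep: "continuous_rep T \<Omega> f w \<Longrightarrow> continuous_rep T \<Omega> f (at_time T \<Omega> f)"
  unfolding at_time_def by (rule someI[where P = "continuous_rep T \<Omega> f"])

section \<open>The error identity\<close>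

text \<open>
  Integrate over time the integration by parts at almost every fixed time.
\<close>

lemma space_integration_by_parts:
  fixes \<Omega> :: "(real^'d) set"
  assumes \<Omega>: "open \<Omega>" and e: "e \<in> L2 ({0<..<T} \<times> \<Omega>)"
    and ring: "AE t in lebesgue_on {0<..<T}. (\<lambda>x. e (t, x)) \<in> H1_ring \<Omega>"
    and G: "\<And>i. has_weak_deriv ({0<..<T} \<times> \<Omega>) (0, axis i 1) e (\<lambda>z. G z $ i)"
    and q: "q \<in> L2 ({0<..<T} \<times> \<Omega>)" and d: "has_space_div ({0<..<T} \<times> \<Omega>) q d"
  shows "(LINT z|lebesgue_on ({0<..<T} \<times> \<Omega>). q z \<bullet> G z) = - (LINT z|lebesgue_on ({0<..<T} \<times> \<Omega>). d z * e z)"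
proof -
  let ?I = "{0<..<T}" let ?X = "?I \<times> \<Omega>"
  have I: "open ?I" by simp
  have dL: "d \<in> L2 ?X" using d by (simp add: has_space_div_def)
  have "(\<lambda>z. G z $ i) \<in> L2 ?X" for i using G by (simp add: has_weak_deriv_def)
  then have GL: "G \<in> L2 ?X" using L2_vec[of "\<lambda>i z. G z $ i"] by simp
  have i1: "integrable (lebesgue_on ?X) (\<lambda>z. d z * e z)" by (rule L2_mult_integrable[OF dL e])
  have i2: "integrable (lebesgue_on ?X) (\<lambda>z. q z \<bullet> G z)" by (rule L2_inner_integrable[OF q GL])
  let ?F = "\<lambda>z. d z * e z + q z \<bullet> G z"
  have F: "integrable (lebesgue_on ?X) ?F" by (intro Bochner_Integration.integrable_add i1 i2)
  have "AE t in lebesgue_on ?I. \<forall>i. has_weak_deriv \<Omega> (axis i 1) (\<lambda>x. e (t, x)) (\<lambda>x. G (t, x) $ i)"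
    using slice_has_weak_deriv[OF \<Omega> e G] by (subst AE_all_countable) auto
  with slice_has_div[OF \<Omega> q d] ring
  have ae: "AE t in lebesgue_on ?I. (LINT x|lebesgue_on \<Omega>. ?F (t, x)) = 0"
  proof eventually_elim
    fix t assume t: "has_div \<Omega> (\<lambda>x. q (t, x)) (\<lambda>x. d (t, x))" "(\<lambda>x. e (t, x)) \<in> H1_ring \<Omega>"
      "\<forall>i. has_weak_deriv \<Omega> (axis i 1) (\<lambda>x. e (t, x)) (\<lambda>x. G (t, x) $ i)"
    show "(LINT x|lebesgue_on \<Omega>. ?F (t, x)) = 0"
      by (rule H1_ring_integration_by_parts[OF \<Omega> t(2) _ t(1)]) (use t(3) in simp)
  qed
  have "(LINT z|lebesgue_on ?X. ?F z) = (LINT t|lebesgue_on ?I. (LINT x|lebesgue_on \<Omega>. ?F (t, x)))"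
    by (rule integral_slice_integral[OF I \<Omega> F, symmetric])
  also have "\<dots> = 0"
    by (rule integral_eq_zero_AE[OF ae])
  finally show ?thesis
    using i1 i2 by simp
qed

text \<open>
  The Friedrichs inequality holds at almost every fixed time; integrate its square over time.
\<close>

lemma Friedrichs_in_space:
  fixes \<Omega> :: "(real^'d) set" and e :: "real \<times> (real^'d) \<Rightarrow> real"
  assumes \<Omega>: "open \<Omega>" and e: "e \<in> L2 ({0<..<T} \<times> \<Omega>)"
    and ring: "AE t in lebesgue_on {0<..<T}. (\<lambda>x. e (t, x)) \<in> H1_ring \<Omega>"
    and G: "\<And>i. has_weak_deriv ({0<..<T} \<times> \<Omega>) (0, axis i 1) e (\<lambda>z. G z $ i)"
    and c: "friedrichs_constant \<Omega> c"
  shows "(L2_norm ({0<..<T} \<times> \<Omega>) e)\<^sup>2 \<le> c\<^sup>2 * (L2_norm ({0<..<T} \<times> \<Omega>) G)\<^sup>2"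
proof -
  let ?I = "{0<..<T}" let ?X = "?I \<times> \<Omega>"
  have I: "open ?I" by simp
  have "(\<lambda>z. G z $ i) \<in> L2 ?X" for i using G by (simp add: has_weak_deriv_def)
  then have GL: "G \<in> L2 ?X" using L2_vec[of "\<lambda>i z. G z $ i"] by simp
  let ?F = "\<lambda>z. c\<^sup>2 * (norm (G z))\<^sup>2 - (norm (e z))\<^sup>2"
  have F: "integrable (lebesgue_on ?X) ?F"
    by (intro Bochner_Integration.integrable_diff integrable_mult_right L2_integrable GL e)
  have "AE t in lebesgue_on ?I. \<forall>i. has_weak_deriv \<Omega> (axis i 1) (\<lambda>x. e (t, x)) (\<lambda>x. G (t, x) $ i)"
    using slice_has_weak_deriv[OF \<Omega> e G] by (subst AE_all_countable) auto
  with ring have ae: "AE t in lebesgue_on ?I. 0 \<le> (LINT x|lebesgue_on \<Omega>. ?F (t, x))"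
  proof eventually_elim
    fix t assume t: "(\<lambda>x. e (t, x)) \<in> H1_ring \<Omega>"
      and "\<forall>i. has_weak_deriv \<Omega> (axis i 1) (\<lambda>x. e (t, x)) (\<lambda>x. G (t, x) $ i)"
    then have D: "has_weak_deriv \<Omega> (axis i 1) (\<lambda>x. e (t, x)) (\<lambda>x. G (t, x) $ i)" for i by simp
    have eL: "(\<lambda>x. e (t, x)) \<in> L2 \<Omega>" using t by (simp add: H1_ring_def H1_def)
    note N = H1_norm_sq[OF \<Omega> eL D]
    have "L2_norm \<Omega> (\<lambda>x. e (t, x)) \<le> c * L2_norm \<Omega> (wgrad \<Omega> (\<lambda>x. e (t, x)))"
      using c t by (simp add: friedrichs_constant_def)
    also have "L2_norm \<Omega> (wgrad \<Omega> (\<lambda>x. e (t, x))) = L2_norm \<Omega> (\<lambda>x. G (t, x))"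
      by (rule L2_norm_cong_AE[OF N(4,3,2)])
    finally have "(L2_norm \<Omega> (\<lambda>x. e (t, x)))\<^sup>2 \<le> (c * L2_norm \<Omega> (\<lambda>x. G (t, x)))\<^sup>2"
      by (rule power_mono[OF _ L2_norm_nonneg])
    then show "0 \<le> (LINT x|lebesgue_on \<Omega>. ?F (t, x))"
      unfolding power_mult_distrib L2_norm_sq
      using L2_integrable[OF eL] L2_integrable[OF N(3)]
      by (subst Bochner_Integration.integral_diff) auto
  qed
  have "0 \<le> (LINT t|lebesgue_on ?I. (LINT x|lebesgue_on \<Omega>. ?F (t, x)))"
    by (rule integral_nonneg_AE[OF ae])
  also have "\<dots> = (LINT z|lebesgue_on ?X. ?F z)"
    by (rule integral_slice_integral[OF I \<Omega> F])
  also have "\<dots> = c\<^sup>2 * (L2_norm ?X G)\<^sup>2 - (L2_norm ?X e)\<^sup>2"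
    unfolding L2_norm_sq using L2_integrable[OF e] L2_integrable[OF GL]
    by (subst Bochner_Integration.integral_diff) auto
  finally show ?thesis by simp
qed

lemma integral_Young:
  fixes f g :: "'a::euclidean_space \<Rightarrow> real"
  assumes "f \<in> L2 S" "g \<in> L2 S" "r > 0"
  shows "2 * \<bar>LINT x|lebesgue_on S. f x * g x\<bar> \<le> (L2_norm S f)\<^sup>2 / r + r * (L2_norm S g)\<^sup>2"
proof -
  have y: "2 * \<bar>a * b\<bar> \<le> inverse r * (norm a)\<^sup>2 + r * (norm b)\<^sup>2" for a b :: real
  proof -
    have "0 \<le> (\<bar>a\<bar> - r * \<bar>b\<bar>)\<^sup>2 / r" using assms(3) by simp
    also have "\<dots> = inverse r * (norm a)\<^sup>2 + r * (norm b)\<^sup>2 - 2 * \<bar>a * b\<bar>"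
      using assms(3) by (simp add: power2_diff power_mult_distrib abs_mult field_simps power2_eq_square)
    finally show ?thesis by simp
  qed
  have "2 * \<bar>LINT x|lebesgue_on S. f x * g x\<bar> \<le> 2 * (LINT x|lebesgue_on S. \<bar>f x * g x\<bar>)"
    by simp
  also have "\<dots> = (LINT x|lebesgue_on S. 2 * \<bar>f x * g x\<bar>)" by simp
  also have "\<dots> \<le> (LINT x|lebesgue_on S. inverse r * (norm (f x))\<^sup>2 + r * (norm (g x))\<^sup>2)"
  proof (rule integral_mono[OF _ _ y])
    show "integrable (lebesgue_on S) (\<lambda>x. 2 * \<bar>f x * g x\<bar>)"
      by (intro integrable_mult_right integrable_abs L2_mult_integrable assms)
    show "integrable (lebesgue_on S) (\<lambda>x. inverse r * (norm (f x))\<^sup>2 + r * (norm (g x))\<^sup>2)"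
      by (intro Bochner_Integration.integrable_add integrable_mult_right L2_integrable assms)
  qed
  also have "\<dots> = (L2_norm S f)\<^sup>2 / r + r * (L2_norm S g)\<^sup>2"
    unfolding L2_norm_sq using L2_integrable[OF assms(1)] L2_integrable[OF assms(2)]
    by (subst Bochner_Integration.integral_add) (auto simp: divide_inverse mult.commute)
  finally show ?thesis .
qed

lemma L2_norm_diff_sq:
  fixes f g :: "'a::euclidean_space \<Rightarrow> 'b::euclidean_space"
  assumes f: "f \<in> L2 S" and g: "g \<in> L2 S"
  shows "(L2_norm S (\<lambda>x. f x - g x))\<^sup>2 =
    (L2_norm S f)\<^sup>2 + (L2_norm S g)\<^sup>2 - 2 * (LINT x|lebesgue_on S. g x \<bullet> f x)"
proof -
  have "(\<lambda>x. (norm (f x - g x))\<^sup>2) = (\<lambda>x. (norm (f x))\<^sup>2 + (norm (g x))\<^sup>2 - 2 * (g x \<bullet> f x))"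
    by (simp add: power2_norm_eq_inner inner_diff_left inner_diff_right inner_commute algebra_simps)
  then show ?thesis
    unfolding L2_norm_sq
    using L2_integrable[OF f] L2_integrable[OF g] L2_inner_integrable[OF g f] by simp
qed

text \<open>
  The arithmetic behind the theorem. Here \<open>a\<close>, \<open>b\<close>, \<open>r\<close>, \<open>s\<close> are the four terms of the error, \<open>n\<close> is the
  squared norm of \<open>e\<close>, \<open>J\<close> its inner product with \<open>R\<close>, \<open>Y\<close> the squared flux residual and \<open>s\<^sub>0\<close> the squared
  initial error. The first condition on \<open>Y\<close> is the error identity. The two bounds for \<open>J\<close> are Young
  inequalities: with weight \<open>1\<close> for the lower estimate, and with weight \<open>2 c\<^sup>2\<close> for the upper one, which
  by the Friedrichs inequality costs exactly half of \<open>a\<close>.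
\<close>

lemma two_sided_bound:
  fixes a b r s s\<^sub>0 n J Y c :: real
  assumes nonneg: "0 \<le> a" "0 \<le> b" "0 \<le> r" "0 \<le> s" "0 < c"
    and n: "n \<le> c\<^sup>2 * a"
    and J: "2 * \<bar>J\<bar> \<le> n + r" "2 * \<bar>J\<bar> \<le> n / (2 * c\<^sup>2) + 2 * c\<^sup>2 * r"
    and Y: "Y + s\<^sub>0 = a + b + s - 2 * J" "Y \<le> 2 * a + 2 * b"
  shows "max (r + 1/2 * Y) (1 / (1 + c\<^sup>2) * (Y + s\<^sub>0)) \<le> a + b + r + s"
    and "a + b + r + s \<le> (1 + 4 * c\<^sup>2) * r + 2 * Y + 2 * s\<^sub>0"
proof -
  have c2: "c\<^sup>2 > 0" using nonneg by simp
  have "Y + s\<^sub>0 \<le> a + b + s + (c\<^sup>2 * a + r)" using Y(1) J(1) n by linarith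
  also have "\<dots> \<le> (1 + c\<^sup>2) * (a + b + r + s)"
    using mult_nonneg_nonneg[of "c\<^sup>2" b] mult_nonneg_nonneg[of "c\<^sup>2" r] mult_nonneg_nonneg[of "c\<^sup>2" s] nonneg
    by (simp add: algebra_simps)
  finally have "1 / (1 + c\<^sup>2) * (Y + s\<^sub>0) \<le> a + b + r + s"
    using pos_divide_le_eq[of "1 + c\<^sup>2" "Y + s\<^sub>0" "a + b + r + s"] c2 by (simp add: mult.commute)
  then show "max (r + 1/2 * Y) (1 / (1 + c\<^sup>2) * (Y + s\<^sub>0)) \<le> a + b + r + s"
    using Y(2) nonneg by simp
  have "n / (2 * c\<^sup>2) \<le> a / 2" using n c2 by (simp add: field_simps)
  then have "a + b + s \<le> Y + s\<^sub>0 + a / 2 + 2 * c\<^sup>2 * r" using Y(1) J(2) by linarith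
  then show "a + b + r + s \<le> (1 + 4 * c\<^sup>2) * r + 2 * Y + 2 * s\<^sub>0"
    using nonneg by (simp add: algebra_simps)
qed

lemma H11_ringD:
  fixes \<Omega> :: "(real^'d) set"
  assumes "u \<in> H11_ring T \<Omega>"
  shows "u \<in> L2 ({0<..<T} \<times> \<Omega>)"
    and "AE t in lebesgue_on {0<..<T}. (\<lambda>x. u (t, x)) \<in> H1_ring \<Omega>"
    and "has_weak_deriv ({0<..<T} \<times> \<Omega>) (0, axis i 1) u (\<lambda>z. space_grad ({0<..<T} \<times> \<Omega>) u z $ i)"
    and "has_weak_deriv ({0<..<T} \<times> \<Omega>) (1, 0) u (time_deriv ({0<..<T} \<times> \<Omega>) u)"
  using assms
  by (auto simp: H11_ring_def H01_ring_def H01_def H10_def space_grad_def time_deriv_def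
      intro: weak_deriv_has_weak_deriv)

lemma D_spaceD:
  assumes "p \<in> D_space \<Xi>"
  shows "p \<in> L2 \<Xi>" "has_space_div \<Xi> p (space_div \<Xi> p)"
  using assms by (auto simp: D_space_def intro: space_div_has_space_div)

theorem theorem3p7:
  fixes \<Omega> :: "(real^'d) set" and \<Xi> :: "(real \<times> (real^'d)) set"
    and T c\<^sub>f E :: real
    and f u u' :: "real \<times> (real^'d) \<Rightarrow> real"
    and p p' :: "real \<times> (real^'d) \<Rightarrow> real^'d"
    and u0 :: "real^'d \<Rightarrow> real"
  assumes "open \<Omega>" and "connected \<Omega>" and "\<Omega> \<noteq> {}"
    and "bounded_in_one_direction \<Omega>"
    and "friedrichs_constant \<Omega> c\<^sub>f"
    and "T > 0"
    and "\<Xi> = {0<..<T} \<times> \<Omega>"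
    and "f \<in> L2 \<Xi>"
    and "u0 \<in> H1_ring \<Omega>"
    and "heat_solution T \<Omega> f u0 u p"
    and "u' \<in> H11_ring T \<Omega>" and "p' \<in> D_space \<Xi>"
    and "E = (L2_norm \<Xi> (space_grad \<Xi> (\<lambda>z. u z - u' z)))\<^sup>2
           + (L2_norm \<Xi> (\<lambda>z. p z - p' z))\<^sup>2
           + (L2_norm \<Xi> (\<lambda>z. time_deriv \<Xi> (\<lambda>z. u z - u' z) z
                              + space_div \<Xi> (\<lambda>z. p' z - p z) z))\<^sup>2
           + (L2_norm \<Omega> (at_time T \<Omega> (\<lambda>z. u z - u' z) T))\<^sup>2"
  shows "max ((L2_norm \<Xi> (\<lambda>z. f z + space_div \<Xi> p' z - time_deriv \<Xi> u' z))\<^sup>2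
                + 1/2 * (L2_norm \<Xi> (\<lambda>z. p' z - space_grad \<Xi> u' z))\<^sup>2)
             (1 / (1 + c\<^sub>f\<^sup>2) *
                ((L2_norm \<Xi> (\<lambda>z. p' z - space_grad \<Xi> u' z))\<^sup>2
                 + (L2_norm \<Omega> (\<lambda>x. u0 x - at_time T \<Omega> u' 0 x))\<^sup>2)) \<le> E
       \<and> E \<le> (1 + 4 * c\<^sub>f\<^sup>2) *
                (L2_norm \<Xi> (\<lambda>z. f z + space_div \<Xi> p' z - time_deriv \<Xi> u' z))\<^sup>2
              + 2 * (L2_norm \<Xi> (\<lambda>z. p' z - space_grad \<Xi> u' z))\<^sup>2
              + 2 * (L2_norm \<Omega> (\<lambda>x. u0 x - at_time T \<Omega> u' 0 x))\<^sup>2"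
proof -
  have \<Omega>: "open \<Omega>" and c: "friedrichs_constant \<Omega> c\<^sub>f" and T: "T > 0" and \<Xi>: "\<Xi> = {0<..<T} \<times> \<Omega>"
    by fact+
  have X: "open \<Xi>" unfolding \<Xi> by (intro open_Times \<Omega>) auto
  have u: "u \<in> H11_ring T \<Omega>" and p: "p \<in> D_space \<Xi>"
    and eq1: "AE z in lebesgue_on \<Xi>. - space_grad \<Xi> u z + p z = 0"
    and eq2: "AE z in lebesgue_on \<Xi>. time_deriv \<Xi> u z - space_div \<Xi> p z = f z"
    and eq3: "AE x in lebesgue_on \<Omega>. at_time T \<Omega> u 0 x = u0 x"
    using \<open>heat_solution T \<Omega> f u0 u p\<close> unfolding heat_solution_def \<Xi> by auto
  note U = H11_ringD[OF u, folded \<Xi>] and U' = H11_ringD[OF \<open>u' \<in> H11_ring T \<Omega>\<close>, folded \<Xi>]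
  note P = D_spaceD[OF p] and P' = D_spaceD[OF \<open>p' \<in> D_space \<Xi>\<close>]
  define e where "e = (\<lambda>z. u z - u' z)"
  define q where "q = (\<lambda>z. p z - p' z)"
  define G where "G = (\<lambda>z. space_grad \<Xi> u z - space_grad \<Xi> u' z)"
  define h where "h = (\<lambda>z. time_deriv \<Xi> u z - time_deriv \<Xi> u' z)"
  define d where "d = (\<lambda>z. space_div \<Xi> p z - space_div \<Xi> p' z)"
  define R where "R = (\<lambda>z. h z - d z)"
  have eL: "e \<in> L2 \<Xi>" unfolding e_def by (rule L2_diff[OF U(1) U'(1)])
  have qL: "q \<in> L2 \<Xi>" unfolding q_def by (rule L2_diff[OF P(1) P'(1)])
  have eG: "has_weak_deriv \<Xi> (0, axis i 1) e (\<lambda>z. G z $ i)" for i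
    using has_weak_deriv_diff[OF X U(1) U'(1) U(3) U'(3)] by (simp add: e_def G_def)
  have eh: "has_weak_deriv \<Xi> (1, 0) e h"
    unfolding e_def h_def by (rule has_weak_deriv_diff[OF X U(1) U'(1) U(4) U'(4)])
  have qd: "has_space_div \<Xi> q d"
    unfolding q_def d_def by (rule has_space_div_diff[OF X P(1) P'(1) P(2) P'(2)])
  have ring: "AE t in lebesgue_on {0<..<T}. (\<lambda>x. e (t, x)) \<in> H1_ring \<Omega>"
    using U(2) U'(2) by eventually_elim (simp add: e_def H1_ring_diff[OF \<Omega>])
  have hL: "h \<in> L2 \<Xi>" and dL: "d \<in> L2 \<Xi>"
    using eh qd by (auto simp: has_weak_deriv_def has_space_div_def)
  have RL: "R \<in> L2 \<Xi>" unfolding R_def by (rule L2_diff[OF hL dL])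
  have "(\<lambda>z. G z $ i) \<in> L2 \<Xi>" for i using eG by (simp add: has_weak_deriv_def)
  then have GL: "G \<in> L2 \<Xi>" using L2_vec[of "\<lambda>i z. G z $ i"] by simp
  have wL: "weak_deriv \<Xi> v g \<in> L2 \<Xi>" if "has_weak_deriv \<Xi> v g k" for v g k
    using weak_deriv_has_weak_deriv[OF that] by (simp add: has_weak_deriv_def)
  let ?J = "LINT z|lebesgue_on \<Xi>. e z * R z"

  \<comment> \<open>The chosen weak derivatives of the differences agree almost everywhere with the differences of the
    chosen weak derivatives, so all norms in the claim can be expressed by \<open>G\<close>, \<open>q\<close>, \<open>R\<close>.\<close>
  have grad: "L2_norm \<Xi> (space_grad \<Xi> (\<lambda>z. u z - u' z)) = L2_norm \<Xi> G"
  proof (rule L2_norm_cong_AE[OF _ GL])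
    show "space_grad \<Xi> (\<lambda>z. u z - u' z) \<in> L2 \<Xi>"
      unfolding space_grad_def e_def[symmetric] by (intro L2_vec wL[OF eG])
    have "AE z in lebesgue_on \<Xi>. \<forall>i. weak_deriv \<Xi> (0, axis i 1) e z = G z $ i"
      using weak_deriv_AE_eq[OF X eG] by (subst AE_all_countable) auto
    then show "AE z in lebesgue_on \<Xi>. space_grad \<Xi> (\<lambda>z. u z - u' z) z = G z"
      unfolding space_grad_def e_def[symmetric] by eventually_elim (simp add: vec_eq_iff)
  qed
  have resid: "L2_norm \<Xi> (\<lambda>z. time_deriv \<Xi> (\<lambda>z. u z - u' z) z + space_div \<Xi> (\<lambda>z. p' z - p z) z) = L2_norm \<Xi> R"
  proof (rule L2_norm_cong_AE[OF _ RL])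
    note qd' = has_space_div_diff[OF X P'(1) P(1) P'(2) P(2)]
    have "space_div \<Xi> (\<lambda>z. p' z - p z) \<in> L2 \<Xi>"
      using space_div_has_space_div[OF qd'] by (simp add: has_space_div_def)
    then show "(\<lambda>z. time_deriv \<Xi> (\<lambda>z. u z - u' z) z + space_div \<Xi> (\<lambda>z. p' z - p z) z) \<in> L2 \<Xi>"
      unfolding time_deriv_def e_def[symmetric] by (intro L2_add wL[OF eh])
    show "AE z in lebesgue_on \<Xi>. time_deriv \<Xi> (\<lambda>z. u z - u' z) z + space_div \<Xi> (\<lambda>z. p' z - p z) z = R z"
      using weak_deriv_AE_eq[OF X eh] space_div_AE_eq[OF X qd']
      by eventually_elim (simp add: time_deriv_def[of \<Xi> e] R_def d_def flip: e_def)
  qed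
  have data: "L2_norm \<Xi> (\<lambda>z. f z + space_div \<Xi> p' z - time_deriv \<Xi> u' z) = L2_norm \<Xi> R"
  proof (rule L2_norm_cong_AE[OF _ RL])
    show "(\<lambda>z. f z + space_div \<Xi> p' z - time_deriv \<Xi> u' z) \<in> L2 \<Xi>"
      using P'(2) U'(4) \<open>f \<in> L2 \<Xi>\<close> by (intro L2_diff L2_add) (auto simp: has_space_div_def has_weak_deriv_def)
    show "AE z in lebesgue_on \<Xi>. f z + space_div \<Xi> p' z - time_deriv \<Xi> u' z = R z"
      using eq2 by eventually_elim (simp add: R_def h_def d_def)
  qed
  have flux: "L2_norm \<Xi> (\<lambda>z. p' z - space_grad \<Xi> u' z) = L2_norm \<Xi> (\<lambda>z. G z - q z)"
  proof (rule L2_norm_cong_AE[OF _ L2_diff[OF GL qL]])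
    have "space_grad \<Xi> u' \<in> L2 \<Xi>"
      unfolding space_grad_def by (intro L2_vec wL[OF U'(3)])
    then show "(\<lambda>z. p' z - space_grad \<Xi> u' z) \<in> L2 \<Xi>" by (rule L2_diff[OF P'(1)])
    show "AE z in lebesgue_on \<Xi>. p' z - space_grad \<Xi> u' z = G z - q z"
      using eq1 by eventually_elim (simp add: G_def q_def algebra_simps)
  qed

  \<comment> \<open>The traces of \<open>e\<close> at the end points are those of \<open>w\<close>; the initial one is known from the data
    because the trace of a difference is the difference of the traces.\<close>
  obtain w where w: "continuous_rep T \<Omega> e w"
    and w_energy: "(L2_norm \<Omega> (w T))\<^sup>2 - (L2_norm \<Omega> (w 0))\<^sup>2 = 2 * (LINT z|lebesgue_on \<Xi>. e z * h z)"
    using continuous_rep_exists[OF \<Omega> T eL[unfolded \<Xi>] eh[unfolded \<Xi>], folded \<Xi>] .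
  obtain wu where wu: "continuous_rep T \<Omega> u wu"
    using continuous_rep_exists[OF \<Omega> T U(1)[unfolded \<Xi>] U(4)[unfolded \<Xi>]] .
  obtain wu' where wu': "continuous_rep T \<Omega> u' wu'"
    using continuous_rep_exists[OF \<Omega> T U'(1)[unfolded \<Xi>] U'(4)[unfolded \<Xi>]] .
  have rep_L2: "k t \<in> L2 \<Omega>" if "continuous_rep T \<Omega> g k" "t \<in> {0..T}" for g k t
    using that by (auto simp: continuous_rep_def)
  have T0: "0 \<in> {0..T}" "T \<in> {0..T}" using T by auto
  have final: "L2_norm \<Omega> (at_time T \<Omega> (\<lambda>z. u z - u' z) T) = L2_norm \<Omega> (w T)"
    unfolding e_def[symmetric]
    by (rule L2_norm_cong_AE[OF rep_L2[OF at_time_continuous_rep[OF w] T0(2)] rep_L2[OF w T0(2)]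
          continuous_rep_unique[OF T at_time_continuous_rep[OF w] w T0(2)]])
  have initial: "L2_norm \<Omega> (\<lambda>x. u0 x - at_time T \<Omega> u' 0 x) = L2_norm \<Omega> (w 0)"
  proof (rule L2_norm_cong_AE[OF _ rep_L2[OF w T0(1)]])
    note r = at_time_continuous_rep[OF wu] at_time_continuous_rep[OF wu']
    have "u0 \<in> L2 \<Omega>" using \<open>u0 \<in> H1_ring \<Omega>\<close> by (simp add: H1_ring_def H1_def)
    then show "(\<lambda>x. u0 x - at_time T \<Omega> u' 0 x) \<in> L2 \<Omega>"
      by (rule L2_diff[OF _ rep_L2[OF r(2) T0(1)]])
    have "AE x in lebesgue_on \<Omega>. at_time T \<Omega> u 0 x - at_time T \<Omega> u' 0 x = w 0 x"
      using continuous_rep_unique[OF T continuous_rep_diff[OF r] w[unfolded e_def] T0(1)] .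
    with eq3 show "AE x in lebesgue_on \<Omega>. u0 x - at_time T \<Omega> u' 0 x = w 0 x"
      by eventually_elim simp
  qed

  \<comment> \<open>The error identity \<open>Y1\<close>, from integration by parts in space and in time.\<close>
  have "(LINT z|lebesgue_on \<Xi>. q z \<bullet> G z) = - (LINT z|lebesgue_on \<Xi>. d z * e z)"
    using space_integration_by_parts[OF \<Omega> eL[unfolded \<Xi>] ring eG[unfolded \<Xi>] qL[unfolded \<Xi>] qd[unfolded \<Xi>], folded \<Xi>] .
  moreover have "?J = (LINT z|lebesgue_on \<Xi>. e z * h z) - (LINT z|lebesgue_on \<Xi>. d z * e z)"
    unfolding R_def right_diff_distrib mult.commute[of "d _"]
    by (rule Bochner_Integration.integral_diff[OF L2_mult_integrable[OF eL hL] L2_mult_integrable[OF eL dL]])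
  ultimately have inner: "2 * (LINT z|lebesgue_on \<Xi>. q z \<bullet> G z) =
      2 * ?J - (L2_norm \<Omega> (w T))\<^sup>2 + (L2_norm \<Omega> (w 0))\<^sup>2"
    using w_energy by simp
  let ?Y = "(L2_norm \<Xi> (\<lambda>z. G z - q z))\<^sup>2"
  have Y1: "?Y + (L2_norm \<Omega> (w 0))\<^sup>2 = (L2_norm \<Xi> G)\<^sup>2 + (L2_norm \<Xi> q)\<^sup>2 + (L2_norm \<Omega> (w T))\<^sup>2 - 2 * ?J"
    using L2_norm_diff_sq[OF GL qL] inner by simp
  have Y2: "?Y \<le> 2 * (L2_norm \<Xi> G)\<^sup>2 + 2 * (L2_norm \<Xi> q)\<^sup>2"
    using L2_norm_add_sq_le[OF GL L2_scale[OF qL, of "-1"]] by (simp add: L2_norm_def)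
  have cpos: "c\<^sub>f > 0" using c by (simp add: friedrichs_constant_def)
  have n: "(L2_norm \<Xi> e)\<^sup>2 \<le> c\<^sub>f\<^sup>2 * (L2_norm \<Xi> G)\<^sup>2"
    using Friedrichs_in_space[OF \<Omega> eL[unfolded \<Xi>] ring eG[unfolded \<Xi>] c, folded \<Xi>] .
  have J1: "2 * \<bar>?J\<bar> \<le> (L2_norm \<Xi> e)\<^sup>2 + (L2_norm \<Xi> R)\<^sup>2"
    using integral_Young[OF eL RL, of 1] by simp
  have J2: "2 * \<bar>?J\<bar> \<le> (L2_norm \<Xi> e)\<^sup>2 / (2 * c\<^sub>f\<^sup>2) + 2 * c\<^sub>f\<^sup>2 * (L2_norm \<Xi> R)\<^sup>2"
    using cpos by (intro integral_Young[OF eL RL]) auto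
  note bounds = two_sided_bound[OF zero_le_power2 zero_le_power2 zero_le_power2 zero_le_power2 cpos n J1 J2 Y1 Y2]
  have E: "E = (L2_norm \<Xi> G)\<^sup>2 + (L2_norm \<Xi> q)\<^sup>2 + (L2_norm \<Xi> R)\<^sup>2 + (L2_norm \<Omega> (w T))\<^sup>2"
    using \<open>E = _\<close> by (simp only: grad resid final q_def)
  show ?thesis
    unfolding E data flux initial using bounds by (intro conjI)
qed

end
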